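(* Let $\beta_j=P_{j,2}(q_1)$ for $j\ge0$ and suppose that $\beta_j\ne0$ for every $j\ge0$. For any $n\ge0$, take $x_i=F_0^{i-1}(q_1)$ for $1\le i\le2n+2$ and $x_i=F_0^{i-2n-3}(q_2)$ for $2n+3\le i\le3n+3$. Then the $(3n+3)\times(3n+3)$ interpolation matrix $M_n$ whose $i$-th row consists of the values $P_{j,k}(x_i)$, $0\le j\le n$, $1\le k\le3$ (in a fixed order of the pairs $(j,k)$), is invertible.
   Context: Sierpinski gasket: let $q_0=(\tfrac12,\tfrac{\sqrt3}{2})$, $q_1=(0,0)$, $q_2=(1,0)$, $V_0=\{q_0,q_1,q_2\}$, $F_i(x)=\tfrac12(x-q_i)+q_i$ ($F_0^r$ is the $r$-fold iterate), and let $SG\subset\mathbb R^2$ be the unique nonempty compact set with $SG=\bigcup_{i=0}^2F_i(SG)$. For a word $w=(w_1,\dots,w_m)\in\{0,1,2\}^m$, $|w|=m$, put $F_w=F_{w_1}\circ\cdots\circ F_{w_m}$; $F_w(SG)$ is called an $m$-cell; $V_m=\bigcup_{|w|=m}F_w(V_0)$; distinct $x,y\in V_m$ satisfy $x\sim_m y$ if they lie in a common $m$-cell. $\mu$ is the self-similar Borel probability measure with $\mu(F_w(SG))=3^{-|w|}$. All functions are real-valued. Energy and Laplacian: $\mathscr E(u,v)=\lim_{m\to\infty}(3/5)^{-m}\sum_{x\sim_m y}(u(x)-u(y))(v(x)-v(y))$ (sum over unordered pairs), and $u\in\operatorname{dom}\mathscr E$ if $\mathscr E(u,u)$ exists and is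 finite. For $u\in\operatorname{dom}\mathscr E$ and $f$ continuous, $\Delta u=f$ means $\mathscr E(u,v)=-\int_{SG}fv\,d\mu$ for all $v\in\operatorname{dom}\mathscr E$ vanishing on $V_0$. Indices of $q_i$ are mod 3. Normal derivative: $\partial_nu(q_i)=\lim_m(5/3)^m(2u(q_i)-u(F_i^mq_{i+1})-u(F_i^mq_{i-1}))$. Tangential derivative: $\partial_Tu(q_i)=\lim_m5^m(u(F_i^mq_{i+1})-u(F_i^mq_{i-1}))$. Monomials: for $j\ge0$, $k\in\{1,2,3\}$, $P_{j,k}$ is the unique function with $\Delta^{j+1}P_{j,k}=0$ such that for all $0\le n\le j$: $\Delta^nP_{j,k}(q_0)=\delta_{nj}\delta_{k1}$, $\partial_n\Delta^nP_{j,k}(q_0)=\delta_{nj}\delta_{k2}$, $\partial_T\Delta^nP_{j,k}(q_0)=\delta_{nj}\delta_{k3}$. *)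

theory Defs
  imports "HOL-Probability.Probability_Measure" "Jordan_Normal_Form.Matrix"
begin

type_synonym point = "real \<times> real"

text \<open>Indices are read modulo 3, so \<open>i + 2\<close> plays the role of \<open>i - 1\<close> below.\<close>

definition vertex :: "nat \<Rightarrow> point" where
  "vertex i = (if i mod 3 = 0 then (1/2, sqrt 3 / 2) else if i mod 3 = 1 then (0, 0) else (1, 0))"

definition contraction :: "nat \<Rightarrow> point \<Rightarrow> point" where
  "contraction i x = (1/2) *\<^sub>R (x - vertex i) + vertex i"

definition gasket :: "point set" where
  "gasket = (THE K. compact K \<and> K \<noteq> {} \<and> K = (\<Union>i\<in>{0,1,2}. contraction i ` K))"

definition words :: "nat \<Rightarrow> nat list set" where
  "words m = {w. length w = m \<and> set w \<subseteq> {0,1,2}}"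

definition word_map :: "nat list \<Rightarrow> point \<Rightarrow> point" where
  "word_map w = foldr (\<lambda>i g. contraction i \<circ> g) w id"

definition V :: "nat \<Rightarrow> point set" where
  "V m = (\<Union>w\<in>words m. word_map w ` {vertex 0, vertex 1, vertex 2})"

definition adjacent :: "nat \<Rightarrow> point \<Rightarrow> point \<Rightarrow> bool" where
  "adjacent m x y \<longleftrightarrow> x \<in> V m \<and> y \<in> V m \<and> x \<noteq> y \<and>
     (\<exists>w\<in>words m. x \<in> word_map w ` gasket \<and> y \<in> word_map w ` gasket)"

text \<open>
  The measure lives on the Borel sets of the plane; the empty word gives the gasket measure 1.
\<close>

definition gasket_measure :: "point measure \<Rightarrow> bool" where
  "gasket_measure \<mu> \<longleftrightarrow> prob_space \<mu> \<and> sets \<mu> = sets borel \<and>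
     (\<forall>A\<in>sets borel. measure \<mu> A = (\<Sum>i\<in>{0,1,2}. 1/3 * measure \<mu> (contraction i -` A))) \<and>
     (\<forall>m. \<forall>w\<in>words m. measure \<mu> (word_map w ` gasket) = (1/3) ^ m)"

text \<open>
  Functions on the gasket are represented by functions on the plane of which only the values on
  the gasket matter. The sum below runs over ordered pairs, whence the factor 1/2.
\<close>

definition graph_energy :: "nat \<Rightarrow> (point \<Rightarrow> real) \<Rightarrow> (point \<Rightarrow> real) \<Rightarrow> real" where
  "graph_energy m u v =
     (5/3) ^ m * (1/2 * (\<Sum>(x, y)\<in>{(x, y). adjacent m x y}. (u x - u y) * (v x - v y)))"

definition energy :: "(point \<Rightarrow> real) \<Rightarrow> (point \<Rightarrow> real) \<Rightarrow> real" where
  "energy u v = lim (\<lambda>m. graph_energy m u v)"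

text \<open>
  The energy only sees the values of a function on the countable set of all vertices, so
  continuity has to be part of the domain: otherwise a test function could be changed
  arbitrarily off that set, and only the zero function could be a Laplacian.
\<close>

definition energy_domain :: "(point \<Rightarrow> real) set" where
  "energy_domain = {u. continuous_on gasket u \<and> convergent (\<lambda>m. graph_energy m u u)}"

definition has_laplacian :: "point measure \<Rightarrow> (point \<Rightarrow> real) \<Rightarrow> (point \<Rightarrow> real) \<Rightarrow> bool" where
  "has_laplacian \<mu> u f \<longleftrightarrow> u \<in> energy_domain \<and> continuous_on gasket f \<and>
     (\<forall>v\<in>energy_domain. (\<forall>x\<in>V 0. v x = 0) \<longrightarrow>
        energy u v = - (LINT x:gasket|\<mu>. f x * v x))"

text \<open>\<open>has_laplacian_power \<mu> n u f\<close> means that the \<open>n\<close>-th power of the Laplacian maps \<open>u\<close> to \<open>f\<close>.\<close>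

primrec has_laplacian_power ::
    "point measure \<Rightarrow> nat \<Rightarrow> (point \<Rightarrow> real) \<Rightarrow> (point \<Rightarrow> real) \<Rightarrow> bool" where
  "has_laplacian_power \<mu> 0 u f \<longleftrightarrow> (\<forall>x\<in>gasket. f x = u x)"
| "has_laplacian_power \<mu> (Suc n) u f \<longleftrightarrow>
     (\<exists>g. has_laplacian_power \<mu> n u g \<and> has_laplacian \<mu> g f)"

definition has_normal_derivative :: "(point \<Rightarrow> real) \<Rightarrow> nat \<Rightarrow> real \<Rightarrow> bool" where
  "has_normal_derivative u i d \<longleftrightarrow>
     (\<lambda>m. (5/3) ^ m * (2 * u (vertex i) - u ((contraction i ^^ m) (vertex (i + 1)))
                         - u ((contraction i ^^ m) (vertex (i + 2))))) \<longlonglongrightarrow> d"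

definition has_tangential_derivative :: "(point \<Rightarrow> real) \<Rightarrow> nat \<Rightarrow> real \<Rightarrow> bool" where
  "has_tangential_derivative u i d \<longleftrightarrow>
     (\<lambda>m. 5 ^ m * (u ((contraction i ^^ m) (vertex (i + 1)))
                 - u ((contraction i ^^ m) (vertex (i + 2))))) \<longlonglongrightarrow> d"

definition is_monomial :: "point measure \<Rightarrow> nat \<Rightarrow> nat \<Rightarrow> (point \<Rightarrow> real) \<Rightarrow> bool" where
  "is_monomial \<mu> j k u \<longleftrightarrow> has_laplacian_power \<mu> (j + 1) u (\<lambda>_. 0) \<and>
     (\<forall>n\<le>j. \<exists>f. has_laplacian_power \<mu> n u f \<and>
        f (vertex 0) = of_bool (n = j \<and> k = 1) \<and>
        has_normal_derivative f 0 (of_bool (n = j \<and> k = 2)) \<and>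
        has_tangential_derivative f 0 (of_bool (n = j \<and> k = 3)))"

text \<open>The interpolation points, numbered from 1 to \<open>3 * n + 3\<close>.\<close>

definition interp_point :: "nat \<Rightarrow> nat \<Rightarrow> point" where
  "interp_point n i =
     (if i \<le> 2 * n + 2 then (contraction 0 ^^ (i - 1)) (vertex 1)
      else (contraction 0 ^^ (i - 2 * n - 3)) (vertex 2))"

text \<open>
  The enumeration \<open>\<sigma>\<close> of the index pairs \<open>(j, k)\<close> fixes the order of the columns. Matrix indices
  start at 0.
\<close>

definition interp_matrix ::
    "(nat \<Rightarrow> nat \<Rightarrow> point \<Rightarrow> real) \<Rightarrow> (nat \<Rightarrow> nat \<times> nat) \<Rightarrow> nat \<Rightarrow> real mat" where
  "interp_matrix P \<sigma> n = Matrix.mat (3 * n + 3) (3 * n + 3)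
     (\<lambda>(r, c). P (fst (\<sigma> c)) (snd (\<sigma> c)) (interp_point n (r + 1)))"

end

theory Submission
  imports Defs "Jordan_Normal_Form.Determinant" "HOL-Computational_Algebra.Formal_Power_Series"
begin

text \<open>
  By uniqueness of the jet at \<open>vertex 0\<close>, the contraction \<open>F\<^sub>0\<close> multiplies \<open>P j k\<close> by
  \<open>5\<^sup>-\<^sup>j\<close> times \<open>1\<close>, \<open>3/5\<close>, \<open>1/5\<close> for \<open>k = 1, 2, 3\<close>, and the reflection at \<open>vertex 0\<close> fixes
  \<open>P j 1\<close>, \<open>P j 2\<close> and negates \<open>P j 3\<close>. A vector in the left kernel of the matrix therefore gives two
  polynomials whose sum has \<open>2 n + 2\<close> roots and whose difference has \<open>n + 1\<close> roots, provided that
  \<open>P j k\<close> does not vanish at \<open>vertex 1\<close>; this forces both to be zero.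

  For \<open>k = 2\<close> the nonvanishing is assumed. For \<open>k = 1\<close> and \<open>k = 3\<close> let \<open>A(z)\<close> and \<open>C(z)\<close> be the
  generating functions of \<open>P j k (vertex 1)\<close>. The symmetrised Taylor expansion of a formal
  eigenfunction around a junction point of two cells shows that the four neighbouring values sum up
  to \<open>4 A(z/5)\<close> times the value at the junction. Applied to \<open>P j 1\<close> and \<open>P j 3\<close> on the first
  subdivision, this mean value formula gives \<open>A(z) = 4 A(z/5)\<^sup>2 - 3 A(z/5)\<close> and
  \<open>5 C(z) = (4 A(z/5) + 1) C(z/5)\<close>, from which all coefficients are seen to be positive.
\<close>

section \<open>Geometry of the gasket\<close>

text \<open>A jet at \<open>vertex 0\<close> determines a function with prescribed Laplacian for the
  following reason: the normal derivative yields the sum of the values at \<open>vertex 1\<close>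
  and \<open>vertex 2\<close>, the tangential derivative yields their difference, and Dirichlet
  uniqueness does the rest. One obstacle is that \<open>has_laplacian\<close> is a weak notion
  without pointwise content. The cancellation of normal derivatives at an interior junction is
  therefore obtained by testing with a piecewise harmonic tent, which is why harmonic functions and
  a gluing operation are constructed explicitly. Another is that \<open>has_laplacian_power\<close>
  is existential: consecutive monomials can be linked only after the Laplacian of a function is
  shown to be unique, by means of bumps in small cells. The quadratic recursion for the boundary
  values says nothing at index 1 and the linear one nothing at index 0. Hence
  \<open>P 1 1 (vertex 1) = 1/6\<close> and \<open>P 0 3 (vertex 1) = 1/2\<close> are computed
  directly. The first rests on the integral 1/3 of each \<open>hat k\<close>, and so on the
  invariance of the integral under reflections.\<close>

lemma idx_cases: "(i::nat) \<in> {0,1,2} \<Longrightarrow> (i = 0 \<Longrightarrow> Q) \<Longrightarrow> (i = 1 \<Longrightarrow> Q) \<Longrightarrow> (i = 2 \<Longrightarrow> Q) \<Longrightarrow> Q"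
  by auto

lemma sum_idx: "(\<Sum>i\<in>{0,1,2::nat}. f i) = f 0 + f 1 + f 2"
  by (simp add: add.assoc)

lemma contraction_eq: "contraction i x = (1/2) *\<^sub>R (x + vertex i)"
  by (simp add: contraction_def algebra_simps flip: scaleR_add_left)

lemma contraction_vertex [simp]: "contraction i (vertex i) = vertex i"
  by (simp add: contraction_def)

lemma contraction_vertex_commute: "contraction i (vertex k) = contraction k (vertex i)"
  by (simp add: contraction_eq add.commute)

lemma contraction_inj: "contraction i x = contraction i y \<longleftrightarrow> x = y"
  by (simp add: contraction_eq)

lemma dist_contraction: "dist (contraction i x) (contraction i y) = dist x y / 2"
proof -
  have "contraction i x - contraction i y = (1/2) *\<^sub>R (x - y)"
    by (simp add: contraction_eq algebra_simps)
  then show ?thesis by (simp add: dist_norm)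
qed

lemma continuous_on_contraction [continuous_intros]:
  "continuous_on A f \<Longrightarrow> continuous_on A (\<lambda>x. contraction i (f x))"
  unfolding contraction_def by (intro continuous_intros)

lemma V_0: "V 0 = {vertex 0, vertex 1, vertex 2}"
  by (auto simp: V_def words_def word_map_def)

lemma words_0: "words 0 = {[]}"
  by (auto simp: words_def)

lemma words_Suc: "words (Suc m) = (\<Union>i\<in>{0,1,2}. (#) i ` words m)"
proof (intro equalityI subsetI)
  fix w assume "w \<in> words (Suc m)"
  then show "w \<in> (\<Union>i\<in>{0,1,2}. (#) i ` words m)"
    by (cases w) (auto simp: words_def)
qed (auto simp: words_def)

lemma word_map_Nil [simp]: "word_map [] x = x"
  by (simp add: word_map_def)

lemma word_map_Cons [simp]: "word_map (i # w) x = contraction i (word_map w x)"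
  by (simp add: word_map_def)

lemma V_Suc: "V (Suc m) = (\<Union>i\<in>{0,1,2}. contraction i ` V m)"
  unfolding V_def words_Suc by (simp add: image_Un image_UN image_image Un_assoc)

lemma finite_V: "finite (V m)"
  by (induction m) (auto simp: V_0 V_Suc)

lemma V_Suc_mono: "V m \<subseteq> V (Suc m)"
proof (induction m)
  case 0
  have "vertex i \<in> contraction i ` {vertex 0, vertex 1, vertex 2}" if "i \<in> {0,1,2}" for i
    using that by (intro image_eqI[of _ _ "vertex i"]) auto
  then show ?case unfolding V_0 V_Suc by blast
next
  case (Suc m)
  show ?case
    by (subst V_Suc[of m], subst V_Suc[of "Suc m"]) (intro UN_mono image_mono Suc order_refl)
qed

lemma V_0_subset: "V 0 \<subseteq> V m"
  by (induction m) (use V_Suc_mono in auto)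

section \<open>The gasket as the closure of its vertices\<close>

definition all_vertices :: "point set" where
  "all_vertices = (\<Union>m. V m)"

lemma all_vertices_fixed: "all_vertices = (\<Union>i\<in>{0,1,2}. contraction i ` all_vertices)"
proof -
  have "all_vertices = (\<Union>m. V (Suc m))"
    unfolding all_vertices_def by (rule antisym) (auto intro: subsetD[OF V_Suc_mono])
  also have "\<dots> = (\<Union>i\<in>{0,1,2}. contraction i ` all_vertices)"
    by (simp add: V_Suc all_vertices_def UN_Un_distrib image_UN)
  finally show ?thesis .
qed

lemma closure_contraction: "closure (contraction i ` A) = contraction i ` closure A"
proof -
  have *: "contraction i ` B = (+) ((1/2) *\<^sub>R vertex i) ` ((*\<^sub>R) (1/2) ` B)" for B
    by (simp add: image_image contraction_eq scaleR_add_right add.commute)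
  show ?thesis unfolding * by (simp only: closure_translation closure_scaleR)
qed

lemma norm_vertex_le: "norm (vertex i) \<le> 1"
  by (simp add: vertex_def norm_prod_def power_divide)

lemma norm_all_vertices: "x \<in> all_vertices \<Longrightarrow> norm x \<le> 1"
proof -
  have "x \<in> V m \<Longrightarrow> norm x \<le> 1" for m
  proof (induction m arbitrary: x)
    case 0
    then show ?case using norm_vertex_le by (auto simp: V_0)
  next
    case (Suc m)
    then obtain i y where y: "x = contraction i y" "norm y \<le> 1" by (auto simp: V_Suc)
    have "norm (y + vertex i) \<le> 2"
      using y(2) norm_vertex_le[of i] norm_triangle_ineq[of y "vertex i"] by linarith
    then show ?case by (simp add: y contraction_eq)
  qed
  then show "x \<in> all_vertices \<Longrightarrow> norm x \<le> 1" by (auto simp: all_vertices_def)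
qed

lemma contraction_power_Suc:
  "(contraction i ^^ Suc m) x = contraction i ((contraction i ^^ m) x)"
  "(contraction i ^^ Suc m) x = (contraction i ^^ m) (contraction i x)"
  by (simp, metis funpow_Suc_right comp_apply)

lemma dist_contraction_power:
  "dist ((contraction i ^^ m) x) ((contraction i ^^ m) y) = dist x y / 2 ^ m"
  by (induction m) (simp_all add: dist_contraction)

lemma contraction_power_vertex [simp]: "(contraction i ^^ m) (vertex i) = vertex i"
  by (induction m) auto

lemma contraction_power_tendsto: "(\<lambda>m. (contraction i ^^ m) x) \<longlonglongrightarrow> vertex i"
proof (rule metric_LIMSEQ_I)
  fix e :: real assume "e > 0"
  have "(\<lambda>m. dist x (vertex i) / 2 ^ m) \<longlonglongrightarrow> 0"
    by (rule LIMSEQ_divide_realpow_zero) simp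
  then obtain N where "\<And>m. m \<ge> N \<Longrightarrow> dist x (vertex i) / 2 ^ m < e"
    using \<open>e > 0\<close> by (metis (no_types, lifting) abs_le_D1 diff_0_right eventually_sequentially
      order_tendstoD(2))
  then have "dist ((contraction i ^^ m) x) (vertex i) < e" if "m \<ge> N" for m
    using dist_contraction_power[where i = i and m = m and x = x and y = "vertex i"] that by simp
  then show "\<exists>N. \<forall>m\<ge>N. dist ((contraction i ^^ m) x) (vertex i) < e" by blast
qed

text \<open>Stated for any fixed set \<open>K\<close> because it serves both in the uniqueness
  proof, before the gasket is identified, and afterwards for the gasket itself.\<close>

lemma attractor_cell_approx:
  assumes K: "K = (\<Union>i\<in>{0,1,2}. contraction i ` K)" and "x \<in> K"
  shows "\<exists>w\<in>words m. \<exists>y\<in>K. x = word_map w y"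
  using \<open>x \<in> K\<close>
proof (induction m arbitrary: x)
  case 0
  then show ?case by (auto simp: words_0)
next
  case (Suc m)
  then obtain i x' where i: "i \<in> {0,1,2}" "x' \<in> K" "x = contraction i x'"
    using K by blast
  with Suc.IH[of x'] obtain w y where "w \<in> words m" "y \<in> K" "x' = word_map w y" by blast
  with i have "i # w \<in> words (Suc m)" "x = word_map (i # w) y" by (auto simp: words_Suc)
  with \<open>y \<in> K\<close> show ?case by blast
qed

lemma dist_word_map: "w \<in> words m \<Longrightarrow> dist (word_map w x) (word_map w y) = dist x y / 2 ^ m"
  by (induction m arbitrary: w) (auto simp: words_0 words_Suc dist_contraction)

lemma word_map_vertex: "w \<in> words m \<Longrightarrow> word_map w (vertex 0) \<in> V m"
  unfolding V_def by blast

text \<open>A nonempty closed fixed set contains each corner, as the limit of iterates of one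
  contraction, and hence all vertices. Conversely each point of \<open>K\<close> is some
  \<open>word_map w y\<close> with \<open>y\<close> in \<open>K\<close>, and so lies within
  \<open>B / 2 ^ m\<close> of the vertex \<open>word_map w (vertex 0)\<close>.\<close>

lemma attractor_unique:
  assumes "compact K" "K \<noteq> {}" and K: "K = (\<Union>i\<in>{0,1,2}. contraction i ` K)"
  shows "K = closure all_vertices"
proof (rule antisym)
  have into: "contraction i x \<in> K" if "i \<in> {0,1,2}" "x \<in> K" for i x
    using K that by blast
  have closed: "closed K" using \<open>compact K\<close> by (rule compact_imp_closed)
  have vert: "vertex i \<in> K" if i: "i \<in> {0,1,2}" for i
  proof -
    obtain x where x: "x \<in> K" using \<open>K \<noteq> {}\<close> by blast
    have "(contraction i ^^ m) x \<in> K" for m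
      by (induction m) (use x into i in auto)
    with closed contraction_power_tendsto show ?thesis
      by (metis closed_sequentially)
  qed
  have "V m \<subseteq> K" for m
    by (induction m) (use vert into in \<open>auto simp: V_0 V_Suc\<close>)
  then show "closure all_vertices \<subseteq> K"
    using closed by (intro closure_minimal) (auto simp: all_vertices_def)
  obtain B where B: "\<And>x. x \<in> K \<Longrightarrow> dist x (vertex 0) \<le> B"
    using compact_imp_bounded[OF \<open>compact K\<close>] unfolding bounded_any_center[where a = "vertex 0"]
    by (metis dist_commute)
  show "K \<subseteq> closure all_vertices"
  proof
    fix x assume x: "x \<in> K"
    show "x \<in> closure all_vertices"
      unfolding closure_approachable
    proof (intro allI impI)
      fix e :: real assume "e > 0"
      have "(\<lambda>m. B / 2 ^ m) \<longlonglongrightarrow> 0" by (rule LIMSEQ_divide_realpow_zero) simp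
      then obtain m where m: "B / 2 ^ m < e"
        using \<open>e > 0\<close> by (metis (no_types, lifting) eventually_sequentially order.refl
          order_tendstoD(2))
      obtain w y where w: "w \<in> words m" "y \<in> K" "x = word_map w y"
        using attractor_cell_approx[OF K x] by blast
      have "dist (word_map w (vertex 0)) x = dist y (vertex 0) / 2 ^ m"
        using w dist_word_map[of w m "vertex 0" y] by (simp add: dist_commute)
      also have "\<dots> \<le> B / 2 ^ m" using B[OF w(2)] by (simp add: divide_right_mono)
      finally have "dist (word_map w (vertex 0)) x < e" using m by simp
      then show "\<exists>y\<in>all_vertices. dist y x < e"
        using word_map_vertex[OF w(1)] by (auto simp: all_vertices_def)
    qed
  qed
qed

text \<open>\<open>gasket\<close> is a definite description, so nothing is known about it until
  existence and uniqueness of the attractor are settled; the closure of the vertices is the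
  witness.\<close>

lemma gasket_closure: "gasket = closure all_vertices"
  and compact_gasket: "compact gasket"
  and gasket_fixed: "gasket = (\<Union>i\<in>{0,1,2}. contraction i ` gasket)"
proof -
  let ?K = "closure all_vertices"
  have "bounded all_vertices"
    using norm_all_vertices bounded_iff by blast
  then have c: "compact ?K" by (simp add: compact_closure)
  have "vertex 0 \<in> all_vertices" using V_0_subset by (auto simp: all_vertices_def V_0)
  then have n: "?K \<noteq> {}" by auto
  have f: "?K = (\<Union>i\<in>{0,1,2}. contraction i ` ?K)"
    by (subst all_vertices_fixed) (simp add: closure_contraction)
  have g: "gasket = ?K" unfolding gasket_def
    by (rule the_equality) (use c n f attractor_unique in auto)
  show "gasket = ?K" "compact gasket" using c g by simp_all
  show "gasket = (\<Union>i\<in>{0,1,2}. contraction i ` gasket)" using f unfolding g .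
qed

lemma contraction_gasket: "i \<in> {0,1,2} \<Longrightarrow> x \<in> gasket \<Longrightarrow> contraction i x \<in> gasket"
  using gasket_fixed by blast

lemma gasket_cases:
  assumes "x \<in> gasket"
  obtains i y where "i \<in> {0,1,2}" "y \<in> gasket" "x = contraction i y"
  using assms gasket_fixed by blast

lemma V_subset_gasket: "V m \<subseteq> gasket"
  unfolding gasket_closure all_vertices_def
  by (rule order_trans[OF _ closure_subset]) (rule UN_upper, simp)

lemma vertex_in_gasket [simp]: "vertex i \<in> gasket"
proof -
  have "vertex i \<in> V 0" by (simp add: V_0 vertex_def)
  then show ?thesis using V_subset_gasket by blast
qed

lemma word_map_gasket: "w \<in> words m \<Longrightarrow> x \<in> gasket \<Longrightarrow> word_map w x \<in> gasket"
  by (induction m arbitrary: w) (auto simp: words_0 words_Suc intro!: contraction_gasket)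

lemma gasket_cell: "x \<in> gasket \<Longrightarrow> \<exists>w\<in>words m. \<exists>y\<in>gasket. x = word_map w y"
  by (rule attractor_cell_approx[OF gasket_fixed])

lemma contraction_power_gasket:
  "i \<in> {0,1,2} \<Longrightarrow> x \<in> gasket \<Longrightarrow> (contraction i ^^ m) x \<in> gasket"
  by (induction m) (use contraction_gasket in auto)

section \<open>Barycentric coordinates of the triangle and the intersection of cells\<close>

definition bary :: "nat \<Rightarrow> point \<Rightarrow> real" where
  "bary i p = (if i = 0 then 2 * snd p / sqrt 3 else if i = 1 then 1 - fst p - snd p / sqrt 3
     else fst p - snd p / sqrt 3)"

lemma bary_vertex: "i \<in> {0,1,2} \<Longrightarrow> k \<in> {0,1,2} \<Longrightarrow> bary i (vertex k) = of_bool (i = k)"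
  by (elim idx_cases) (simp_all add: bary_def vertex_def)

lemma bary_contraction: "bary i (contraction k x) = (bary i x + bary i (vertex k)) / 2"
  by (simp add: bary_def contraction_eq add_divide_distrib diff_divide_distrib)

lemma bary_sum: "bary 0 p + bary 1 p + bary 2 p = 1"
  by (simp add: bary_def)

lemma bary_repr: "p = bary 0 p *\<^sub>R vertex 0 + bary 1 p *\<^sub>R vertex 1 + bary 2 p *\<^sub>R vertex 2"
  by (rule prod_eqI) (simp_all add: bary_def vertex_def)

lemma continuous_on_bary [continuous_intros]: "continuous_on A (bary i)"
  unfolding bary_def by (cases "i = 0"; cases "i = 1") (auto intro!: continuous_intros)

lemma bary_nonneg:
  assumes "x \<in> gasket" "i \<in> {0,1,2}"
  shows "bary i x \<ge> 0"
proof -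
  have "bary i y \<ge> 0" if "y \<in> V m" for y m
    using that
  proof (induction m arbitrary: y)
    case 0
    then show ?case using assms(2) by (auto simp: V_0 bary_vertex)
  next
    case (Suc m)
    then obtain k z where "k \<in> {0,1,2}" "y = contraction k z" "z \<in> V m" by (auto simp: V_Suc)
    with Suc.IH[of z] assms(2) show ?case by (auto simp: bary_contraction bary_vertex)
  qed
  then have "all_vertices \<subseteq> {y. bary i y \<ge> 0}" by (auto simp: all_vertices_def)
  moreover have "closed {y. 0 \<le> bary i y}"
    by (intro closed_Collect_le continuous_intros)
  ultimately have "gasket \<subseteq> {y. bary i y \<ge> 0}"
    unfolding gasket_closure by (rule closure_minimal)
  with assms(1) show ?thesis by blast
qed

lemma bary_eq_1:
  assumes "x \<in> gasket" "i \<in> {0,1,2}" "bary i x \<ge> 1"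
  shows "x = vertex i"
proof -
  have nn: "bary 0 x \<ge> 0" "bary 1 x \<ge> 0" "bary 2 x \<ge> 0"
    using bary_nonneg[OF assms(1)] by auto
  consider "i = 0" "bary 0 x = 1" "bary 1 x = 0" "bary 2 x = 0"
    | "i = 1" "bary 0 x = 0" "bary 1 x = 1" "bary 2 x = 0"
    | "i = 2" "bary 0 x = 0" "bary 1 x = 0" "bary 2 x = 1"
    using assms(2,3) nn bary_sum[of x] by fastforce
  then show ?thesis
    by cases (use bary_repr[of x] in auto)
qed

text \<open>\<open>contraction i\<close> halves coordinate \<open>k\<close>, whereas
  \<open>contraction k\<close> adds 1 before halving. A common point therefore has
  \<open>bary k x = bary k y + 1\<close>, which is at least 1, and only a corner reaches
  that.\<close>

lemma cells_meet:
  assumes "i \<in> {0,1,2}" "k \<in> {0,1,2}" "i \<noteq> k" "x \<in> gasket" "y \<in> gasket"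
    "contraction i x = contraction k y"
  shows "x = vertex k" "y = vertex i"
proof -
  have "bary k x / 2 = (bary k y + 1) / 2"
    using arg_cong[OF assms(6), of "bary k"] assms(1-3) by (simp add: bary_contraction bary_vertex)
  with bary_nonneg[OF assms(5,2)] bary_eq_1[OF assms(4,2)] show "x = vertex k" by simp
  have "bary i y / 2 = (bary i x + 1) / 2"
    using arg_cong[OF assms(6), of "bary i"] assms(1-3) by (simp add: bary_contraction bary_vertex)
  with bary_nonneg[OF assms(4,1)] bary_eq_1[OF assms(5,1)] show "y = vertex i" by simp
qed

text \<open>The reflection of the triangle that fixes \<open>vertex r\<close>; on indices modulo 3 it acts by
  \<open>i \<mapsto> 2 * r - i\<close>, which is \<open>2 * r + 2 * i\<close>.\<close>

definition reflection :: "nat \<Rightarrow> point \<Rightarrow> point" where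
  "reflection r p = bary 0 p *\<^sub>R vertex (2 * r) + bary 1 p *\<^sub>R vertex (2 * r + 2)
     + bary 2 p *\<^sub>R vertex (2 * r + 4)"

lemma vertex_mod: "vertex (i mod 3) = vertex i"
  by (simp add: vertex_def)

lemma reflection_vertex:
  "i \<in> {0,1,2} \<Longrightarrow> reflection r (vertex i) = vertex ((2 * r + 2 * i) mod 3)"
  by (auto simp: reflection_def bary_vertex vertex_mod)

lemma reflection_mod: "reflection (r mod 3) = reflection r"
proof -
  have "vertex (2 * (r mod 3) + c) = vertex (2 * r + c)" for c
  proof -
    have "(2 * (r mod 3) + c) mod 3 = (2 * r + c) mod 3" by (metis mod_add_left_eq mod_mult_right_eq)
    then show ?thesis by (metis vertex_mod)
  qed
  from this[of 0] this[of 2] this[of 4] show ?thesis by (simp add: reflection_def fun_eq_iff)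
qed

lemma sqrt3_mult: "sqrt 3 * (sqrt 3 * x) = 3 * x"
  by (simp flip: mult.assoc)

lemma reflection_contraction:
  assumes "i \<in> {0,1,2}"
  shows "reflection r (contraction i x) = contraction ((2 * r + 2 * i) mod 3) (reflection r x)"
proof -
  have *: "reflection s (contraction i x) = contraction ((2 * s + 2 * i) mod 3) (reflection s x)"
    if "s \<in> {0,1,2}" for s
    using that assms
    by (elim idx_cases; simp)
      (simp_all add: reflection_def bary_contraction contraction_eq bary_def vertex_def
        prod_eq_iff field_simps sqrt3_mult)
  have "(2 * (r mod 3) + 2 * i) mod 3 = (2 * r + 2 * i) mod 3"
    by (metis mod_add_left_eq mod_mult_right_eq)
  moreover have "r mod 3 \<in> {0,1,2}" by auto
  ultimately show ?thesis using *[of "r mod 3"] by (simp add: reflection_mod)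
qed

lemma continuous_on_reflection [continuous_intros]: "continuous_on A (reflection r)"
  unfolding reflection_def by (intro continuous_intros)

lemma reflection_gasket:
  assumes "x \<in> gasket"
  shows "reflection r x \<in> gasket"
proof -
  have "reflection r y \<in> V m" if "y \<in> V m" for m y
    using that
  proof (induction m arbitrary: y)
    case 0
    then obtain i where "i \<in> {0,1,2}" "y = vertex i" by (auto simp: V_0)
    then have "reflection r y = vertex ((2 * r + 2 * i) mod 3)" by (simp add: reflection_vertex)
    moreover have "(2 * r + 2 * i) mod 3 \<in> {0,1,2}" by auto
    ultimately show ?case by (auto simp: V_0)
  next
    case (Suc m)
    then obtain i z where i: "i \<in> {0,1,2}" "y = contraction i z" "z \<in> V m" by (auto simp: V_Suc)
    have "(2 * r + 2 * i) mod 3 \<in> {0,1,2}" by auto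
    with i Suc.IH[of z] show ?case
      unfolding V_Suc UN_iff by (intro bexI[of _ "(2 * r + 2 * i) mod 3"] image_eqI[OF _ Suc.IH])
        (simp_all only: reflection_contraction)
  qed
  then have "reflection r ` all_vertices \<subseteq> gasket"
    using V_subset_gasket by (fastforce simp: all_vertices_def)
  moreover have "closed gasket" using compact_gasket by (rule compact_imp_closed)
  ultimately have "reflection r ` closure all_vertices \<subseteq> gasket"
    by (intro image_closure_subset continuous_intros)
  with assms show ?thesis unfolding gasket_closure by blast
qed

lemma reflection_involution: "reflection r (reflection r x) = x"
proof -
  have *: "reflection s (reflection s x) = x" if "s \<in> {0,1,2}" for s
    using that
    by (elim idx_cases) (simp_all add: reflection_def bary_def vertex_def prod_eq_iff field_simps)
  have "r mod 3 \<in> {0,1,2}" by auto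
  with *[of "r mod 3"] show ?thesis by (simp add: reflection_mod)
qed

section \<open>Graph energies\<close>

lemma adjacent_Suc:
  "adjacent (Suc m) x y \<longleftrightarrow>
     (\<exists>i\<in>{0,1,2}. \<exists>x' y'. x = contraction i x' \<and> y = contraction i y' \<and> adjacent m x' y')"
proof
  assume adj: "adjacent (Suc m) x y"
  then obtain w where w: "w \<in> words (Suc m)" "x \<in> word_map w ` gasket" "y \<in> word_map w ` gasket"
    by (auto simp: adjacent_def)
  then obtain i w' where i: "i \<in> {0,1,2}" "w' \<in> words m" "w = i # w'" by (auto simp: words_Suc)
  obtain a where a: "a \<in> gasket" "x = contraction i (word_map w' a)" using w(2) i(3) by auto
  obtain b where b: "b \<in> gasket" "y = contraction i (word_map w' b)" using w(3) i(3) by auto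
  \<comment> \<open>A point of level \<open>m + 1\<close> in cell \<open>i\<close> may have been
    generated from another cell \<open>k\<close>. Then it is the junction of the two cells and its
    preimage is a corner, which belongs to \<open>V m\<close> anyway.\<close>
  have in_V: "word_map w' c \<in> V m" if c: "c \<in> gasket" "contraction i (word_map w' c) \<in> V (Suc m)" for c
  proof -
    obtain k z where k: "k \<in> {0,1,2}" "z \<in> V m" "contraction i (word_map w' c) = contraction k z"
      using c(2) unfolding V_Suc by blast
    show ?thesis
    proof (cases "k = i")
      case True
      with k show ?thesis by (simp add: contraction_inj)
    next
      case False
      have "word_map w' c = vertex k"
        using cells_meet(1)[OF i(1) k(1) _ _ _ k(3)] False k(2) V_subset_gasket[of m]
          word_map_gasket[OF i(2) c(1)] by blast
      moreover have "vertex k \<in> V 0" using k(1) by (auto simp: V_0)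
      ultimately show ?thesis using V_0_subset by auto
    qed
  qed
  have "adjacent m (word_map w' a) (word_map w' b)"
    unfolding adjacent_def using adj a b i(2) in_V by (auto simp: adjacent_def)
  with a b i(1)
  show "\<exists>i\<in>{0,1,2}. \<exists>x' y'. x = contraction i x' \<and> y = contraction i y' \<and> adjacent m x' y'"
    by blast
next
  assume "\<exists>i\<in>{0,1,2}. \<exists>x' y'. x = contraction i x' \<and> y = contraction i y' \<and> adjacent m x' y'"
  then obtain i x' y' where i: "i \<in> {0,1,2}" "x = contraction i x'" "y = contraction i y'"
    "adjacent m x' y'" by blast
  then obtain w where w: "w \<in> words m" "x' \<in> word_map w ` gasket" "y' \<in> word_map w ` gasket"
    by (auto simp: adjacent_def)
  have "i # w \<in> words (Suc m)" using i(1) w(1) by (auto simp: words_Suc)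
  moreover have "x \<in> word_map (i # w) ` gasket" "y \<in> word_map (i # w) ` gasket"
    using i w by auto
  moreover have "x \<in> V (Suc m)" "y \<in> V (Suc m)" "x \<noteq> y"
    using i by (auto simp: adjacent_def V_Suc contraction_inj)
  ultimately show "adjacent (Suc m) x y" unfolding adjacent_def by blast
qed

lemma finite_adjacent: "finite {(x, y). adjacent m x y}"
  by (rule finite_subset[of _ "V m \<times> V m"]) (auto simp: adjacent_def finite_V)

lemma adjacent_gasket: "adjacent m x y \<Longrightarrow> x \<in> gasket \<and> y \<in> gasket"
  using V_subset_gasket by (auto simp: adjacent_def)

lemma vertex_distinct:
  "vertex 0 \<noteq> vertex 1" "vertex 0 \<noteq> vertex 2" "vertex 1 \<noteq> vertex 2"
  by (simp_all add: vertex_def)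

lemma ordered_pairs_of_three:
  assumes "a \<noteq> b" "a \<noteq> c" "b \<noteq> c"
  shows "{(x, y). x \<in> {a, b, c} \<and> y \<in> {a, b, c} \<and> x \<noteq> y} =
    {(a, b), (b, a), (a, c), (c, a), (b, c), (c, b)}"
  using assms by auto

lemma graph_energy_0:
  "graph_energy 0 u v =
     (u (vertex 0) - u (vertex 1)) * (v (vertex 0) - v (vertex 1)) +
     (u (vertex 0) - u (vertex 2)) * (v (vertex 0) - v (vertex 2)) +
     (u (vertex 1) - u (vertex 2)) * (v (vertex 1) - v (vertex 2))"
proof -
  have adj: "adjacent 0 x y \<longleftrightarrow> x \<in> {vertex 0, vertex 1, vertex 2} \<and>
      y \<in> {vertex 0, vertex 1, vertex 2} \<and> x \<noteq> y" for x y
    using V_subset_gasket[of 0] unfolding adjacent_def words_0 V_0 by auto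
  have "{(x, y). adjacent 0 x y} =
      {(vertex 0, vertex 1), (vertex 1, vertex 0), (vertex 0, vertex 2), (vertex 2, vertex 0),
       (vertex 1, vertex 2), (vertex 2, vertex 1)}"
    unfolding adj by (rule ordered_pairs_of_three[OF vertex_distinct])
  then show ?thesis
    using vertex_distinct vertex_distinct[symmetric] by (simp add: graph_energy_def algebra_simps)
qed

lemma graph_energy_Suc:
  "graph_energy (Suc m) u v =
     5/3 * (\<Sum>i\<in>{0,1,2}. graph_energy m (\<lambda>x. u (contraction i x)) (\<lambda>x. v (contraction i x)))"
proof -
  let ?A = "{(x, y). adjacent m x y}" and ?f = "\<lambda>i. map_prod (contraction i) (contraction i)"
  let ?g = "\<lambda>(x, y). (u x - u y) * (v x - v y)"
  have set_eq: "{(x, y). adjacent (Suc m) x y} = (\<Union>i\<in>{0,1,2}. ?f i ` ?A)"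
  proof (rule Set.set_eqI)
    fix p :: "point \<times> point"
    obtain x y where p: "p = (x, y)" by (cases p)
    have "p \<in> ?f i ` ?A \<longleftrightarrow>
        (\<exists>x' y'. x = contraction i x' \<and> y = contraction i y' \<and> adjacent m x' y')" for i
    proof
      assume "p \<in> ?f i ` ?A"
      then obtain q where q: "p = ?f i q" "q \<in> ?A" by (rule imageE)
      obtain x' y' where "q = (x', y')" by (cases q)
      with q p have "x = contraction i x'" "y = contraction i y'" "adjacent m x' y'" by simp_all
      then show "\<exists>x' y'. x = contraction i x' \<and> y = contraction i y' \<and> adjacent m x' y'" by blast
    next
      assume "\<exists>x' y'. x = contraction i x' \<and> y = contraction i y' \<and> adjacent m x' y'"
      then obtain x' y' where "x = contraction i x'" "y = contraction i y'" "adjacent m x' y'" by blast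
      with p show "p \<in> ?f i ` ?A" by (intro image_eqI[of _ _ "(x', y')"]) simp_all
    qed
    with p show "p \<in> {(x, y). adjacent (Suc m) x y} \<longleftrightarrow> p \<in> (\<Union>i\<in>{0,1,2}. ?f i ` ?A)"
      by (simp only: mem_Collect_eq prod.case adjacent_Suc UN_iff)
  qed
  \<comment> \<open>Two cells share at most one point, so an edge, having distinct endpoints, cannot
    belong to both.\<close>
  have disj: "?f i ` ?A \<inter> ?f k ` ?A = {}" if "i \<in> {0,1,2}" "k \<in> {0,1,2}" "i \<noteq> k" for i k
  proof (rule ccontr)
    assume "\<not> ?thesis"
    then obtain q where q: "q \<in> ?f i ` ?A" "q \<in> ?f k ` ?A"
      by (meson Int_iff equals0I)
    from q(1) obtain p where p: "q = ?f i p" "p \<in> ?A" by (rule imageE)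
    from q(2) obtain p' where p': "q = ?f k p'" "p' \<in> ?A" by (rule imageE)
    obtain x y where xy: "p = (x, y)" by (cases p)
    obtain x' y' where xy': "p' = (x', y')" by (cases p')
    have xy: "adjacent m x y" "adjacent m x' y'"
      "contraction i x = contraction k x'" "contraction i y = contraction k y'"
      using p p' by (simp_all add: xy xy')
    then have "x = vertex k" "y = vertex k"
      using cells_meet(1)[OF that] adjacent_gasket by metis+
    with xy(1) show False by (simp add: adjacent_def)
  qed
  have inj: "inj_on (?f i) ?A" for i
    by (auto simp: inj_on_def contraction_inj)
  have cell: "sum ?g (?f i ` ?A) = (\<Sum>(x, y)\<in>?A. (u (contraction i x) - u (contraction i y)) *
      (v (contraction i x) - v (contraction i y)))" for i
    unfolding sum.reindex[OF inj] by (intro sum.cong) auto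
  have "sum ?g {(x, y). adjacent (Suc m) x y} = (\<Sum>i\<in>{0,1,2}. sum ?g (?f i ` ?A))"
    unfolding set_eq
    by (rule sum.UNION_disjoint) (use disj finite_adjacent in auto)
  also have "\<dots> = (\<Sum>i\<in>{0,1,2}. \<Sum>(x, y)\<in>?A. (u (contraction i x) - u (contraction i y)) *
      (v (contraction i x) - v (contraction i y)))"
    using cell by presburger
  finally show ?thesis
    by (simp add: graph_energy_def sum_distrib_left algebra_simps)
qed

lemma graph_energy_Suc':
  "graph_energy (Suc m) u v =
     5/3 * (graph_energy m (\<lambda>x. u (contraction 0 x)) (\<lambda>x. v (contraction 0 x)) +
            graph_energy m (\<lambda>x. u (contraction 1 x)) (\<lambda>x. v (contraction 1 x)) +
            graph_energy m (\<lambda>x. u (contraction 2 x)) (\<lambda>x. v (contraction 2 x)))"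
  by (simp add: graph_energy_Suc)

lemma graph_energy_cong:
  assumes "\<And>x. x \<in> gasket \<Longrightarrow> u x = u' x" "\<And>x. x \<in> gasket \<Longrightarrow> v x = v' x"
  shows "graph_energy m u v = graph_energy m u' v'"
proof -
  have "u x = u' x \<and> u y = u' y \<and> v x = v' x \<and> v y = v' y" if "adjacent m x y" for x y
    using adjacent_gasket[OF that] assms by blast
  then show ?thesis
    unfolding graph_energy_def by (intro arg_cong[where f = "(*) _"] sum.cong) auto
qed

lemma graph_energy_commute: "graph_energy m u v = graph_energy m v u"
  by (simp add: graph_energy_def mult.commute)

lemma graph_energy_add: "graph_energy m (\<lambda>x. u x + u' x) v = graph_energy m u v + graph_energy m u' v"
  by (induction m arbitrary: u u' v) (simp_all add: graph_energy_0 graph_energy_Suc' algebra_simps)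

lemma graph_energy_cmult: "graph_energy m (\<lambda>x. c * u x) v = c * graph_energy m u v"
  by (induction m arbitrary: u v) (simp_all add: graph_energy_0 graph_energy_Suc' algebra_simps)

lemma graph_energy_add_right:
  "graph_energy m v (\<lambda>x. u x + u' x) = graph_energy m v u + graph_energy m v u'"
  by (simp add: graph_energy_commute[of m v] graph_energy_add)

lemma graph_energy_cmult_right: "graph_energy m v (\<lambda>x. c * u x) = c * graph_energy m v u"
  by (simp add: graph_energy_commute[of m v] graph_energy_cmult)

lemma graph_energy_nonneg: "graph_energy m u u \<ge> 0"
  by (induction m arbitrary: u) (simp_all add: graph_energy_0 graph_energy_Suc')

lemma graph_energy_const: "graph_energy m (\<lambda>x. c) u = 0"
  by (induction m arbitrary: u) (simp_all add: graph_energy_0 graph_energy_Suc')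

text \<open>Harmonic extension minimises the energy: with the weights 2/5, 2/5, 1/5 the part linear
  in the deviations vanishes and a sum of squares remains.\<close>

lemma graph_energy_0_le_1: "graph_energy 0 u u \<le> graph_energy (Suc 0) u u"
proof -
  define a b c where "a = u (vertex 0)" "b = u (vertex 1)" "c = u (vertex 2)"
  note abc = this
  \<comment> \<open>The deviations of the three midpoint values from the harmonic extension of
    \<open>a\<close>, \<open>b\<close>, \<open>c\<close>.\<close>
  define x y z where "x = u (contraction 0 (vertex 1)) - (2*a + 2*b + c) / 5"
    "y = u (contraction 1 (vertex 2)) - (a + 2*b + 2*c) / 5"
    "z = u (contraction 0 (vertex 2)) - (2*a + b + 2*c) / 5"
  note xyz = this
  have u: "u (contraction 0 (vertex 1)) = x + (2*a + 2*b + c) / 5"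
    "u (contraction 1 (vertex 0)) = x + (2*a + 2*b + c) / 5"
    "u (contraction 1 (vertex 2)) = y + (a + 2*b + 2*c) / 5"
    "u (contraction 2 (vertex 1)) = y + (a + 2*b + 2*c) / 5"
    "u (contraction 0 (vertex 2)) = z + (2*a + b + 2*c) / 5"
    "u (contraction 2 (vertex 0)) = z + (2*a + b + 2*c) / 5"
    using contraction_vertex_commute[of 1 0] contraction_vertex_commute[of 2 0]
      contraction_vertex_commute[of 2 1]
    by (simp_all add: xyz)
  have "graph_energy (Suc 0) u u - graph_energy 0 u u =
      5/3 * (2*x\<^sup>2 + 2*y\<^sup>2 + 2*z\<^sup>2 + (x - y)\<^sup>2 + (y - z)\<^sup>2 + (x - z)\<^sup>2)"
    unfolding graph_energy_Suc' graph_energy_0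
    by (simp only: u contraction_vertex abc[symmetric]) (simp add: field_simps power2_eq_square)
  moreover have "\<dots> \<ge> 0" by simp
  ultimately show ?thesis by linarith
qed

lemma graph_energy_mono: "graph_energy m u u \<le> graph_energy (Suc m) u u"
proof (induction m arbitrary: u)
  case 0
  show ?case by (rule graph_energy_0_le_1)
next
  case (Suc m)
  show ?case
    by (subst (1 2) graph_energy_Suc) (intro mult_left_mono sum_mono Suc, simp)
qed

lemma graph_energy_contraction_le:
  assumes "i \<in> {0,1,2}"
  shows "graph_energy m (\<lambda>x. u (contraction i x)) (\<lambda>x. u (contraction i x))
    \<le> 3/5 * graph_energy (Suc m) u u"
  using assms
    graph_energy_nonneg[of m "\<lambda>x. u (contraction 0 x)"]
    graph_energy_nonneg[of m "\<lambda>x. u (contraction 1 x)"]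
    graph_energy_nonneg[of m "\<lambda>x. u (contraction 2 x)"]
  unfolding graph_energy_Suc' by (elim idx_cases) simp_all

text \<open>Zero energy passes to each cell. Cell \<open>i\<close> contains the outer corner
  \<open>vertex i\<close>, so its constant is tied to the value at \<open>vertex 0\<close> through
  the energy of level 0.\<close>

lemma zero_energy_constant_on_V:
  assumes "\<And>m. graph_energy m u u = 0" "x \<in> V m"
  shows "u x = u (vertex 0)"
  using assms
proof (induction m arbitrary: u x)
  case (0 u x)
  let ?s = "(u (vertex 0) - u (vertex 1))\<^sup>2 + (u (vertex 0) - u (vertex 2))\<^sup>2
    + (u (vertex 1) - u (vertex 2))\<^sup>2"
  have "?s = 0" using 0(1)[of 0] by (simp add: graph_energy_0 power2_eq_square)
  then show ?case using 0(2) by (auto simp: V_0 add_nonneg_eq_0_iff)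
next
  case (Suc m u x)
  let ?u = "\<lambda>i x. u (contraction i x)"
  from Suc.prems(2) obtain i y where i: "i \<in> {0,1,2}" "x = contraction i y" "y \<in> V m"
    by (auto simp: V_Suc)
  have zero: "graph_energy k (?u i) (?u i) = 0" for k
    using graph_energy_contraction_le[OF i(1), of k u] Suc.prems(1)[of "Suc k"]
      graph_energy_nonneg[of k "?u i"] by simp
  have base: "v (vertex k) = v (vertex 0)"
    if "\<And>m. graph_energy m v v = 0" "k \<in> {0,1,2}" for v k
  proof -
    let ?s = "(v (vertex 0) - v (vertex 1))\<^sup>2 + (v (vertex 0) - v (vertex 2))\<^sup>2
      + (v (vertex 1) - v (vertex 2))\<^sup>2"
    have "?s = 0" using that(1)[of 0] by (simp add: graph_energy_0 power2_eq_square)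
    then show ?thesis using that(2) by (auto simp: add_nonneg_eq_0_iff)
  qed
  have "u x = u (contraction i (vertex 0))"
    using Suc.IH[OF zero i(3)] i(2) by simp
  also have "\<dots> = u (vertex i)" using base[OF zero i(1)] by simp
  also have "\<dots> = u (vertex 0)" by (rule base[OF Suc.prems(1) i(1)])
  finally show ?case .
qed

lemma zero_energy_constant:
  assumes "continuous_on gasket u" "\<And>m. graph_energy m u u = 0" "x \<in> gasket"
  shows "u x = u (vertex 0)"
proof (rule continuous_constant_on_closure[of all_vertices])
  show "continuous_on (closure all_vertices) u" using assms(1) by (simp add: gasket_closure)
  show "x \<in> closure all_vertices" using assms(3) by (simp add: gasket_closure)
qed (use zero_energy_constant_on_V[OF assms(2)] in \<open>unfold all_vertices_def, blast\<close>)

section \<open>The energy form\<close>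

lemma continuous_on_gasket_compose:
  assumes "continuous_on gasket u" "continuous_on gasket f" "\<And>x. x \<in> gasket \<Longrightarrow> f x \<in> gasket"
  shows "continuous_on gasket (\<lambda>x. u (f x))"
  by (rule continuous_on_compose2[OF assms(1,2)]) (use assms(3) in blast)

lemma continuous_on_gasket_reflection:
  "continuous_on gasket u \<Longrightarrow> continuous_on gasket (\<lambda>x. u (reflection r x))"
  by (rule continuous_on_gasket_compose[where f = "reflection r"])
    (simp_all add: continuous_on_reflection reflection_gasket)

lemma continuous_on_gasket_contraction:
  "i \<in> {0,1,2} \<Longrightarrow> continuous_on gasket u \<Longrightarrow> continuous_on gasket (\<lambda>x. u (contraction i x))"
  by (rule continuous_on_gasket_compose[where f = "contraction i"])
    (simp_all only: continuous_on_contraction continuous_on_id contraction_gasket)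

text \<open>Graph energies increase with the level, so convergence amounts to boundedness, which is
  easier to establish for sums and for restrictions to cells.\<close>

lemma energy_domain_iff:
  "u \<in> energy_domain \<longleftrightarrow> continuous_on gasket u \<and> (\<exists>B. \<forall>m. graph_energy m u u \<le> B)"
proof -
  have inc: "incseq (\<lambda>m. graph_energy m u u)"
    by (rule incseq_SucI) (rule graph_energy_mono)
  have "convergent (\<lambda>m. graph_energy m u u) \<longleftrightarrow> (\<exists>B. \<forall>m. graph_energy m u u \<le> B)"
  proof
    assume "convergent (\<lambda>m. graph_energy m u u)"
    then obtain L where L: "(\<lambda>m. graph_energy m u u) \<longlonglongrightarrow> L" by (auto simp: convergent_def)
    then show "\<exists>B. \<forall>m. graph_energy m u u \<le> B" using incseq_le[OF inc L] by blast
  next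
    assume "\<exists>B. \<forall>m. graph_energy m u u \<le> B"
    then obtain B where "\<And>m. graph_energy m u u \<le> B" by blast
    then show "convergent (\<lambda>m. graph_energy m u u)"
      using incseq_convergent[OF inc] by (metis convergentI)
  qed
  then show ?thesis by (simp add: energy_domain_def)
qed

lemma energy_domain_continuous: "u \<in> energy_domain \<Longrightarrow> continuous_on gasket u"
  by (simp add: energy_domain_def)

lemma energy_domain_cong:
  assumes "\<And>x. x \<in> gasket \<Longrightarrow> u x = u' x" "u \<in> energy_domain"
  shows "u' \<in> energy_domain"
proof -
  have "graph_energy m u u = graph_energy m u' u'" for m by (rule graph_energy_cong) (fact assms(1))+
  then show ?thesis
    using assms continuous_on_cong[of gasket gasket u u'] by (simp add: energy_domain_def)
qed

lemma energy_domain_cmult: "u \<in> energy_domain \<Longrightarrow> (\<lambda>x. c * u x) \<in> energy_domain"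
  by (auto simp: energy_domain_def graph_energy_cmult graph_energy_cmult_right
      intro!: continuous_intros convergent_mult convergent_const)

lemma energy_domain_add:
  assumes "u \<in> energy_domain" "v \<in> energy_domain"
  shows "(\<lambda>x. u x + v x) \<in> energy_domain"
proof -
  obtain A B where A: "\<And>m. graph_energy m u u \<le> A" and B: "\<And>m. graph_energy m v v \<le> B"
    using assms by (auto simp: energy_domain_iff)
  have "graph_energy m (\<lambda>x. u x + v x) (\<lambda>x. u x + v x) \<le> 2 * A + 2 * B" for m
  proof -
    \<comment> \<open>Parallelogram bound: nonnegativity for the difference controls the mixed term,
      so the energy of the sum is at most twice the sum of the energies.\<close>
    have "graph_energy m (\<lambda>x. u x + (-1) * v x) (\<lambda>x. u x + (-1) * v x) \<ge> 0"
      by (rule graph_energy_nonneg)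
    then have "2 * graph_energy m u v \<le> graph_energy m u u + graph_energy m v v"
      by (simp only: graph_energy_add graph_energy_add_right graph_energy_cmult
          graph_energy_cmult_right) (simp add: graph_energy_commute[of m v u])
    then show ?thesis
      using A[of m] B[of m]
      by (simp add: graph_energy_add graph_energy_add_right graph_energy_commute[of m v u])
  qed
  then show ?thesis
    using assms by (auto simp: energy_domain_iff intro!: continuous_intros)
qed

lemma energy_domain_const: "(\<lambda>x. c) \<in> energy_domain"
  by (auto simp: energy_domain_iff graph_energy_const)

lemma energy_domain_contraction:
  assumes "i \<in> {0,1,2}" "u \<in> energy_domain"
  shows "(\<lambda>x. u (contraction i x)) \<in> energy_domain"
proof -
  obtain B where B: "\<And>m. graph_energy m u u \<le> B" using assms by (auto simp: energy_domain_iff)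
  have "graph_energy m (\<lambda>x. u (contraction i x)) (\<lambda>x. u (contraction i x)) \<le> 3/5 * B" for m
    using graph_energy_contraction_le[OF assms(1), of m u] B[of "Suc m"] by simp
  moreover have "continuous_on gasket (\<lambda>x. u (contraction i x))"
    by (intro continuous_on_gasket_contraction assms energy_domain_continuous)
  ultimately show ?thesis unfolding energy_domain_iff by blast
qed

text \<open>\<open>energy\<close> is a bare \<open>lim\<close>, meaningful only once convergence is
  known. Polarisation expresses the mixed graph energy through three quadratic ones, which converge
  by definition of the domain.\<close>

lemma energy_LIMSEQ:
  assumes "u \<in> energy_domain" "v \<in> energy_domain"
  shows "(\<lambda>m. graph_energy m u v) \<longlonglongrightarrow> energy u v"
proof -
  let ?p = "\<lambda>x. u x + v x"
  have "?p \<in> energy_domain" using assms by (rule energy_domain_add)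
  then have "convergent (\<lambda>m. (graph_energy m ?p ?p + (-1) * graph_energy m u u
      + (-1) * graph_energy m v v) * (1/2))"
    using assms
    by (intro convergent_mult convergent_add convergent_const) (simp_all add: energy_domain_def)
  moreover have "(graph_energy m ?p ?p + (-1) * graph_energy m u u
      + (-1) * graph_energy m v v) * (1/2) = graph_energy m u v" for m
    by (simp add: graph_energy_add graph_energy_add_right graph_energy_commute[of m v u])
  ultimately have "convergent (\<lambda>m. graph_energy m u v)" by simp
  then show ?thesis by (simp add: energy_def convergent_LIMSEQ_iff)
qed

lemma energy_eqI: "(\<lambda>m. graph_energy m u v) \<longlonglongrightarrow> L \<Longrightarrow> energy u v = L"
  unfolding energy_def by (rule limI)

lemma energy_commute: "energy u v = energy v u"
  by (simp add: energy_def graph_energy_commute)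

lemma energy_cong:
  assumes "\<And>x. x \<in> gasket \<Longrightarrow> u x = u' x" "\<And>x. x \<in> gasket \<Longrightarrow> v x = v' x"
  shows "energy u v = energy u' v'"
  unfolding energy_def using graph_energy_cong[of u u' v v'] assms by presburger

lemma energy_add:
  assumes "u \<in> energy_domain" "u' \<in> energy_domain" "v \<in> energy_domain"
  shows "energy (\<lambda>x. u x + u' x) v = energy u v + energy u' v"
  by (rule energy_eqI) (unfold graph_energy_add, intro tendsto_add energy_LIMSEQ assms)

lemma energy_cmult:
  assumes "u \<in> energy_domain" "v \<in> energy_domain"
  shows "energy (\<lambda>x. c * u x) v = c * energy u v"
  by (rule energy_eqI) (unfold graph_energy_cmult, intro tendsto_mult_left energy_LIMSEQ assms)

lemma energy_const: "energy (\<lambda>x. c) v = 0"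
  by (rule energy_eqI) (simp add: graph_energy_const)

lemma energy_split:
  assumes "u \<in> energy_domain" "v \<in> energy_domain"
  shows "energy u v =
    5/3 * (\<Sum>i\<in>{0,1,2}. energy (\<lambda>x. u (contraction i x)) (\<lambda>x. v (contraction i x)))"
proof -
  have "(\<lambda>m. graph_energy (Suc m) u v) \<longlonglongrightarrow>
      5/3 * (\<Sum>i\<in>{0,1,2}. energy (\<lambda>x. u (contraction i x)) (\<lambda>x. v (contraction i x)))"
    unfolding graph_energy_Suc
    by (intro tendsto_mult_left tendsto_sum energy_LIMSEQ energy_domain_contraction assms)
  then show ?thesis by (intro energy_eqI) (rule LIMSEQ_imp_Suc)
qed

lemma energy_zero_imp_constant:
  assumes "u \<in> energy_domain" "energy u u = 0" "x \<in> gasket"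
  shows "u x = u (vertex 0)"
proof (rule zero_energy_constant)
  have inc: "incseq (\<lambda>m. graph_energy m u u)" by (rule incseq_SucI) (rule graph_energy_mono)
  show "graph_energy m u u = 0" for m
    using incseq_le[OF inc energy_LIMSEQ[OF assms(1,1)], of m] assms(2) graph_energy_nonneg[of m u]
    by simp
qed (use assms energy_domain_continuous in auto)

text \<open>The three transpositions of the corner indices, for \<open>r\<close> congruent to 0, 1,
  2 in this order. The arithmetic is left unreduced so that the terms match those produced by
  \<open>reflection_vertex\<close>.\<close>

lemma reflection_index_cases:
  fixes r :: nat
  obtains "(2 * r + 2 * 0) mod 3 = 0" "(2 * r + 2 * 1) mod 3 = 2" "(2 * r + 2 * 2) mod 3 = 1"
  | "(2 * r + 2 * 0) mod 3 = 2" "(2 * r + 2 * 1) mod 3 = 1" "(2 * r + 2 * 2) mod 3 = 0"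
  | "(2 * r + 2 * 0) mod 3 = 1" "(2 * r + 2 * 1) mod 3 = 0" "(2 * r + 2 * 2) mod 3 = 2"
proof -
  consider "r mod 3 = 0" | "r mod 3 = 1" | "r mod 3 = 2" by linarith
  then show ?thesis
  proof cases
    case 1
    show ?thesis by (rule that(1); use 1 in presburger)
  next
    case 2
    show ?thesis by (rule that(2); use 2 in presburger)
  next
    case 3
    show ?thesis by (rule that(3); use 3 in presburger)
  qed
qed

lemma graph_energy_reflection:
  "graph_energy m (\<lambda>x. u (reflection r x)) (\<lambda>x. v (reflection r x)) = graph_energy m u v"
proof (induction m arbitrary: u v)
  case 0
  have v: "reflection r (vertex 0) = vertex ((2 * r + 2 * 0) mod 3)"
    "reflection r (vertex 1) = vertex ((2 * r + 2 * 1) mod 3)"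
    "reflection r (vertex 2) = vertex ((2 * r + 2 * 2) mod 3)"
    by (simp_all only: reflection_vertex insert_iff simp_thms)
  show ?case
    by (rule reflection_index_cases[of r]) (simp_all only: graph_energy_0 v, simp_all add: algebra_simps)
next
  case (Suc m)
  let ?\<rho> = "\<lambda>i. (2 * r + 2 * i) mod 3"
  let ?E = "\<lambda>i. graph_energy m (\<lambda>x. u (contraction i x)) (\<lambda>x. v (contraction i x))"
  have *: "graph_energy m (\<lambda>x. u (reflection r (contraction i x))) (\<lambda>x. v (reflection r (contraction i x)))
      = ?E (?\<rho> i)" if "i \<in> {0,1,2}" for i
    using Suc.IH[of "\<lambda>x. u (contraction (?\<rho> i) x)" "\<lambda>x. v (contraction (?\<rho> i) x)"]
    by (simp only: reflection_contraction[OF that])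
  have "?E (?\<rho> 0) + ?E (?\<rho> 1) + ?E (?\<rho> 2) = ?E 0 + ?E 1 + ?E 2"
    by (rule reflection_index_cases[of r]) simp_all
  then show ?case
    using *[of 0] *[of 1] *[of 2] by (simp only: graph_energy_Suc' insert_iff simp_thms)
qed

lemma energy_domain_reflection:
  "u \<in> energy_domain \<Longrightarrow> (\<lambda>x. u (reflection r x)) \<in> energy_domain"
  by (simp add: energy_domain_def graph_energy_reflection continuous_on_gasket_reflection)

lemma energy_reflection: "energy (\<lambda>x. u (reflection r x)) (\<lambda>x. v (reflection r x)) = energy u v"
  by (simp add: energy_def graph_energy_reflection)

section \<open>Gluing functions along cells\<close>

text \<open>\<open>2 *\<^sub>R x - vertex i\<close> inverts \<open>contraction i\<close>. At a
  junction point the order of the tests decides which piece is evaluated, which is harmless under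
  \<open>matching\<close>.\<close>

definition glue :: "(nat \<Rightarrow> point \<Rightarrow> real) \<Rightarrow> point \<Rightarrow> real" where
  "glue v x = (if x \<in> contraction 0 ` gasket then v 0 (2 *\<^sub>R x - vertex 0)
     else if x \<in> contraction 1 ` gasket then v 1 (2 *\<^sub>R x - vertex 1)
     else v 2 (2 *\<^sub>R x - vertex 2))"

text \<open>Cells \<open>i\<close> and \<open>k\<close> meet only at
  \<open>contraction i (vertex k)\<close>, which is also \<open>contraction k (vertex i)\<close>;
  the two pieces have to agree there.\<close>

definition matching :: "(nat \<Rightarrow> point \<Rightarrow> real) \<Rightarrow> bool" where
  "matching v \<longleftrightarrow> (\<forall>i\<in>{0,1,2}. \<forall>k\<in>{0,1,2}. v i (vertex k) = v k (vertex i))"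

lemma contraction_inverse: "2 *\<^sub>R contraction i x - vertex i = x"
  by (simp add: contraction_eq)

lemma glue_contraction:
  assumes "matching v" "i \<in> {0,1,2}" "x \<in> gasket"
  shows "glue v (contraction i x) = v i x"
proof -
  have *: "v k (2 *\<^sub>R contraction i x - vertex k) = v i x"
    if "k \<in> {0,1,2}" "contraction i x \<in> contraction k ` gasket" for k
  proof (cases "k = i")
    case False
    from that(2) obtain y where y: "y \<in> gasket" "contraction i x = contraction k y" by blast
    then have "x = vertex k" "y = vertex i"
      using cells_meet[OF assms(2) that(1) _ assms(3) y(1)] False by auto
    moreover have "v k (vertex i) = v i (vertex k)"
      using assms(1,2) that(1) unfolding matching_def by blast
    ultimately show ?thesis using y(2) by (simp add: contraction_inverse)
  qed (simp add: contraction_inverse)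
  have own: "contraction i x \<in> contraction i ` gasket" using assms(3) by (rule imageI)
  consider "contraction i x \<in> contraction 0 ` gasket"
    | "contraction i x \<notin> contraction 0 ` gasket" "contraction i x \<in> contraction 1 ` gasket"
    | "contraction i x \<notin> contraction 0 ` gasket" "contraction i x \<notin> contraction 1 ` gasket" "i = 2"
    using own assms(2) by blast
  then show ?thesis
  proof cases
    case 1
    with *[of 0] show ?thesis by (simp add: glue_def)
  next
    case 2
    with *[of 1] show ?thesis by (simp add: glue_def)
  next
    case 3
    with *[of 2] own show ?thesis by (simp add: glue_def)
  qed
qed

lemma glue_continuous:
  assumes "matching v" "\<And>i. i \<in> {0,1,2} \<Longrightarrow> continuous_on gasket (v i)"
  shows "continuous_on gasket (glue v)"
proof -
  have cell: "continuous_on (contraction i ` gasket) (glue v)" if i: "i \<in> {0,1,2}" for i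
  proof -
    have "continuous_on (contraction i ` gasket) (\<lambda>x. v i (2 *\<^sub>R x - vertex i))"
      by (rule continuous_on_compose2[OF assms(2)[OF i]])
        (intro continuous_intros, simp add: image_image contraction_inverse)
    moreover have "v i (2 *\<^sub>R x - vertex i) = glue v x" if "x \<in> contraction i ` gasket" for x
    proof -
      from that obtain y where "y \<in> gasket" "x = contraction i y" by blast
      with glue_contraction[OF assms(1) i] show ?thesis by (simp add: contraction_inverse)
    qed
    ultimately show ?thesis by (rule continuous_on_eq)
  qed
  have "closed (contraction i ` gasket)" for i
    by (intro compact_imp_closed compact_continuous_image compact_gasket continuous_on_contraction
        continuous_on_id)
  then have "continuous_on (\<Union>i\<in>{0,1,2}. contraction i ` gasket) (glue v)"
    by (intro continuous_on_closed_Union cell) simp_all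
  then show ?thesis by (simp only: gasket_fixed[symmetric])
qed

lemma glue_energy_domain:
  assumes "matching v" "\<And>i. i \<in> {0,1,2} \<Longrightarrow> v i \<in> energy_domain"
  shows "glue v \<in> energy_domain"
proof -
  have eq: "graph_energy (Suc m) (glue v) (glue v) = 5/3 * (\<Sum>i\<in>{0,1,2}. graph_energy m (v i) (v i))" for m
    unfolding graph_energy_Suc
    by (intro arg_cong[where f = "(*) _"] sum.cong refl graph_energy_cong glue_contraction assms(1))
  have "convergent (\<lambda>m. graph_energy (Suc m) (glue v) (glue v))"
    unfolding eq using assms(2)
    by (intro convergent_mult convergent_const convergent_sum) (simp add: energy_domain_def)
  then have "convergent (\<lambda>m. graph_energy m (glue v) (glue v))"
    by (rule iffD1[OF convergent_Suc_iff])
  moreover have "continuous_on gasket (glue v)"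
    by (intro glue_continuous assms(1) energy_domain_continuous assms(2))
  ultimately show ?thesis by (simp add: energy_domain_def)
qed

section \<open>Harmonic functions\<close>

text \<open>The corner values on cell \<open>i\<close> of the harmonic function with corner values
  \<open>a\<close>. For \<open>k\<close> different from \<open>i\<close> the formula is the 2/5,
  2/5, 1/5 rule, with weight 1/5 on the third corner.\<close>

definition harm_ext :: "nat \<Rightarrow> (nat \<Rightarrow> real) \<Rightarrow> nat \<Rightarrow> real" where
  "harm_ext i a k = (if k = i then a i else (a i + a k + (a 0 + a 1 + a 2)) / 5)"

text \<open>The extension rule is applied down to level \<open>m\<close>, with barycentric
  interpolation inside the cells. Each approximation is continuous on the gasket, so the limit
  inherits continuity by uniform convergence.\<close>

primrec harm_approx :: "nat \<Rightarrow> (nat \<Rightarrow> real) \<Rightarrow> point \<Rightarrow> real" where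
  "harm_approx 0 a = (\<lambda>x. a 0 * bary 0 x + a 1 * bary 1 x + a 2 * bary 2 x)"
| "harm_approx (Suc m) a = glue (\<lambda>i. harm_approx m (harm_ext i a))"

definition harmonic :: "(nat \<Rightarrow> real) \<Rightarrow> point \<Rightarrow> real" where
  "harmonic a x = lim (\<lambda>m. harm_approx m a x)"

lemma harm_ext_commute: "harm_ext i a k = harm_ext k a i"
  by (simp add: harm_ext_def)

lemma matching_harm_extI:
  assumes "\<And>b k. k \<in> {0,1,2} \<Longrightarrow> f b (vertex k) = b k"
  shows "matching (\<lambda>i. f (harm_ext i a))"
  unfolding matching_def
proof (intro ballI)
  fix i k :: nat assume i: "i \<in> {0,1,2}" and k: "k \<in> {0,1,2}"
  show "f (harm_ext i a) (vertex k) = f (harm_ext k a) (vertex i)"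
    unfolding assms[OF i] assms[OF k] by (rule harm_ext_commute)
qed

lemma harm_approx_matching_vertex:
  "matching (\<lambda>i. harm_approx m (harm_ext i a)) \<and> (k \<in> {0,1,2} \<longrightarrow> harm_approx m a (vertex k) = a k)"
proof (induction m arbitrary: a k)
  case 0
  have "harm_approx 0 b (vertex k) = b k" if "k \<in> {0,1,2}" for b k
    using that by (elim idx_cases) (simp_all add: bary_vertex)
  then show ?case by (intro conjI impI matching_harm_extI)
next
  case (Suc m)
  have v: "harm_approx (Suc m) b (vertex k) = b k" if k: "k \<in> {0,1,2}" for b k
  proof -
    have "harm_approx (Suc m) b (contraction k (vertex k)) = harm_approx m (harm_ext k b) (vertex k)"
      unfolding harm_approx.simps by (rule glue_contraction[OF conjunct1[OF Suc.IH] k]) simp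
    also have "\<dots> = harm_ext k b k" using Suc.IH k by blast
    also have "\<dots> = b k" by (simp add: harm_ext_def)
    finally show ?thesis by simp
  qed
  then show ?case by (intro conjI impI matching_harm_extI)
qed

lemma harm_approx_contraction:
  "i \<in> {0,1,2} \<Longrightarrow> x \<in> gasket \<Longrightarrow>
    harm_approx (Suc m) a (contraction i x) = harm_approx m (harm_ext i a) x"
  unfolding harm_approx.simps by (rule glue_contraction[OF conjunct1[OF harm_approx_matching_vertex]])

lemma harm_approx_continuous: "continuous_on gasket (harm_approx m a)"
proof (induction m arbitrary: a)
  case 0
  show ?case by (simp, intro continuous_intros)
next
  case (Suc m)
  show ?case
    unfolding harm_approx.simps
    by (intro glue_continuous Suc conjunct1[OF harm_approx_matching_vertex])
qed

definition spread :: "(nat \<Rightarrow> real) \<Rightarrow> real" where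
  "spread a = \<bar>a 0 - a 1\<bar> + \<bar>a 0 - a 2\<bar> + \<bar>a 1 - a 2\<bar>"

text \<open>Each difference on a cell combines old differences with weights 2/5 and 1/5, and every
  old difference receives total weight at most 3/5. This geometric decay drives the uniform
  convergence.\<close>

lemma spread_harm_ext:
  assumes "i \<in> {0,1,2}"
  shows "spread (harm_ext i a) \<le> 3/5 * spread a"
proof -
  have *: "\<bar>x - (x + y + (x + y + z)) / 5\<bar> + \<bar>x - (x + z + (x + y + z)) / 5\<bar> +
      \<bar>(x + y + (x + y + z)) / 5 - (x + z + (x + y + z)) / 5\<bar>
      \<le> 3/5 * (\<bar>x - y\<bar> + \<bar>x - z\<bar> + \<bar>y - z\<bar>)" for x y z :: real
  proof -
    have e: "x - (x + y + (x + y + z)) / 5 = 2/5 * (x - y) + 1/5 * (x - z)"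
      "x - (x + z + (x + y + z)) / 5 = 2/5 * (x - z) + 1/5 * (x - y)"
      "(x + y + (x + y + z)) / 5 - (x + z + (x + y + z)) / 5 = 1/5 * (y - z)"
      by (simp_all add: field_simps)
    have tri: "\<bar>2/5 * p + 1/5 * q\<bar> \<le> 2/5 * \<bar>p\<bar> + 1/5 * \<bar>q\<bar>" for p q :: real
      using abs_triangle_ineq[of "2/5 * p" "1/5 * q"] by (simp add: abs_mult)
    note tri[of "x - y" "x - z"] tri[of "x - z" "x - y"]
    moreover have "\<bar>1/5 * (y - z)\<bar> = 1/5 * \<bar>y - z\<bar>" "0 \<le> \<bar>y - z\<bar>" by (simp_all add: abs_mult)
    ultimately have "\<bar>2/5 * (x - y) + 1/5 * (x - z)\<bar> + \<bar>2/5 * (x - z) + 1/5 * (x - y)\<bar> +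
        \<bar>1/5 * (y - z)\<bar> \<le> 2/5 * \<bar>x - y\<bar> + 1/5 * \<bar>x - z\<bar> + (2/5 * \<bar>x - z\<bar> + 1/5 * \<bar>x - y\<bar>)
        + 3/5 * \<bar>y - z\<bar>" by linarith
    then show ?thesis unfolding e by simp
  qed
  consider "i = 0" | "i = 1" | "i = 2" using assms by blast
  then show ?thesis
  proof cases
    case 1
    then show ?thesis using *[of "a 0" "a 1" "a 2"] by (simp add: spread_def harm_ext_def)
  next
    case 2
    have "spread (harm_ext 1 a) = \<bar>a 1 - (a 1 + a 0 + (a 1 + a 0 + a 2)) / 5\<bar> +
      \<bar>a 1 - (a 1 + a 2 + (a 1 + a 0 + a 2)) / 5\<bar> +
      \<bar>(a 1 + a 0 + (a 1 + a 0 + a 2)) / 5 - (a 1 + a 2 + (a 1 + a 0 + a 2)) / 5\<bar>"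
      by (simp add: spread_def harm_ext_def abs_minus_commute add_ac)
    with 2 *[of "a 1" "a 0" "a 2"] show ?thesis
      by (simp add: spread_def abs_minus_commute)
  next
    case 3
    have "spread (harm_ext 2 a) = \<bar>a 2 - (a 2 + a 0 + (a 2 + a 0 + a 1)) / 5\<bar> +
      \<bar>a 2 - (a 2 + a 1 + (a 2 + a 0 + a 1)) / 5\<bar> +
      \<bar>(a 2 + a 0 + (a 2 + a 0 + a 1)) / 5 - (a 2 + a 1 + (a 2 + a 0 + a 1)) / 5\<bar>"
      by (simp add: spread_def harm_ext_def abs_minus_commute add_ac)
    with 3 *[of "a 2" "a 0" "a 1"] show ?thesis
      by (simp add: spread_def abs_minus_commute)
  qed
qed

lemma harm_approx_step:
  assumes "x \<in> gasket"
  shows "\<bar>harm_approx (Suc m) a x - harm_approx m a x\<bar> \<le> (3/5) ^ m * spread a"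
  using assms
proof (induction m arbitrary: a x)
  case 0
  then obtain i y where i: "i \<in> {0,1,2}" and y: "y \<in> gasket" and x: "x = contraction i y"
    by (rule gasket_cases)
  have nn: "bary 0 y \<ge> 0" "bary 1 y \<ge> 0" "bary 2 y \<ge> 0" using bary_nonneg[OF y] by auto
  \<comment> \<open>The change from level 0 to level 1 at the corners of cell \<open>i\<close>:
    harmonic rule against affine midpoint.\<close>
  let ?d = "\<lambda>k. harm_ext i a k - (a i + a k) / 2"
  have d: "\<bar>?d k\<bar> \<le> spread a" if "k \<in> {0,1,2}" for k
  proof -
    have "\<bar>(x + y + z) * 2 - 3 * x - 3 * y\<bar> \<le> 10 * (\<bar>x - y\<bar> + \<bar>x - z\<bar> + \<bar>y - z\<bar>)" for x y z :: real
    proof -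
      have "(x + y + z) * 2 - 3 * x - 3 * y = - (x - z) - (y - z)" by simp
      then have "\<bar>(x + y + z) * 2 - 3 * x - 3 * y\<bar> \<le> \<bar>x - z\<bar> + \<bar>y - z\<bar>"
        using abs_triangle_ineq4[of "- (x - z)" "y - z"] by (simp only: abs_minus_cancel)
      also have "\<dots> \<le> 10 * (\<bar>x - y\<bar> + \<bar>x - z\<bar> + \<bar>y - z\<bar>)"
        by (simp add: distrib_left add_increasing add_mono)
      finally show ?thesis .
    qed
    \<comment> \<open>For distinct \<open>i\<close> and \<open>k\<close> the index
      \<open>3 - i - k\<close> is the third corner.\<close>
    note bound = this[of "a i" "a k" "a (3 - i - k)"]
    have *: "\<bar>(a 0 + a 1 + a 2) * 2 - 3 * a i - 3 * a k\<bar> \<le> 10 * spread a" if "k \<noteq> i"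
    proof -
      have "a 0 + a 1 + a 2 = a i + a k + a (3 - i - k)"
        using that i \<open>k \<in> {0,1,2}\<close> by (elim idx_cases) (simp_all add: numeral_eq_Suc)
      moreover have "spread a = \<bar>a i - a k\<bar> + \<bar>a i - a (3 - i - k)\<bar> + \<bar>a k - a (3 - i - k)\<bar>"
        using that i \<open>k \<in> {0,1,2}\<close>
        by (elim idx_cases) (simp_all add: spread_def abs_minus_commute numeral_eq_Suc)
      ultimately show ?thesis using bound by (simp only:)
    qed
    have "spread a \<ge> 0" by (simp add: spread_def)
    show ?thesis
    proof (cases "k = i")
      case True
      with \<open>spread a \<ge> 0\<close> show ?thesis by (simp add: harm_ext_def)
    next
      case False
      then have "?d k = ((a 0 + a 1 + a 2) * 2 - 3 * a i - 3 * a k) / 10"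
        by (simp add: harm_ext_def field_simps)
      with *[OF False] show ?thesis by (simp only: abs_divide abs_numeral) simp
    qed
  qed
  have b1: "bary (Suc 0) y = 1 - bary 0 y - bary 2 y" using bary_sum[of y] by simp
  have "harm_approx 0 a (contraction i y) = (a i + a 0) / 2 * bary 0 y + (a i + a 1) / 2 * bary 1 y
      + (a i + a 2) / 2 * bary 2 y"
    using i by (elim idx_cases) (simp_all add: b1 bary_contraction bary_vertex algebra_simps
        add_divide_distrib diff_divide_distrib)
  then have "harm_approx (Suc 0) a x - harm_approx 0 a x =
      ?d 0 * bary 0 y + ?d 1 * bary 1 y + ?d 2 * bary 2 y"
    unfolding x harm_approx_contraction[OF i y] by (simp add: algebra_simps)
  also have "\<bar>\<dots>\<bar> \<le> \<bar>?d 0\<bar> * bary 0 y + \<bar>?d 1\<bar> * bary 1 y + \<bar>?d 2\<bar> * bary 2 y"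
    using nn by (intro order_trans[OF abs_triangle_ineq] add_mono) (simp_all add: abs_mult)
  also have "\<dots> \<le> spread a * bary 0 y + spread a * bary 1 y + spread a * bary 2 y"
    using nn d by (intro add_mono mult_right_mono) auto
  also have "\<dots> = spread a" using bary_sum[of y] by (simp flip: distrib_left)
  finally show ?case by simp
next
  case (Suc m)
  then obtain i y where i: "i \<in> {0,1,2}" and y: "y \<in> gasket" and x: "x = contraction i y"
    using gasket_cases by metis
  have "\<bar>harm_approx (Suc (Suc m)) a x - harm_approx (Suc m) a x\<bar> \<le> (3/5) ^ m * spread (harm_ext i a)"
    unfolding x harm_approx_contraction[OF i y] by (rule Suc.IH[OF y])
  also have "\<dots> \<le> (3/5) ^ m * (3/5 * spread a)"
    by (intro mult_left_mono spread_harm_ext i) simp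
  finally show ?case by simp
qed

lemma harmonic_uniform_limit: "uniform_limit gasket (\<lambda>m. harm_approx m a) (harmonic a) sequentially"
proof -
  let ?d = "\<lambda>k x. harm_approx (Suc k) a x - harm_approx k a x"
  have "uniform_limit gasket (\<lambda>m x. \<Sum>k<m. ?d k x) (\<lambda>x. suminf (\<lambda>k. ?d k x)) sequentially"
  proof (rule Weierstrass_m_test)
    show "norm (?d k x) \<le> (3/5) ^ k * spread a" if "x \<in> gasket" for k x
      using harm_approx_step[OF that] by simp
    show "summable (\<lambda>k. (3/5::real) ^ k * spread a)"
      by (intro summable_mult2 summable_geometric) simp
  qed
  then have lim: "uniform_limit gasket (\<lambda>m x. (\<Sum>k<m. ?d k x) + harm_approx 0 a x)
      (\<lambda>x. suminf (\<lambda>k. ?d k x) + harm_approx 0 a x) sequentially"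
    by (intro uniform_limit_intros)
  have tele: "(\<Sum>k<m. ?d k x) + harm_approx 0 a x = harm_approx m a x" for m x
    by (subst sum_lessThan_telescope) simp
  from lim have lim': "uniform_limit gasket (\<lambda>m. harm_approx m a)
      (\<lambda>x. suminf (\<lambda>k. ?d k x) + harm_approx 0 a x) sequentially"
    unfolding tele .
  moreover have "harmonic a x = suminf (\<lambda>k. ?d k x) + harm_approx 0 a x" if "x \<in> gasket" for x
    unfolding harmonic_def by (rule limI) (rule tendsto_uniform_limitI[OF lim' that])
  ultimately show ?thesis by (simp cong: uniform_limit_cong')
qed

lemma harmonic_LIMSEQ: "x \<in> gasket \<Longrightarrow> (\<lambda>m. harm_approx m a x) \<longlonglongrightarrow> harmonic a x"
  by (rule tendsto_uniform_limitI[OF harmonic_uniform_limit])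

lemma harmonic_continuous: "continuous_on gasket (harmonic a)"
  by (rule uniform_limit_theorem[OF _ harmonic_uniform_limit]) (simp_all add: harm_approx_continuous)

lemma harmonic_vertex [simp]: "k \<in> {0,1,2} \<Longrightarrow> harmonic a (vertex k) = a k"
  using harmonic_LIMSEQ[of "vertex k" a] harm_approx_matching_vertex[of _ a k]
  by (simp add: LIMSEQ_const_iff)

lemma harmonic_contraction:
  assumes "i \<in> {0,1,2}" "x \<in> gasket"
  shows "harmonic a (contraction i x) = harmonic (harm_ext i a) x"
proof (rule LIMSEQ_unique)
  show "(\<lambda>m. harm_approx (Suc m) a (contraction i x)) \<longlonglongrightarrow> harmonic a (contraction i x)"
    by (rule LIMSEQ_Suc) (intro harmonic_LIMSEQ contraction_gasket assms)
  show "(\<lambda>m. harm_approx (Suc m) a (contraction i x)) \<longlonglongrightarrow> harmonic (harm_ext i a) x"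
    unfolding harm_approx_contraction[OF assms] by (intro harmonic_LIMSEQ assms)
qed

lemma graph_energy_Suc_harmonic:
  "graph_energy (Suc m) u (harmonic a) =
    5/3 * (\<Sum>i\<in>{0,1,2}. graph_energy m (\<lambda>x. u (contraction i x)) (harmonic (harm_ext i a)))"
  unfolding graph_energy_Suc
  by (intro arg_cong[where f = "(*) _"] sum.cong refl graph_energy_cong harmonic_contraction)

text \<open>A harmonic function is balanced at each midpoint, so the midpoint values of the
  arbitrary function \<open>u\<close> cancel and only its corner values contribute.\<close>

lemma graph_energy_1_harmonic: "graph_energy (Suc 0) u (harmonic a) = graph_energy 0 u (harmonic a)"
proof -
  \<comment> \<open>Dividing by 5 clears the denominators of the extension rule.\<close>
  define A B C where "A = a 0 / 5" "B = a 1 / 5" "C = a 2 / 5"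
  then have a: "a 0 = 5 * A" "a 1 = 5 * B" "a 2 = 5 * C" by simp_all
  have e: "harm_ext 0 a 0 = 5 * A" "harm_ext 1 a 1 = 5 * B" "harm_ext 2 a 2 = 5 * C"
    "harm_ext 0 a 1 = 2 * A + 2 * B + C" "harm_ext 1 a 0 = 2 * A + 2 * B + C"
    "harm_ext 0 a 2 = 2 * A + B + 2 * C" "harm_ext 2 a 0 = 2 * A + B + 2 * C"
    "harm_ext 1 a 2 = A + 2 * B + 2 * C" "harm_ext 2 a 1 = A + 2 * B + 2 * C"
    by (simp_all add: harm_ext_def a a(2)[unfolded One_nat_def])
  have u: "u (contraction 1 (vertex 0)) = u (contraction 0 (vertex 1))"
    "u (contraction 2 (vertex 0)) = u (contraction 0 (vertex 2))"
    "u (contraction 2 (vertex 1)) = u (contraction 1 (vertex 2))"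
    by (simp_all only: contraction_vertex_commute[of 1 0] contraction_vertex_commute[of 2 0]
        contraction_vertex_commute[of 2 1])
  have "3 * graph_energy (Suc 0) u (harmonic a) = 3 * graph_energy 0 u (harmonic a)"
    unfolding graph_energy_Suc_harmonic graph_energy_0 sum_idx
    by (simp only: harmonic_vertex insert_iff simp_thms e u contraction_vertex a)
      (simp add: algebra_simps)
  then show ?thesis by simp
qed

lemma graph_energy_harmonic: "graph_energy m u (harmonic a) = graph_energy 0 u (harmonic a)"
proof (induction m arbitrary: u a)
  case (Suc m)
  have "graph_energy (Suc m) u (harmonic a) = graph_energy (Suc 0) u (harmonic a)"
    unfolding graph_energy_Suc_harmonic
    by (intro arg_cong[where f = "(*) _"] sum.cong refl Suc)
  then show ?case by (simp only: graph_energy_1_harmonic)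
qed simp

lemma harmonic_energy_domain: "harmonic a \<in> energy_domain"
  unfolding energy_domain_iff
  by (intro conjI harmonic_continuous exI[of _ "graph_energy 0 (harmonic a) (harmonic a)"] allI)
    (rule eq_refl, rule graph_energy_harmonic)

text \<open>Against a harmonic function the graph energies are constant in the level, so the limit
  exists for every \<open>u\<close>. Pairings with \<open>hat 0\<close> thereby become finite
  expressions in corner values.\<close>

lemma energy_harmonic: "energy u (harmonic a) = graph_energy 0 u (harmonic a)"
  by (rule energy_eqI) (subst graph_energy_harmonic, rule tendsto_const)

definition hat :: "nat \<Rightarrow> point \<Rightarrow> real" where
  "hat k = harmonic (\<lambda>i. of_bool (i = k))"

lemma hat_vertex [simp]: "i \<in> {0,1,2} \<Longrightarrow> hat k (vertex i) = of_bool (i = k)"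
  unfolding hat_def by simp

lemma hat_energy_domain: "hat k \<in> energy_domain"
  unfolding hat_def by (rule harmonic_energy_domain)

lemma hat_continuous: "continuous_on gasket (hat k)"
  unfolding hat_def by (rule harmonic_continuous)

section \<open>Integration over the gasket\<close>

lemma small_cells:
  fixes g :: "point \<Rightarrow> real"
  assumes "continuous_on gasket g" "e > 0"
  obtains m where "\<And>w x y. w \<in> words m \<Longrightarrow> x \<in> gasket \<Longrightarrow> y \<in> gasket \<Longrightarrow>
    \<bar>g (word_map w x) - g (word_map w y)\<bar> < e"
proof -
  have "uniformly_continuous_on gasket g"
    using assms(1) compact_gasket by (rule compact_uniformly_continuous)
  then obtain d where "d > 0" and d: "\<And>x y. x \<in> gasket \<Longrightarrow> y \<in> gasket \<Longrightarrow> dist y x < d \<Longrightarrow>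
      dist (g y) (g x) < e"
    using \<open>e > 0\<close> unfolding uniformly_continuous_on_def by blast
  have "bounded gasket" using compact_gasket by (rule compact_imp_bounded)
  then obtain B where B: "\<And>x y. x \<in> gasket \<Longrightarrow> y \<in> gasket \<Longrightarrow> dist x y \<le> B"
    unfolding bounded_two_points by blast
  have "(\<lambda>m. B / 2 ^ m) \<longlonglongrightarrow> 0" by (rule LIMSEQ_divide_realpow_zero) simp
  then obtain m where m: "B / 2 ^ m < d"
    using \<open>d > 0\<close> by (metis (no_types, lifting) eventually_sequentially order.refl order_tendstoD(2))
  show ?thesis
  proof (rule that)
    fix w x y assume w: "w \<in> words m" and x: "x \<in> gasket" and y: "y \<in> gasket"
    have "dist (word_map w x) (word_map w y) = dist x y / 2 ^ m" using w by (rule dist_word_map)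
    also have "\<dots> \<le> B / 2 ^ m" using B[OF x y] by (simp add: divide_right_mono)
    finally have "dist (word_map w x) (word_map w y) < d" using m by simp
    then show "\<bar>g (word_map w x) - g (word_map w y)\<bar> < e"
      using d[OF word_map_gasket[OF w y] word_map_gasket[OF w x]] by (simp add: dist_real_def)
  qed
qed

text \<open>The equally weighted Riemann sum over the images of one sample point \<open>p\<close> in
  all \<open>m\<close>-cells. \<open>gasket_measure\<close> speaks of contractions only; reflection
  invariance of the integral is reached through these sums.\<close>

primrec cell_average :: "nat \<Rightarrow> point \<Rightarrow> (point \<Rightarrow> real) \<Rightarrow> real" where
  "cell_average 0 p g = g p"
| "cell_average (Suc m) p g = 1/3 * (\<Sum>i\<in>{0,1,2}. cell_average m p (\<lambda>x. g (contraction i x)))"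

lemma cell_average_reflection:
  "cell_average m p (\<lambda>x. g (reflection r x)) = cell_average m (reflection r p) g"
proof (induction m arbitrary: g)
  case (Suc m)
  let ?\<rho> = "\<lambda>i. (2 * r + 2 * i) mod 3"
  let ?A = "\<lambda>i. cell_average m (reflection r p) (\<lambda>x. g (contraction i x))"
  have *: "cell_average m p (\<lambda>x. g (reflection r (contraction i x))) = ?A (?\<rho> i)"
    if "i \<in> {0,1,2}" for i
    using Suc.IH[of "\<lambda>x. g (contraction (?\<rho> i) x)"] by (simp only: reflection_contraction[OF that])
  have "(\<Sum>i\<in>{0,1,2}. cell_average m p (\<lambda>x. g (reflection r (contraction i x))))
      = (\<Sum>i\<in>{0,1,2}. ?A (?\<rho> i))"
    by (intro sum.cong refl *)
  also have "\<dots> = ?A (?\<rho> 0) + ?A (?\<rho> 1) + ?A (?\<rho> 2)" by simp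
  also have "\<dots> = ?A 0 + ?A 1 + ?A 2"
    by (rule reflection_index_cases[of r]) simp_all
  finally show ?case by simp
qed simp

lemma gasket_sets_borel: "gasket \<in> sets borel"
  by (intro borel_closed compact_imp_closed compact_gasket)

locale gasket_space =
  fixes \<mu> :: "point measure"
  assumes gasket_measure: "gasket_measure \<mu>"
begin

sublocale prob_space \<mu>
  using gasket_measure by (simp add: gasket_measure_def)

lemma sets_mu [measurable_cong]: "sets \<mu> = sets borel"
  using gasket_measure by (simp add: gasket_measure_def)

lemma space_mu [simp]: "space \<mu> = UNIV"
  using sets_eq_imp_space_eq[OF sets_mu] by simp

lemma measure_gasket: "measure \<mu> gasket = 1"
proof -
  have "\<forall>w\<in>words 0. measure \<mu> (word_map w ` gasket) = (1/3) ^ 0"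
    using gasket_measure unfolding gasket_measure_def by blast
  then show ?thesis by (simp add: words_0)
qed

lemma AE_gasket: "AE x in \<mu>. x \<in> gasket"
  by (rule AE_prob_1) (rule measure_gasket)

lemma contraction_measurable [measurable]: "contraction i \<in> borel_measurable borel"
  by (intro borel_measurable_continuous_onI continuous_on_contraction continuous_on_id)

lemma emeasure_contraction:
  assumes "A \<in> sets borel"
  shows "emeasure \<mu> A = (\<Sum>i\<in>{0,1,2}. ennreal (1/3) * emeasure \<mu> (contraction i -` A))"
proof -
  have "measure \<mu> A = (\<Sum>i\<in>{0,1,2}. 1/3 * measure \<mu> (contraction i -` A))"
    using gasket_measure assms unfolding gasket_measure_def by blast
  then have "ennreal (measure \<mu> A) = (\<Sum>i\<in>{0,1,2}. ennreal (1/3 * measure \<mu> (contraction i -` A)))"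
    by (subst sum_ennreal) auto
  then show ?thesis by (simp only: emeasure_eq_measure ennreal_mult'' measure_nonneg)
qed

lemma nn_integral_contraction:
  assumes "f \<in> borel_measurable borel"
  shows "(\<integral>\<^sup>+x. f x \<partial>\<mu>) = (\<Sum>i\<in>{0,1,2}. ennreal (1/3) * (\<integral>\<^sup>+x. f (contraction i x) \<partial>\<mu>))"
  using assms
proof (induction rule: borel_measurable_induct)
  case (cong f g)
  then show ?case by simp
next
  case (set A)
  have "(\<integral>\<^sup>+x. indicator A (contraction i x) \<partial>\<mu>) = emeasure \<mu> (contraction i -` A)" for i
  proof -
    have "(\<lambda>x. indicator A (contraction i x) :: ennreal) = indicator (contraction i -` A)"
      by (auto simp: indicator_def fun_eq_iff)
    moreover have "contraction i -` A \<in> sets \<mu>"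
      using measurable_sets[OF contraction_measurable set] by (simp add: sets_mu)
    ultimately show ?thesis by simp
  qed
  then show ?case using set emeasure_contraction[OF set] by (simp add: sets_mu)
next
  case (mult u c)
  then have [measurable]: "u \<in> borel_measurable borel" by simp
  show ?case using mult
    by (simp add: nn_integral_cmult distrib_left mult.left_commute)
next
  case (add u v)
  then have [measurable]: "u \<in> borel_measurable borel" "v \<in> borel_measurable borel" by simp_all
  show ?case using add by (simp add: nn_integral_add distrib_left add_ac)
next
  case (seq U)
  then have [measurable]: "\<And>k. U k \<in> borel_measurable borel" by simp
  have inc: "incseq (\<lambda>k x. U k (contraction i x))" for i
    using \<open>incseq U\<close> by (simp add: incseq_def le_fun_def del: split_paired_All)
  have SUP_apply': "(SUP k. U k) x = (SUP k. U k x)" for x by (simp add: image_comp)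
  have "(\<integral>\<^sup>+x. (SUP k. U k) x \<partial>\<mu>) = (SUP k. \<integral>\<^sup>+x. U k x \<partial>\<mu>)"
    unfolding SUP_apply' using \<open>incseq U\<close> by (intro nn_integral_monotone_convergence_SUP) simp_all
  also have "\<dots> = (SUP k. \<Sum>i\<in>{0,1,2}. ennreal (1/3) * (\<integral>\<^sup>+x. U k (contraction i x) \<partial>\<mu>))"
    using seq by simp
  also have "\<dots> = (\<Sum>i\<in>{0,1,2}. SUP k. ennreal (1/3) * (\<integral>\<^sup>+x. U k (contraction i x) \<partial>\<mu>))"
    using inc by (intro ennreal_SUP_sum)
      (auto simp: incseq_def le_fun_def intro!: mult_left_mono nn_integral_mono)
  also have "\<dots> = (\<Sum>i\<in>{0,1,2}. ennreal (1/3) * (\<integral>\<^sup>+x. (SUP k. U k) (contraction i x) \<partial>\<mu>))"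
    unfolding SUP_apply' SUP_mult_left_ennreal[symmetric]
    by (subst nn_integral_monotone_convergence_SUP[OF inc]) simp_all
  finally show ?case .
qed

definition gint :: "(point \<Rightarrow> real) \<Rightarrow> real" where
  "gint g = (LINT x:gasket|\<mu>. g x)"

lemma gint_cong: "(\<And>x. x \<in> gasket \<Longrightarrow> g x = h x) \<Longrightarrow> gint g = gint h"
  unfolding gint_def by (rule set_lebesgue_integral_cong) (simp_all add: sets_mu gasket_sets_borel)

lemma continuous_integrable:
  fixes g :: "point \<Rightarrow> real"
  assumes "continuous_on gasket g"
  shows "set_integrable \<mu> gasket g"
proof -
  have "bounded (g ` gasket)"
    by (intro compact_imp_bounded compact_continuous_image assms compact_gasket)
  then obtain B where B: "\<And>x. x \<in> gasket \<Longrightarrow> \<bar>g x\<bar> \<le> B"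
    unfolding bounded_iff by auto
  have "(\<lambda>x. indicator gasket x *\<^sub>R g x) \<in> borel_measurable borel"
    by (intro borel_measurable_continuous_on_indicator gasket_sets_borel assms)
  then have "(\<lambda>x. indicator gasket x *\<^sub>R g x) \<in> borel_measurable \<mu>"
    using measurable_cong_sets[OF sets_mu refl] by blast
  moreover have "norm (indicator gasket x *\<^sub>R g x) \<le> \<bar>B\<bar>" for x
    using B[of x] by (auto simp: indicator_def)
  ultimately show ?thesis
    unfolding set_integrable_def by (intro integrable_const_bound[where B = "\<bar>B\<bar>"]) auto
qed

lemma gint_add: "continuous_on gasket g \<Longrightarrow> continuous_on gasket h \<Longrightarrow> gint (\<lambda>x. g x + h x) = gint g + gint h"
  unfolding gint_def by (intro set_integral_add continuous_integrable)

lemma gint_diff: "continuous_on gasket g \<Longrightarrow> continuous_on gasket h \<Longrightarrow> gint (\<lambda>x. g x - h x) = gint g - gint h"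
  unfolding gint_def by (intro set_integral_diff continuous_integrable)

lemma gint_cmult: "gint (\<lambda>x. c * g x) = c * gint g"
  unfolding gint_def by simp

lemma gint_const: "gint (\<lambda>x. c) = c"
proof -
  have "gint (\<lambda>x. c) = measure \<mu> gasket * c"
    unfolding gint_def set_lebesgue_integral_def using gasket_sets_borel by (simp add: sets_mu)
  then show ?thesis by (simp add: measure_gasket)
qed

lemma gint_mono:
  assumes "continuous_on gasket g" "continuous_on gasket h" "\<And>x. x \<in> gasket \<Longrightarrow> g x \<le> h x"
  shows "gint g \<le> gint h"
  unfolding gint_def by (intro set_integral_mono continuous_integrable assms)

lemma gint_abs_le:
  assumes "continuous_on gasket g" "\<And>x. x \<in> gasket \<Longrightarrow> \<bar>g x\<bar> \<le> c"
  shows "\<bar>gint g\<bar> \<le> c"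
proof -
  have "gint g \<le> gint (\<lambda>x. c)" "gint (\<lambda>x. - c) \<le> gint g"
    using assms(2) by (intro gint_mono assms(1) continuous_on_const; force)+
  then show ?thesis by (simp add: gint_const)
qed

lemma gint_contraction_nonneg:
  assumes "continuous_on gasket g" "\<And>x. x \<in> gasket \<Longrightarrow> g x \<ge> 0"
  shows "gint g = 1/3 * (\<Sum>i\<in>{0,1,2}. gint (\<lambda>x. g (contraction i x)))"
proof -
  let ?f = "\<lambda>x. indicator gasket x *\<^sub>R g x"
  have meas: "?f \<in> borel_measurable borel"
    by (intro borel_measurable_continuous_on_indicator gasket_sets_borel assms)
  have f0: "?f x \<ge> 0" for x using assms(2) by (simp add: indicator_def)
  have nn: "(\<integral>\<^sup>+x. ennreal (?f x) \<partial>\<mu>) = ennreal (gint g)"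
    using continuous_integrable[OF assms(1)] f0
    unfolding gint_def set_lebesgue_integral_def set_integrable_def by (intro nn_integral_eq_integral) auto
  have nni: "(\<integral>\<^sup>+x. ennreal (?f (contraction i x)) \<partial>\<mu>) = ennreal (gint (\<lambda>x. g (contraction i x)))"
    and nn0: "gint (\<lambda>x. g (contraction i x)) \<ge> 0" if i: "i \<in> {0,1,2}" for i
  proof -
    \<comment> \<open>Here the indicator tests \<open>x\<close> instead of
      \<open>contraction i x\<close>. Both points lie in the gasket for almost every
      \<open>x\<close>, since the gasket has full measure.\<close>
    let ?h = "\<lambda>x. indicator gasket x *\<^sub>R g (contraction i x)"
    have h0: "?h x \<ge> 0" for x using assms(2)[OF contraction_gasket[OF i]] by (simp add: indicator_def)
    have "(\<integral>\<^sup>+x. ennreal (?f (contraction i x)) \<partial>\<mu>) = (\<integral>\<^sup>+x. ennreal (?h x) \<partial>\<mu>)"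
      by (rule nn_integral_cong_AE, rule eventually_mono[OF AE_gasket])
        (simp add: contraction_gasket[OF i])
    also have "\<dots> = ennreal (gint (\<lambda>x. g (contraction i x)))"
      using continuous_integrable[OF continuous_on_gasket_contraction[OF i assms(1)]] h0
      unfolding gint_def set_lebesgue_integral_def set_integrable_def
      by (intro nn_integral_eq_integral) auto
    finally show "(\<integral>\<^sup>+x. ennreal (?f (contraction i x)) \<partial>\<mu>) = ennreal (gint (\<lambda>x. g (contraction i x)))" .
    show "gint (\<lambda>x. g (contraction i x)) \<ge> 0"
      unfolding gint_def set_lebesgue_integral_def by (intro Bochner_Integration.integral_nonneg h0)
  qed
  have nng: "gint g \<ge> 0"
    unfolding gint_def set_lebesgue_integral_def by (intro Bochner_Integration.integral_nonneg f0)
  have "ennreal (gint g) = (\<Sum>i\<in>{0,1,2}. ennreal (1/3) * ennreal (gint (\<lambda>x. g (contraction i x))))"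
    unfolding nn[symmetric]
    by (subst nn_integral_contraction) (use meas in measurable, intro sum.cong refl, simp only: nni)
  also have "\<dots> = (\<Sum>i\<in>{0,1,2}. ennreal (1/3 * gint (\<lambda>x. g (contraction i x))))"
    by (intro sum.cong refl) (simp only: ennreal_mult'' nn0)
  also have "\<dots> = ennreal (\<Sum>i\<in>{0,1,2}. 1/3 * gint (\<lambda>x. g (contraction i x)))"
    using nn0 by (intro sum_ennreal) simp
  finally have "gint g = (\<Sum>i\<in>{0,1,2}. 1/3 * gint (\<lambda>x. g (contraction i x)))"
    using nn0 by (subst (asm) ennreal_inj[OF nng]) (intro sum_nonneg, simp, assumption)
  then show ?thesis by (simp add: sum_distrib_left)
qed

text \<open>Adding the bound \<open>B\<close> makes the integrand nonnegative, and the constant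
  cancels on both sides.\<close>

lemma gint_contraction:
  assumes "continuous_on gasket g"
  shows "gint g = 1/3 * (\<Sum>i\<in>{0,1,2}. gint (\<lambda>x. g (contraction i x)))"
proof -
  have "bounded (g ` gasket)"
    by (intro compact_imp_bounded compact_continuous_image assms compact_gasket)
  then obtain B where B: "\<And>x. x \<in> gasket \<Longrightarrow> \<bar>g x\<bar> \<le> B"
    unfolding bounded_iff by auto
  have c: "continuous_on gasket (\<lambda>x. g x + B)" by (intro continuous_intros assms)
  have "gint (\<lambda>x. g x + B) = 1/3 * (\<Sum>i\<in>{0,1,2}. gint (\<lambda>x. g (contraction i x) + B))"
    by (rule gint_contraction_nonneg[OF c]) (use B in force)
  also have "\<dots> = 1/3 * (\<Sum>i\<in>{0,1,2}. gint (\<lambda>x. g (contraction i x)) + B)"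
    by (intro arg_cong[where f = "(*) _"] sum.cong refl)
      (simp only: gint_add continuous_on_gasket_contraction assms continuous_on_const gint_const)
  finally show ?thesis
    by (simp add: gint_add assms gint_const distrib_left)
qed

lemma gint_cell_average:
  assumes "continuous_on gasket g" "p \<in> gasket"
    "\<And>w x y. w \<in> words m \<Longrightarrow> x \<in> gasket \<Longrightarrow> y \<in> gasket \<Longrightarrow> \<bar>g (word_map w x) - g (word_map w y)\<bar> < e"
  shows "\<bar>gint g - cell_average m p g\<bar> \<le> e"
  using assms(1,3)
proof (induction m arbitrary: g)
  case 0
  have "\<bar>gint (\<lambda>x. g x - g p)\<bar> \<le> e"
  proof (rule gint_abs_le)
    show "\<bar>g x - g p\<bar> \<le> e" if "x \<in> gasket" for x
      using 0(2)[of "[]" x p] that assms(2) by (simp add: words_0 less_imp_le)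
  qed (intro continuous_intros 0)
  then show ?case by (simp add: gint_diff 0 gint_const)
next
  case (Suc m)
  have *: "\<bar>gint (\<lambda>x. g (contraction i x)) - cell_average m p (\<lambda>x. g (contraction i x))\<bar> \<le> e"
    if i: "i \<in> {0,1,2}" for i
  proof (rule Suc.IH)
    show "continuous_on gasket (\<lambda>x. g (contraction i x))"
      using i Suc.prems(1) by (rule continuous_on_gasket_contraction)
    fix w x y assume "w \<in> words m" "x \<in> gasket" "y \<in> gasket"
    then show "\<bar>g (contraction i (word_map w x)) - g (contraction i (word_map w y))\<bar> < e"
      using Suc.prems(2)[of "i # w" x y] i by (auto simp: words_Suc)
  qed
  have mean: "\<bar>1/3 * (a + b + c) - 1/3 * (a' + b' + c')\<bar> \<le> e"
    if "\<bar>a - a'\<bar> \<le> e" "\<bar>b - b'\<bar> \<le> e" "\<bar>c - c'\<bar> \<le> e" for a a' b b' c c' :: real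
    using that by (simp add: abs_le_iff field_simps)
  show ?case
    unfolding cell_average.simps gint_contraction[OF Suc.prems(1)] sum_idx
    by (intro mean *) simp_all
qed

text \<open>A reflection permutes the \<open>m\<close>-cells, so a Riemann sum of the reflected
  function is one of \<open>g\<close> at the reflected sample point. Both integrals are therefore
  close to the same sum.\<close>

lemma gint_reflection:
  assumes "continuous_on gasket g"
  shows "gint (\<lambda>x. g (reflection r x)) = gint g"
proof -
  have c: "continuous_on gasket (\<lambda>x. g (reflection r x))"
    using assms by (rule continuous_on_gasket_reflection)
  have "\<bar>gint (\<lambda>x. g (reflection r x)) - gint g\<bar> \<le> e" if "e > 0" for e
  proof -
    have "e / 2 > 0" using that by simp
    then obtain m where
      m: "\<And>w x y. w \<in> words m \<Longrightarrow> x \<in> gasket \<Longrightarrow> y \<in> gasket \<Longrightarrow>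
        \<bar>g (word_map w x) - g (word_map w y)\<bar> < e / 2"
      by (rule small_cells[OF assms]) (rule that)
    \<comment> \<open>This carries the small oscillation of \<open>g\<close> on
      \<open>m\<close>-cells over to the reflected function.\<close>
    have cell: "\<exists>w'\<in>words k. \<forall>z. reflection r (word_map w z) = word_map w' (reflection r z)"
      if "w \<in> words k" for k w
      using that
    proof (induction k arbitrary: w)
      case 0
      then show ?case by (simp add: words_0)
    next
      case (Suc k)
      then obtain i v where i: "i \<in> {0,1,2}" "v \<in> words k" "w = i # v" by (auto simp: words_Suc)
      from Suc.IH[OF i(2)] obtain v' where v': "v' \<in> words k"
        "\<forall>z. reflection r (word_map v z) = word_map v' (reflection r z)" by (rule bexE)
      have "(2 * r + 2 * i) mod 3 \<in> {0,1,2}" by auto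
      then have "((2 * r + 2 * i) mod 3) # v' \<in> words (Suc k)"
        unfolding words_Suc by (rule UN_I) (rule imageI, rule v'(1))
      moreover have "reflection r (word_map w z)
          = word_map (((2 * r + 2 * i) mod 3) # v') (reflection r z)" for z
        by (simp only: i(3) word_map_Cons reflection_contraction[OF i(1)] v'(2)[rule_format])
      ultimately show ?case by (intro bexI[of _ "((2 * r + 2 * i) mod 3) # v'"] allI)
    qed
    have m': "\<bar>g (reflection r (word_map w x)) - g (reflection r (word_map w y))\<bar> < e / 2"
      if w: "w \<in> words m" and x: "x \<in> gasket" and y: "y \<in> gasket" for w x y
    proof -
      from cell[OF w] obtain w' where w': "w' \<in> words m"
        "\<forall>z. reflection r (word_map w z) = word_map w' (reflection r z)" by (rule bexE)
      show ?thesis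
        using m[OF w'(1) reflection_gasket[OF x] reflection_gasket[OF y]] w'(2)[rule_format] by simp
    qed
    have "\<bar>gint (\<lambda>x. g (reflection r x)) - cell_average m (reflection r (vertex 0)) g\<bar> \<le> e / 2"
      using gint_cell_average[OF c vertex_in_gasket m'] by (simp only: cell_average_reflection)
    moreover have "\<bar>gint g - cell_average m (reflection r (vertex 0)) g\<bar> \<le> e / 2"
      by (rule gint_cell_average[OF assms reflection_gasket[OF vertex_in_gasket] m])
    moreover have "\<bar>a - c\<bar> \<le> e / 2 \<Longrightarrow> \<bar>b - c\<bar> \<le> e / 2 \<Longrightarrow> \<bar>a - b\<bar> \<le> e" for a b c :: real
      by linarith
    ultimately show ?thesis by blast
  qed
  then have "\<bar>gint (\<lambda>x. g (reflection r x)) - gint g\<bar> \<le> 0"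
    by (rule field_le_epsilon) simp
  then show ?thesis by simp
qed

end

section \<open>The Laplacian\<close>

text \<open>On \<open>vertex 0\<close> the quantity below is a weak form of the normal derivative: tested against
  \<open>hat 0\<close> it equals the limit in \<open>has_normal_derivative\<close>.\<close>

definition (in gasket_space) defect :: "(point \<Rightarrow> real) \<Rightarrow> (point \<Rightarrow> real) \<Rightarrow> (point \<Rightarrow> real) \<Rightarrow> real" where
  "defect u f v = energy u v + gint (\<lambda>x. f x * v x)"

definition test_functions :: "(point \<Rightarrow> real) set" where
  "test_functions = {v \<in> energy_domain. \<forall>i\<in>{0,1,2}. v (vertex i) = 0}"

text \<open>For distinct \<open>i\<close> and \<open>k\<close>, the tent at the junction
  \<open>contraction i (vertex k)\<close>: harmonic on each 1-cell, 1 at that point and 0 at the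
  other vertices of level 1. Testing with it compares the normal derivatives from the two
  cells.\<close>

definition junction :: "nat \<Rightarrow> nat \<Rightarrow> point \<Rightarrow> real" where
  "junction i k = glue (\<lambda>l. if l = i then hat k else if l = k then hat i else (\<lambda>x. 0))"

lemma glue_vertex: "matching v \<Longrightarrow> i \<in> {0,1,2} \<Longrightarrow> glue v (vertex i) = v i (vertex i)"
  using glue_contraction[of v i "vertex i"] by simp

lemma glue_test_function:
  assumes "matching v" "\<And>i. i \<in> {0,1,2} \<Longrightarrow> v i \<in> energy_domain"
    "\<And>i. i \<in> {0,1,2} \<Longrightarrow> v i (vertex i) = 0"
  shows "glue v \<in> test_functions"
  unfolding test_functions_def
  by (intro CollectI conjI ballI glue_energy_domain assms(1,2)) (simp_all only: glue_vertex assms)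

lemma junction_matching:
  assumes "i \<in> {0,1,2}" "k \<in> {0,1,2}" "i \<noteq> k"
  shows "matching (\<lambda>l. if l = i then hat k else if l = k then hat i else (\<lambda>x. 0))"
  unfolding matching_def
proof (intro ballI)
  fix a b :: nat assume a: "a \<in> {0,1,2}" and b: "b \<in> {0,1,2}"
  show "(if a = i then hat k else if a = k then hat i else (\<lambda>x. 0)) (vertex b) =
      (if b = i then hat k else if b = k then hat i else (\<lambda>x. 0)) (vertex a)"
    using assms(3)
    by (cases "a = i"; cases "a = k"; cases "b = i"; cases "b = k")
      (simp_all add: hat_vertex[OF a] hat_vertex[OF b] hat_vertex[OF assms(1)] hat_vertex[OF assms(2)]
        del: hat_vertex)
qed

lemma junction_test_function:
  assumes "i \<in> {0,1,2}" "k \<in> {0,1,2}" "i \<noteq> k"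
  shows "junction i k \<in> test_functions"
  unfolding junction_def
proof (rule glue_test_function[OF junction_matching[OF assms]])
  fix l :: nat assume l: "l \<in> {0,1,2}"
  show "(if l = i then hat k else if l = k then hat i else (\<lambda>x. 0)) (vertex l) = 0"
    using assms(3) by (simp add: hat_vertex[OF assms(1)] hat_vertex[OF assms(2)] del: hat_vertex)
qed (simp add: hat_energy_domain energy_domain_const)

lemma test_function_energy_domain: "v \<in> test_functions \<Longrightarrow> v \<in> energy_domain"
  by (simp add: test_functions_def)

lemma reflection_test_function:
  assumes "v \<in> test_functions"
  shows "(\<lambda>x. v (reflection r x)) \<in> test_functions"
proof -
  have "v (reflection r (vertex i)) = 0" if i: "i \<in> {0,1,2}" for i
  proof -
    have "(2 * r + 2 * i) mod 3 \<in> {0,1,2}" by auto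
    moreover have "\<forall>i\<in>{0,1,2}. v (vertex i) = 0"
      using assms unfolding test_functions_def mem_Collect_eq by (rule conjunct2)
    ultimately show ?thesis unfolding reflection_vertex[OF i] by (rule bspec[rotated])
  qed
  then show ?thesis
    using assms by (simp add: test_functions_def energy_domain_reflection)
qed

text \<open>Gluing this family transplants \<open>v\<close> into cell \<open>i\<close> and extends
  it by zero.\<close>

definition zero_at_ends :: "nat \<Rightarrow> (point \<Rightarrow> real) \<Rightarrow> nat \<Rightarrow> point \<Rightarrow> real" where
  "zero_at_ends i v k = (if k = i then v else (\<lambda>x. 0))"

lemma zero_extension:
  assumes "v \<in> test_functions"
  shows "matching (zero_at_ends i v)" "glue (zero_at_ends i v) \<in> test_functions"
proof -
  have z: "zero_at_ends i v k (vertex l) = 0" if "l \<in> {0,1,2}" for k l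
    using assms that by (elim idx_cases) (simp_all add: zero_at_ends_def test_functions_def)
  show m: "matching (zero_at_ends i v)"
    unfolding matching_def by (intro ballI) (simp only: z)
  show "glue (zero_at_ends i v) \<in> test_functions"
    by (rule glue_test_function[OF m _ z])
      (use assms in \<open>simp_all add: zero_at_ends_def energy_domain_const test_function_energy_domain\<close>)
qed

context gasket_space
begin

section \<open>The weak boundary term under sums, cells and reflections\<close>

lemma has_laplacian_iff:
  "has_laplacian \<mu> u f \<longleftrightarrow>
    u \<in> energy_domain \<and> continuous_on gasket f \<and> (\<forall>v\<in>test_functions. defect u f v = 0)"
  unfolding has_laplacian_def V_0 test_functions_def defect_def gint_def[symmetric]
  by (simp add: eq_neg_iff_add_eq_0) blast

lemma defect_cong:
  assumes "\<And>x. x \<in> gasket \<Longrightarrow> u x = u' x" "\<And>x. x \<in> gasket \<Longrightarrow> f x = f' x"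
    "\<And>x. x \<in> gasket \<Longrightarrow> v x = v' x"
  shows "defect u f v = defect u' f' v'"
  unfolding defect_def
  by (intro arg_cong2[where f = "(+)"] energy_cong gint_cong) (simp_all add: assms)

lemma defect_zero: "defect u f (\<lambda>x. 0) = 0"
  unfolding defect_def energy_commute[of u] by (simp add: energy_const gint_const)

lemma defect_add:
  assumes "u \<in> energy_domain" "u' \<in> energy_domain" "v \<in> energy_domain"
    "continuous_on gasket f" "continuous_on gasket f'"
  shows "defect (\<lambda>x. u x + u' x) (\<lambda>x. f x + f' x) v = defect u f v + defect u' f' v"
proof -
  have "continuous_on gasket (\<lambda>x. f x * v x)" "continuous_on gasket (\<lambda>x. f' x * v x)"
    by (intro continuous_intros assms energy_domain_continuous)+
  then show ?thesis
    unfolding defect_def by (simp add: energy_add assms(1-3) distrib_right gint_add)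
qed

lemma defect_cmult:
  "u \<in> energy_domain \<Longrightarrow> v \<in> energy_domain \<Longrightarrow> defect (\<lambda>x. c * u x) (\<lambda>x. c * f x) v = c * defect u f v"
  unfolding defect_def by (simp add: energy_cmult distrib_left mult.assoc gint_cmult)

lemma defect_add_right:
  assumes "u \<in> energy_domain" "v \<in> energy_domain" "v' \<in> energy_domain" "continuous_on gasket f"
  shows "defect u f (\<lambda>x. v x + c * v' x) = defect u f v + c * defect u f v'"
proof -
  have c: "continuous_on gasket (\<lambda>x. f x * v x)" "continuous_on gasket (\<lambda>x. c * (f x * v' x))"
    by (intro continuous_intros assms energy_domain_continuous)+
  have "energy u (\<lambda>x. v x + c * v' x) = energy u v + c * energy u v'"
    unfolding energy_commute[of u] by (simp add: energy_add energy_cmult energy_domain_cmult assms)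
  moreover have "gint (\<lambda>x. f x * (v x + c * v' x)) = gint (\<lambda>x. f x * v x) + c * gint (\<lambda>x. f x * v' x)"
    using gint_add[OF c] by (simp add: gint_cmult distrib_left mult.left_commute)
  ultimately show ?thesis unfolding defect_def by (simp add: distrib_left)
qed

text \<open>Passing to cells brings the factor 5/3 into the energy and 1/3 into the integral, which
  is 5/3 times 1/5. This is the origin of the factor 1/5 in the Laplacian on a cell.\<close>

lemma defect_split:
  assumes "u \<in> energy_domain" "v \<in> energy_domain" "continuous_on gasket f"
  shows "defect u f v = 5/3 * (\<Sum>i\<in>{0,1,2}. defect (\<lambda>x. u (contraction i x))
    (\<lambda>x. 1/5 * f (contraction i x)) (\<lambda>x. v (contraction i x)))"
proof -
  have "continuous_on gasket (\<lambda>x. f x * v x)"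
    by (intro continuous_intros assms energy_domain_continuous)
  from gint_contraction[OF this] show ?thesis
    unfolding defect_def energy_split[OF assms(1,2)] sum_idx mult.assoc gint_cmult
    by (simp add: algebra_simps)
qed

lemma defect_glue:
  assumes "u \<in> energy_domain" "continuous_on gasket f" "matching v"
    "\<And>i. i \<in> {0,1,2} \<Longrightarrow> v i \<in> energy_domain"
  shows "defect u f (glue v) = 5/3 * (\<Sum>i\<in>{0,1,2}. defect (\<lambda>x. u (contraction i x))
    (\<lambda>x. 1/5 * f (contraction i x)) (v i))"
proof -
  have "defect u f (glue v) = 5/3 * (\<Sum>i\<in>{0,1,2}. defect (\<lambda>x. u (contraction i x))
      (\<lambda>x. 1/5 * f (contraction i x)) (\<lambda>x. glue v (contraction i x)))"
    by (rule defect_split[OF assms(1) glue_energy_domain[OF assms(3,4)] assms(2)])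
  also have "(\<Sum>i\<in>{0,1,2}. defect (\<lambda>x. u (contraction i x))
      (\<lambda>x. 1/5 * f (contraction i x)) (\<lambda>x. glue v (contraction i x))) =
      (\<Sum>i\<in>{0,1,2}. defect (\<lambda>x. u (contraction i x)) (\<lambda>x. 1/5 * f (contraction i x)) (v i))"
    by (rule sum.cong[OF refl]) (rule defect_cong[OF refl refl glue_contraction[OF assms(3)]])
  finally show ?thesis .
qed

lemma defect_reflection:
  assumes "v \<in> energy_domain" "continuous_on gasket f"
  shows "defect (\<lambda>x. u (reflection r x)) (\<lambda>x. f (reflection r x)) (\<lambda>x. v (reflection r x)) = defect u f v"
proof -
  have "continuous_on gasket (\<lambda>x. f x * v x)"
    by (intro continuous_intros assms energy_domain_continuous)
  from gint_reflection[OF this] show ?thesis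
    unfolding defect_def energy_reflection by simp
qed

lemma defect_zero_extension:
  assumes "u \<in> energy_domain" "continuous_on gasket f" "v \<in> test_functions" "i \<in> {0,1,2}"
  shows "defect u f (glue (zero_at_ends i v)) =
    5/3 * defect (\<lambda>x. u (contraction i x)) (\<lambda>x. 1/5 * f (contraction i x)) v"
proof -
  have "zero_at_ends i v k \<in> energy_domain" for k
    using assms(3) by (simp add: zero_at_ends_def energy_domain_const test_function_energy_domain)
  from defect_glue[OF assms(1,2) zero_extension(1)[OF assms(3)] this]
  have "defect u f (glue (zero_at_ends i v)) = 5/3 * (\<Sum>k\<in>{0,1,2}. defect (\<lambda>x. u (contraction k x))
    (\<lambda>x. 1/5 * f (contraction k x)) (zero_at_ends i v k))" .
  with assms(4) show ?thesis
    by (elim idx_cases) (simp_all add: zero_at_ends_def defect_zero)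
qed

lemma has_laplacian_contraction:
  assumes "has_laplacian \<mu> u f" "i \<in> {0,1,2}"
  shows "has_laplacian \<mu> (\<lambda>x. u (contraction i x)) (\<lambda>x. 1/5 * f (contraction i x))"
proof -
  have u: "u \<in> energy_domain" and f: "continuous_on gasket f"
    and d: "\<And>v. v \<in> test_functions \<Longrightarrow> defect u f v = 0"
    using assms(1) by (auto simp: has_laplacian_iff)
  have "defect (\<lambda>x. u (contraction i x)) (\<lambda>x. 1/5 * f (contraction i x)) v = 0"
    if v: "v \<in> test_functions" for v
    using d[OF zero_extension(2)[OF v]] defect_zero_extension[OF u f v assms(2)] by simp
  then show ?thesis
    unfolding has_laplacian_iff using u f assms(2)
    by (intro conjI ballI energy_domain_contraction continuous_on_mult_left
        continuous_on_gasket_contraction)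
qed

lemma has_laplacian_reflection:
  assumes "has_laplacian \<mu> u f"
  shows "has_laplacian \<mu> (\<lambda>x. u (reflection r x)) (\<lambda>x. f (reflection r x))"
proof -
  have u: "u \<in> energy_domain" and f: "continuous_on gasket f"
    and d: "\<And>v. v \<in> test_functions \<Longrightarrow> defect u f v = 0"
    using assms(1) by (auto simp: has_laplacian_iff)
  have "defect (\<lambda>x. u (reflection r x)) (\<lambda>x. f (reflection r x)) v = 0"
    if v: "v \<in> test_functions" for v
  proof -
    let ?w = "\<lambda>x. v (reflection r x)"
    have w: "?w \<in> test_functions" using v by (rule reflection_test_function)
    have "defect (\<lambda>x. u (reflection r x)) (\<lambda>x. f (reflection r x)) (\<lambda>x. ?w (reflection r x)) = defect u f ?w"
      by (rule defect_reflection[OF test_function_energy_domain[OF w] f])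
    with d[OF w] show ?thesis by (simp add: reflection_involution)
  qed
  then show ?thesis
    unfolding has_laplacian_iff using u f
    by (intro conjI ballI energy_domain_reflection continuous_on_gasket_reflection)
qed

lemma has_laplacian_cong:
  assumes "\<And>x. x \<in> gasket \<Longrightarrow> u x = u' x" "\<And>x. x \<in> gasket \<Longrightarrow> f x = f' x" "has_laplacian \<mu> u f"
  shows "has_laplacian \<mu> u' f'"
proof -
  have "defect u' f' v = defect u f v" for v by (rule defect_cong) (simp_all add: assms)
  moreover have "continuous_on gasket f'"
    by (rule continuous_on_eq[OF _ assms(2)]) (use assms(3) in \<open>simp_all add: has_laplacian_iff\<close>)
  ultimately show ?thesis
    using assms(3) energy_domain_cong[OF assms(1)] by (simp add: has_laplacian_iff)
qed

lemma has_laplacian_add: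
  assumes "has_laplacian \<mu> u f" "has_laplacian \<mu> u' f'"
  shows "has_laplacian \<mu> (\<lambda>x. u x + u' x) (\<lambda>x. f x + f' x)"
  using assms unfolding has_laplacian_iff
  by (simp add: energy_domain_add continuous_on_add defect_add test_function_energy_domain)

lemma has_laplacian_cmult:
  assumes "has_laplacian \<mu> u f"
  shows "has_laplacian \<mu> (\<lambda>x. c * u x) (\<lambda>x. c * f x)"
  using assms unfolding has_laplacian_iff
  by (simp add: energy_domain_cmult continuous_on_mult_left defect_cmult test_function_energy_domain)

lemma has_laplacian_harmonic: "has_laplacian \<mu> (harmonic a) (\<lambda>x. 0)"
proof -
  have "defect (harmonic a) (\<lambda>x. 0) v = 0" if "v \<in> test_functions" for v
    using that unfolding defect_def energy_commute[of "harmonic a"] energy_harmonic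
    by (simp add: gint_const graph_energy_0 test_functions_def)
  then show ?thesis
    unfolding has_laplacian_iff using harmonic_energy_domain by simp
qed

text \<open>The difference of the two functions is itself a test function; testing its own equation
  with it shows that its energy is zero.\<close>

lemma dirichlet_unique:
  assumes "has_laplacian \<mu> u f" "has_laplacian \<mu> u' f'" "\<And>x. x \<in> gasket \<Longrightarrow> f x = f' x"
    "\<And>i. i \<in> {0,1,2} \<Longrightarrow> u (vertex i) = u' (vertex i)" "x \<in> gasket"
  shows "u x = u' x"
proof -
  let ?w = "\<lambda>x. u x + (-1) * u' x"
  have "has_laplacian \<mu> ?w (\<lambda>x. f x + (-1) * f' x)"
    by (intro has_laplacian_add has_laplacian_cmult assms)
  then have w: "has_laplacian \<mu> ?w (\<lambda>x. 0)"
    by (rule has_laplacian_cong[rotated 2]) (simp_all add: assms(3))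
  then have dom: "?w \<in> energy_domain" by (simp add: has_laplacian_iff)
  have test: "?w \<in> test_functions"
    unfolding test_functions_def using dom assms(4) by simp
  with w have "defect ?w (\<lambda>x. 0) ?w = 0" by (simp add: has_laplacian_iff)
  then have "energy ?w ?w = 0" by (simp add: defect_def gint_const)
  from energy_zero_imp_constant[OF dom this assms(5)] have "?w x = ?w (vertex 0)" .
  also have "\<dots> = 0" using assms(4)[of 0] by simp
  finally show ?thesis by simp
qed

lemma harmonic_unique:
  assumes "has_laplacian \<mu> u f" "\<And>x. x \<in> gasket \<Longrightarrow> f x = 0" "x \<in> gasket"
    "\<And>i. i \<in> {0,1,2} \<Longrightarrow> u (vertex i) = a i"
  shows "u x = harmonic a x"
  by (rule dirichlet_unique[OF assms(1) has_laplacian_harmonic assms(2) _ assms(3)])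
    (simp_all only: harmonic_vertex assms(4))

text \<open>The reflection of index \<open>2 * k\<close> takes corner \<open>k\<close> to corner 0,
  since \<open>6 * k\<close> is 0 modulo 3, and corner 0 to \<open>k\<close>, since
  \<open>4 * k\<close> is congruent to \<open>k\<close>. Both sides are harmonic with the same
  corner values.\<close>

lemma hat_reflection:
  assumes "x \<in> gasket" "k \<in> {0,1,2}"
  shows "hat 0 (reflection (2 * k) x) = hat k x"
proof -
  have l: "has_laplacian \<mu> (\<lambda>x. hat 0 (reflection (2 * k) x)) (\<lambda>x. 0)"
    using has_laplacian_reflection[OF has_laplacian_harmonic] unfolding hat_def .
  show ?thesis
    unfolding hat_def[of k]
  proof (rule harmonic_unique[OF l _ assms(1)])
    fix i :: nat assume i: "i \<in> {0,1,2}"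
    show "hat 0 (reflection (2 * k) (vertex i)) = of_bool (i = k)"
      unfolding reflection_vertex[OF i] using i assms(2)
      by (elim idx_cases) simp_all
  qed simp
qed

lemma hat_sum:
  assumes "x \<in> gasket"
  shows "hat 0 x + hat 1 x + hat 2 x = 1"
proof -
  have l: "has_laplacian \<mu> (\<lambda>x. hat 0 x + hat 1 x + hat 2 x) (\<lambda>x. 0 + 0 + 0)"
    unfolding hat_def by (intro has_laplacian_add has_laplacian_harmonic)
  have "hat 0 x + hat 1 x + hat 2 x = harmonic (\<lambda>i. 1) x"
    by (rule harmonic_unique[OF l _ assms]) (simp, elim idx_cases, simp_all)
  also have "has_laplacian \<mu> (\<lambda>x. 1) (\<lambda>x. 0)"
    unfolding has_laplacian_iff defect_def
    by (simp add: energy_domain_const energy_const gint_const)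
  then have "harmonic (\<lambda>i. 1) x = 1"
    using harmonic_unique[of "\<lambda>x. 1" "\<lambda>x. 0" x "\<lambda>i. 1"] assms by simp
  finally show ?thesis .
qed

text \<open>The three hats sum to 1 and are reflections of one another.\<close>

lemma gint_hat:
  assumes "k \<in> {0,1,2}"
  shows "gint (hat k) = 1/3"
proof -
  have eq: "gint (hat k) = gint (hat 0)" if "k \<in> {0,1,2}" for k
  proof -
    have "gint (hat k) = gint (\<lambda>x. hat 0 (reflection (2 * k) x))"
      by (rule gint_cong) (simp only: hat_reflection that)
    then show ?thesis by (simp only: gint_reflection hat_continuous)
  qed
  have "1 = gint (\<lambda>x. hat 0 x + hat 1 x + hat 2 x)"
    using gint_cong[of "\<lambda>x. hat 0 x + hat 1 x + hat 2 x" "\<lambda>x. 1"] hat_sum by (simp add: gint_const)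
  also have "\<dots> = gint (hat 0) + gint (hat 1) + gint (hat 2)"
    by (simp only: gint_add hat_continuous continuous_on_add)
  finally show ?thesis using eq[of 1] eq[of 2] eq[OF assms] by simp
qed

lemma defect_hat:
  "defect u f (hat 0) =
    2 * u (vertex 0) - u (vertex 1) - u (vertex 2) + gint (\<lambda>x. f x * hat 0 x)"
  unfolding defect_def hat_def energy_harmonic by (simp add: graph_energy_0)

text \<open>The function \<open>hat 0\<close> and its rescaled copy on the cell at \<open>vertex 0\<close> differ by a test function.\<close>

lemma defect_hat_contraction:
  assumes "has_laplacian \<mu> u f"
  shows "defect u f (hat 0) =
    5/3 * defect (\<lambda>x. u (contraction 0 x)) (\<lambda>x. 1/5 * f (contraction 0 x)) (hat 0)"
proof -
  have u: "u \<in> energy_domain" and f: "continuous_on gasket f"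
    and d: "\<And>v. v \<in> test_functions \<Longrightarrow> defect u f v = 0"
    using assms(1) by (auto simp: has_laplacian_iff)
  let ?g = "zero_at_ends 0 (hat 0)"
  have m: "matching ?g"
    unfolding matching_def
  proof (intro ballI)
    fix a b :: nat assume a: "a \<in> {0,1,2}" and b: "b \<in> {0,1,2}"
    show "?g a (vertex b) = ?g b (vertex a)"
      by (cases "a = 0"; cases "b = 0")
        (simp_all add: zero_at_ends_def hat_vertex[OF a] hat_vertex[OF b] del: hat_vertex)
  qed
  have dom: "?g i \<in> energy_domain" for i
    by (simp add: zero_at_ends_def hat_energy_domain energy_domain_const)
  have gl: "glue ?g \<in> energy_domain" by (intro glue_energy_domain m dom)
  have "(\<lambda>x. hat 0 x + (-1) * glue ?g x) \<in> energy_domain"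
    by (intro energy_domain_add energy_domain_cmult hat_energy_domain gl)
  moreover have "glue ?g (vertex i) = hat 0 (vertex i)" if "i \<in> {0,1,2}" for i
    using that by (simp add: glue_vertex m zero_at_ends_def)
  ultimately have "(\<lambda>x. hat 0 x + (-1) * glue ?g x) \<in> test_functions"
    unfolding test_functions_def by simp
  from d[OF this] have "defect u f (hat 0) = defect u f (glue ?g)"
    unfolding defect_add_right[OF u hat_energy_domain gl f] by simp
  also have "\<dots> = 5/3 * defect (\<lambda>x. u (contraction 0 x)) (\<lambda>x. 1/5 * f (contraction 0 x)) (hat 0)"
    unfolding defect_glue[OF u f m dom] by (simp add: zero_at_ends_def defect_zero)
  finally show ?thesis .
qed

lemma has_laplacian_contraction_power:
  assumes "has_laplacian \<mu> u f"
  shows "has_laplacian \<mu> (\<lambda>x. u ((contraction 0 ^^ m) x)) (\<lambda>x. (1/5) ^ m * f ((contraction 0 ^^ m) x))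
    \<and> defect u f (hat 0) = (5/3) ^ m * defect (\<lambda>x. u ((contraction 0 ^^ m) x))
        (\<lambda>x. (1/5) ^ m * f ((contraction 0 ^^ m) x)) (hat 0)"
proof (induction m)
  case (Suc m)
  let ?u = "\<lambda>x. u ((contraction 0 ^^ m) x)" and ?f = "\<lambda>x. (1/5) ^ m * f ((contraction 0 ^^ m) x)"
  have l: "has_laplacian \<mu> ?u ?f" and d: "defect u f (hat 0) = (5/3) ^ m * defect ?u ?f (hat 0)"
    using Suc by simp_all
  have eq: "(\<lambda>x. 1/5 * ?f (contraction 0 x)) = (\<lambda>x. (1/5) ^ Suc m * f ((contraction 0 ^^ Suc m) x))"
    "(\<lambda>x. ?u (contraction 0 x)) = (\<lambda>x. u ((contraction 0 ^^ Suc m) x))"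
    unfolding contraction_power_Suc(2) by simp_all
  show ?case
    using has_laplacian_contraction[OF l, of 0] d defect_hat_contraction[OF l] unfolding eq by simp
qed (use assms in simp)

text \<open>Rescaling to the cell of level \<open>m\<close> preserves the pairing with
  \<open>hat 0\<close>. Its energy part is the difference quotient, and its integral part carries
  the factor \<open>(5/3)^m (1/5)^m = (1/3)^m\<close>, which tends to zero.\<close>

lemma has_normal_derivative_defect:
  assumes "has_laplacian \<mu> u f"
  shows "has_normal_derivative u 0 (defect u f (hat 0))"
proof -
  have f: "continuous_on gasket f" using assms(1) by (auto simp: has_laplacian_iff)
  let ?c = "\<lambda>m. contraction 0 ^^ m"
  have cont: "continuous_on gasket (\<lambda>x. f (?c m x) * hat 0 x)" for m
  proof (intro continuous_on_mult hat_continuous)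
    show "continuous_on gasket (\<lambda>x. f (?c m x))"
    proof (induction m)
      case (Suc m)
      from continuous_on_gasket_contraction[OF _ Suc, of 0] show ?case
        unfolding contraction_power_Suc(2) by simp
    qed (use f in simp)
  qed
  have "bounded (f ` gasket)" "bounded (hat 0 ` gasket)"
    by (intro compact_imp_bounded compact_continuous_image f hat_continuous compact_gasket)+
  then obtain A B where A: "\<And>x. x \<in> gasket \<Longrightarrow> \<bar>f x\<bar> \<le> A" and B: "\<And>x. x \<in> gasket \<Longrightarrow> \<bar>hat 0 x\<bar> \<le> B"
    unfolding bounded_iff by auto
  have bound: "\<bar>gint (\<lambda>x. f (?c m x) * hat 0 x)\<bar> \<le> A * B" for m
  proof (rule gint_abs_le[OF cont])
    fix x assume x: "x \<in> gasket"
    have "0 \<le> A" using A[OF vertex_in_gasket[of 0]] by linarith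
    then show "\<bar>f (?c m x) * hat 0 x\<bar> \<le> A * B"
      unfolding abs_mult using A[OF contraction_power_gasket[of 0 x m]] B[OF x] x
      by (intro mult_mono) simp_all
  qed
  have eq: "(5/3) ^ m * (2 * u (vertex 0) - u (?c m (vertex 1)) - u (?c m (vertex 2)))
      = defect u f (hat 0) - (1/3) ^ m * gint (\<lambda>x. f (?c m x) * hat 0 x)" for m
  proof -
    have "defect u f (hat 0) = (5/3) ^ m * (2 * u (vertex 0) - u (?c m (vertex 1)) - u (?c m (vertex 2))
      + gint (\<lambda>x. (1/5) ^ m * f (?c m x) * hat 0 x))"
      using has_laplacian_contraction_power[OF assms, of m] by (simp add: defect_hat)
    also have "gint (\<lambda>x. (1/5) ^ m * f (?c m x) * hat 0 x) = (1/5) ^ m * gint (\<lambda>x. f (?c m x) * hat 0 x)"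
      unfolding mult.assoc gint_cmult ..
    finally show ?thesis
      by (simp add: distrib_left flip: power_mult_distrib mult.assoc)
  qed
  have "(\<lambda>m. (1/3) ^ m * gint (\<lambda>x. f (?c m x) * hat 0 x)) \<longlonglongrightarrow> 0"
  proof (rule Lim_null_comparison)
    show "\<forall>\<^sub>F m in sequentially. norm ((1/3) ^ m * gint (\<lambda>x. f (?c m x) * hat 0 x)) \<le> (1/3) ^ m * (A * B)"
      by (rule always_eventually) (simp add: abs_mult mult_left_mono[OF bound])
    have "(\<lambda>m. (1/3::real) ^ m * (A * B)) \<longlonglongrightarrow> 0 * (A * B)"
      by (intro tendsto_mult tendsto_const LIMSEQ_power_zero) simp
    then show "(\<lambda>m. (1/3) ^ m * (A * B)) \<longlonglongrightarrow> 0" by simp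
  qed
  then have "(\<lambda>m. defect u f (hat 0) - (1/3) ^ m * gint (\<lambda>x. f (?c m x) * hat 0 x)) \<longlonglongrightarrow>
      defect u f (hat 0) - 0"
    by (intro tendsto_diff tendsto_const)
  then show ?thesis
    unfolding has_normal_derivative_def eq[symmetric] by (simp add: numeral_eq_Suc)
qed

text \<open>Fundamental lemma of the calculus of variations. Transplanting test functions into a
  small cell preserves orthogonality, and there \<open>f\<close> is almost constant, so a bump with
  nonzero integral forces its values towards zero.\<close>

lemma test_orthogonal_zero:
  assumes "continuous_on gasket f" "\<And>v. v \<in> test_functions \<Longrightarrow> gint (\<lambda>x. f x * v x) = 0" "x \<in> gasket"
  shows "f x = 0"
proof -
  have orth: "continuous_on gasket (\<lambda>x. g (word_map w x)) \<and> gint (\<lambda>x. g (word_map w x) * v x) = 0"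
    if "w \<in> words m" "continuous_on gasket g" "\<And>v. v \<in> test_functions \<Longrightarrow> gint (\<lambda>x. g x * v x) = 0"
      "v \<in> test_functions" for w g v m
    using that
  proof (induction m arbitrary: w g v)
    case 0
    then show ?case by (simp add: words_0)
  next
    case (Suc m)
    from Suc.prems(1) obtain i w' where i: "i \<in> {0,1,2}" "w' \<in> words m" and w: "w = i # w'"
      by (auto simp: words_Suc)
    let ?g = "\<lambda>x. g (contraction i x)"
    have c: "continuous_on gasket ?g" by (intro continuous_on_gasket_contraction i Suc.prems)
    have "gint (\<lambda>x. ?g x * z x) = 0" if z: "z \<in> test_functions" for z
    proof -
      have "continuous_on gasket (\<lambda>x. g x * glue (zero_at_ends i z) x)"
        by (intro continuous_on_mult Suc.prems energy_domain_continuous test_function_energy_domain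
            zero_extension(2) z)
      note gint_contraction[OF this]
      moreover have "gint (\<lambda>x. g (contraction k x) * glue (zero_at_ends i z) (contraction k x))
          = gint (\<lambda>x. g (contraction k x) * zero_at_ends i z k x)" if "k \<in> {0,1,2}" for k
        by (rule gint_cong) (simp only: glue_contraction zero_extension(1) z that)
      ultimately have "gint (\<lambda>x. g x * glue (zero_at_ends i z) x)
          = 1/3 * (\<Sum>k\<in>{0,1,2}. gint (\<lambda>x. g (contraction k x) * zero_at_ends i z k x))" by simp
      also have "\<dots> = 1/3 * gint (\<lambda>x. ?g x * z x)"
        using i(1) by (elim idx_cases) (simp_all add: zero_at_ends_def gint_const)
      finally show ?thesis using Suc.prems(3)[OF zero_extension(2)[OF z]] by simp
    qed
    from Suc.IH[OF i(2) c this Suc.prems(4)] show ?case by (simp add: w)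
  qed
  let ?b = "junction 0 1"
  have b: "?b \<in> test_functions" by (rule junction_test_function) simp_all
  have cb: "continuous_on gasket ?b"
    using b by (intro energy_domain_continuous test_function_energy_domain)
  let ?h = "\<lambda>l::nat. if l = 0 then hat 1 else if l = 1 then hat 0 else (\<lambda>x. 0)"
  have "gint ?b = 1/3 * (\<Sum>i\<in>{0,1,2}. gint (\<lambda>x. ?b (contraction i x)))"
    by (rule gint_contraction[OF cb])
  also have "\<dots> = 1/3 * (\<Sum>i\<in>{0,1,2}. gint (?h i))"
    unfolding junction_def
    by (intro arg_cong[where f = "(*) _"] sum.cong refl gint_cong glue_contraction junction_matching) simp_all
  \<comment> \<open>Two of the three cells carry a hat of integral 1/3, each weighted by
    1/3.\<close>
  finally have gb: "gint ?b = 2/9" by (simp add: gint_hat gint_const)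
  have "bounded (?b ` gasket)"
    by (intro compact_imp_bounded compact_continuous_image cb compact_gasket)
  then obtain B where B: "\<And>x. x \<in> gasket \<Longrightarrow> \<bar>?b x\<bar> \<le> B"
    unfolding bounded_iff by auto
  have B0: "B \<ge> 0" using B[OF vertex_in_gasket[of 0]] by linarith
  have small: "\<bar>f x\<bar> * (2/9) \<le> e * B" if e: "e > 0" for e
  proof -
    obtain m where m: "\<And>w x y. w \<in> words m \<Longrightarrow> x \<in> gasket \<Longrightarrow> y \<in> gasket \<Longrightarrow>
        \<bar>f (word_map w x) - f (word_map w y)\<bar> < e"
      by (rule small_cells[OF assms(1) e]) (rule that)
    obtain w y where w: "w \<in> words m" and y: "y \<in> gasket" and x: "x = word_map w y"
      using gasket_cell[OF assms(3), of m] by (elim bexE) (rule that)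
    let ?f = "\<lambda>z. f (word_map w z)"
    have cf: "continuous_on gasket ?f" and zero: "gint (\<lambda>z. ?f z * ?b z) = 0"
      using orth[OF w assms(1,2) b] by simp_all
    have "\<bar>gint (\<lambda>z. (f x - ?f z) * ?b z)\<bar> \<le> e * B"
    proof (rule gint_abs_le)
      show "continuous_on gasket (\<lambda>z. (f x - ?f z) * ?b z)"
        by (intro continuous_intros cf cb)
      show "\<bar>(f x - ?f z) * ?b z\<bar> \<le> e * B" if z: "z \<in> gasket" for z
        unfolding abs_mult x using m[OF w y z] B[OF z] e by (intro mult_mono) simp_all
    qed
    moreover have "gint (\<lambda>z. (f x - ?f z) * ?b z) = f x * (2/9)"
    proof -
      have "gint (\<lambda>z. f x * ?b z - ?f z * ?b z) = gint (\<lambda>z. f x * ?b z) - gint (\<lambda>z. ?f z * ?b z)"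
        by (intro gint_diff continuous_intros cf cb)
      then show ?thesis unfolding left_diff_distrib gint_cmult gb zero by simp
    qed
    ultimately show ?thesis by (simp add: abs_mult)
  qed
  have "\<bar>f x\<bar> * (2/9) \<le> 0 + e" if "e > 0" for e
  proof -
    have "e / (B + 1) > 0" using that B0 by simp
    from small[OF this] have "\<bar>f x\<bar> * (2/9) \<le> e / (B + 1) * B" .
    also have "\<dots> \<le> e" using that B0 by (simp add: field_simps)
    finally show ?thesis by simp
  qed
  then have "\<bar>f x\<bar> * (2/9) \<le> 0" by (rule field_le_epsilon)
  then show ?thesis by simp
qed

text \<open>This identifies, on the gasket, the different intermediate functions hidden behind the
  existentials of \<open>has_laplacian_power\<close>.\<close>

lemma laplacian_unique:
  assumes "has_laplacian \<mu> u f" "has_laplacian \<mu> u' f'" "\<And>x. x \<in> gasket \<Longrightarrow> u x = u' x" "x \<in> gasket"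
  shows "f x = f' x"
proof -
  let ?g = "\<lambda>x. f x + (-1) * f' x"
  have "has_laplacian \<mu> (\<lambda>x. u x + (-1) * u' x) ?g"
    by (intro has_laplacian_add has_laplacian_cmult assms)
  then have l: "has_laplacian \<mu> (\<lambda>x. 0) ?g"
    by (rule has_laplacian_cong[rotated 2]) (simp_all add: assms(3))
  have orth: "gint (\<lambda>x. ?g x * v x) = 0" if "v \<in> test_functions" for v
    using l that by (simp add: has_laplacian_iff defect_def energy_const)
  have "continuous_on gasket ?g" using l by (simp add: has_laplacian_iff)
  from test_orthogonal_zero[OF this orth assms(4)] show ?thesis by simp
qed

end

section \<open>Jets at the top vertex\<close>

lemma reflection_contraction_power:
  "reflection 0 ((contraction 0 ^^ m) x) = (contraction 0 ^^ m) (reflection 0 x)"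
proof (induction m)
  case (Suc m)
  have "reflection 0 (contraction 0 y) = contraction 0 (reflection 0 y)" for y
    using reflection_contraction[of 0 0 y] by simp
  with Suc show ?case by simp
qed simp

lemma reflection_0_vertex [simp]:
  "reflection 0 (vertex 0) = vertex 0" "reflection 0 (vertex (Suc 0)) = vertex 2"
  "reflection 0 (vertex 2) = vertex (Suc 0)"
  using reflection_vertex[of 0 0] reflection_vertex[of 1 0] reflection_vertex[of 2 0]
  by (simp_all add: numeral_2_eq_2)

section \<open>Rules for normal and tangential derivatives at \<open>vertex 0\<close>\<close>

lemma normal_derivative_iff:
  "has_normal_derivative u 0 d \<longleftrightarrow>
     (\<lambda>m. (5/3) ^ m * (2 * u (vertex 0) - u ((contraction 0 ^^ m) (vertex 1))
       - u ((contraction 0 ^^ m) (vertex 2)))) \<longlonglongrightarrow> d"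
  by (simp add: has_normal_derivative_def numeral_eq_Suc)

lemma tangential_derivative_iff:
  "has_tangential_derivative u 0 d \<longleftrightarrow>
     (\<lambda>m. 5 ^ m * (u ((contraction 0 ^^ m) (vertex 1)) - u ((contraction 0 ^^ m) (vertex 2)))) \<longlonglongrightarrow> d"
  by (simp add: has_tangential_derivative_def numeral_eq_Suc)

lemma normal_derivative_cong:
  assumes "\<And>x. x \<in> gasket \<Longrightarrow> u x = v x"
  shows "has_normal_derivative u 0 d \<longleftrightarrow> has_normal_derivative v 0 d"
  unfolding normal_derivative_iff by (simp add: assms contraction_power_gasket)

lemma tangential_derivative_cong:
  assumes "\<And>x. x \<in> gasket \<Longrightarrow> u x = v x"
  shows "has_tangential_derivative u 0 d \<longleftrightarrow> has_tangential_derivative v 0 d"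
  unfolding tangential_derivative_iff by (simp add: assms contraction_power_gasket)

lemma normal_derivative_unique:
  "has_normal_derivative u 0 d \<Longrightarrow> has_normal_derivative u 0 d' \<Longrightarrow> d = d'"
  unfolding normal_derivative_iff by (rule LIMSEQ_unique)

lemma tangential_derivative_unique:
  "has_tangential_derivative u 0 d \<Longrightarrow> has_tangential_derivative u 0 d' \<Longrightarrow> d = d'"
  unfolding tangential_derivative_iff by (rule LIMSEQ_unique)

lemma normal_derivative_cmult:
  assumes "has_normal_derivative u 0 d"
  shows "has_normal_derivative (\<lambda>x. c * u x) 0 (c * d)"
  using tendsto_mult_left[OF assms[unfolded normal_derivative_iff], of c]
  unfolding normal_derivative_iff by (simp add: algebra_simps)

lemma tangential_derivative_cmult:
  assumes "has_tangential_derivative u 0 d"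
  shows "has_tangential_derivative (\<lambda>x. c * u x) 0 (c * d)"
  using tendsto_mult_left[OF assms[unfolded tangential_derivative_iff], of c]
  unfolding tangential_derivative_iff by (simp add: algebra_simps)

lemma normal_derivative_sum:
  assumes "\<And>i. i \<in> I \<Longrightarrow> has_normal_derivative (u i) 0 (d i)"
  shows "has_normal_derivative (\<lambda>x. \<Sum>i\<in>I. u i x) 0 (\<Sum>i\<in>I. d i)"
proof -
  have "(5/3) ^ m * (2 * (\<Sum>i\<in>I. u i x) - (\<Sum>i\<in>I. u i y) - (\<Sum>i\<in>I. u i z)) =
      (\<Sum>i\<in>I. (5/3) ^ m * (2 * u i x - u i y - u i z))" for m x y z
    by (simp add: sum_distrib_left sum_subtractf right_diff_distrib)
  then show ?thesis
    using tendsto_sum[OF assms[unfolded normal_derivative_iff]] unfolding normal_derivative_iff by simp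
qed

lemma tangential_derivative_sum:
  assumes "\<And>i. i \<in> I \<Longrightarrow> has_tangential_derivative (u i) 0 (d i)"
  shows "has_tangential_derivative (\<lambda>x. \<Sum>i\<in>I. u i x) 0 (\<Sum>i\<in>I. d i)"
proof -
  have "5 ^ m * ((\<Sum>i\<in>I. u i x) - (\<Sum>i\<in>I. u i y)) = (\<Sum>i\<in>I. 5 ^ m * (u i x - u i y))" for m x y
    by (simp add: sum_distrib_left sum_subtractf right_diff_distrib)
  then show ?thesis
    using tendsto_sum[OF assms[unfolded tangential_derivative_iff]] unfolding tangential_derivative_iff by simp
qed

lemma normal_derivative_contraction:
  assumes "has_normal_derivative u 0 d"
  shows "has_normal_derivative (\<lambda>x. u (contraction 0 x)) 0 (3/5 * d)"
  using tendsto_mult_left[OF LIMSEQ_Suc[OF assms[unfolded normal_derivative_iff]], of "3/5"]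
  unfolding normal_derivative_iff by simp

lemma tangential_derivative_contraction:
  assumes "has_tangential_derivative u 0 d"
  shows "has_tangential_derivative (\<lambda>x. u (contraction 0 x)) 0 (1/5 * d)"
  using tendsto_mult_left[OF LIMSEQ_Suc[OF assms[unfolded tangential_derivative_iff]], of "1/5"]
  unfolding tangential_derivative_iff by simp

lemma normal_derivative_reflection:
  assumes "has_normal_derivative u 0 d"
  shows "has_normal_derivative (\<lambda>x. u (reflection 0 x)) 0 d"
  using assms unfolding normal_derivative_iff
  by (simp add: reflection_contraction_power algebra_simps)

lemma tangential_derivative_reflection:
  assumes "has_tangential_derivative u 0 d"
  shows "has_tangential_derivative (\<lambda>x. u (reflection 0 x)) 0 (- d)"
  using tendsto_minus[OF assms[unfolded tangential_derivative_iff]]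
  unfolding tangential_derivative_iff
  by (simp add: reflection_contraction_power algebra_simps)

text \<open>One contraction divides the difference of the two lower corner values by exactly 5, so
  the scaled sequence is constant.\<close>

lemma harmonic_tangential_derivative: "has_tangential_derivative (harmonic a) 0 (a 1 - a 2)"
proof -
  have "5 ^ m * (harmonic a ((contraction 0 ^^ m) (vertex 1)) - harmonic a ((contraction 0 ^^ m) (vertex 2)))
      = a 1 - a 2" for m
  proof (induction m arbitrary: a)
    case 0
    show ?case by simp
  next
    case (Suc m)
    have "harmonic a ((contraction 0 ^^ Suc m) (vertex k)) =
        harmonic (harm_ext 0 a) ((contraction 0 ^^ m) (vertex k))" for k
      unfolding contraction_power_Suc(1)
      by (intro harmonic_contraction contraction_power_gasket vertex_in_gasket) simp_all
    moreover have "harm_ext 0 a 1 - harm_ext 0 a 2 = (a 1 - a 2) / 5"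
      by (simp add: harm_ext_def field_simps)
    ultimately show ?case using Suc[of "harm_ext 0 a"] by simp
  qed
  then show ?thesis unfolding tangential_derivative_iff by simp
qed

context gasket_space
begin

lemma has_laplacian_zero: "has_laplacian \<mu> (\<lambda>x. 0) (\<lambda>x. 0)"
  using has_laplacian_cmult[OF has_laplacian_harmonic, of 0] by simp

lemma has_laplacian_sum:
  assumes "finite I" "\<And>i. i \<in> I \<Longrightarrow> has_laplacian \<mu> (u i) (f i)"
  shows "has_laplacian \<mu> (\<lambda>x. \<Sum>i\<in>I. u i x) (\<lambda>x. \<Sum>i\<in>I. f i x)"
  using assms by (induction I rule: finite_induct) (simp_all add: has_laplacian_zero has_laplacian_add)

lemma normal_derivative_value:
  assumes "has_laplacian \<mu> u f" "has_normal_derivative u 0 d"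
  shows "2 * u (vertex 0) - u (vertex 1) - u (vertex 2) + gint (\<lambda>x. f x * hat 0 x) = d"
  using normal_derivative_unique[OF has_normal_derivative_defect[OF assms(1)] assms(2)]
  by (simp only: defect_hat)

lemma jet_unique:
  assumes "has_laplacian \<mu> u f" "has_laplacian \<mu> u' f'" "\<And>x. x \<in> gasket \<Longrightarrow> f x = f' x"
    "u (vertex 0) = u' (vertex 0)"
    "has_normal_derivative u 0 d" "has_normal_derivative u' 0 d"
    "has_tangential_derivative u 0 t" "has_tangential_derivative u' 0 t" "x \<in> gasket"
  shows "u x = u' x"
proof -
  have "gint (\<lambda>x. f x * hat 0 x) = gint (\<lambda>x. f' x * hat 0 x)"
    by (rule gint_cong) (simp add: assms(3))
  then have sum: "u (vertex 1) + u (vertex 2) = u' (vertex 1) + u' (vertex 2)"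
    using normal_derivative_value[OF assms(1,5)] normal_derivative_value[OF assms(2,6)] assms(4) by simp
  define w where "w = (\<lambda>x. u x + (-1) * u' x)"
  have w: "w x = u x - u' x" for x by (simp add: w_def)
  have l: "has_laplacian \<mu> w (\<lambda>x. f x + (-1) * f' x)"
    unfolding w_def by (intro has_laplacian_add has_laplacian_cmult assms)
  \<comment> \<open>Only the difference of the two functions is harmonic, so its tangential
    derivative can be read off from its corner values.\<close>
  have "w x = harmonic (\<lambda>i. w (vertex i)) x" if "x \<in> gasket" for x
    by (rule harmonic_unique[OF l _ that refl]) (simp add: assms(3))
  then have "has_tangential_derivative w 0 (w (vertex 1) - w (vertex 2))"
    using tangential_derivative_cong[of w "harmonic (\<lambda>i. w (vertex i))"]
      harmonic_tangential_derivative[of "\<lambda>i. w (vertex i)"] by blast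
  moreover have "has_tangential_derivative w 0 0"
    using tendsto_diff[OF assms(7,8)[unfolded tangential_derivative_iff]]
    unfolding tangential_derivative_iff w by (simp add: algebra_simps)
  ultimately have "w (vertex 1) = w (vertex 2)"
    using tangential_derivative_unique by fastforce
  with sum have "u (vertex 1) = u' (vertex 1)" "u (vertex 2) = u' (vertex 2)" by (simp_all add: w)
  with assms(4) show ?thesis
    by (intro dirichlet_unique[OF assms(1-3) _ assms(9)]) (auto elim: idx_cases)
qed

text \<open>The sequences \<open>U\<close> below are the coefficient sequences of formal eigenfunctions
  \<open>\<Sum>j. U j * z ^ j\<close> of the Laplacian with eigenvalue \<open>z\<close>.\<close>

definition eigen_sequence :: "(nat \<Rightarrow> point \<Rightarrow> real) \<Rightarrow> bool" where
  "eigen_sequence U \<longleftrightarrow> has_laplacian \<mu> (U 0) (\<lambda>x. 0) \<and> (\<forall>j. has_laplacian \<mu> (U (Suc j)) (U j))"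

lemma eigen_sequence_unique:
  assumes "eigen_sequence U" "eigen_sequence U'"
    "\<And>j. U j (vertex 0) = U' j (vertex 0)"
    "\<And>j. has_normal_derivative (U j) 0 (d j)" "\<And>j. has_normal_derivative (U' j) 0 (d j)"
    "\<And>j. has_tangential_derivative (U j) 0 (t j)" "\<And>j. has_tangential_derivative (U' j) 0 (t j)"
    "x \<in> gasket"
  shows "U j x = U' j x"
  using assms(8)
proof (induction j arbitrary: x)
  case 0
  show ?case
    by (rule jet_unique[of "U 0" "\<lambda>x. 0" "U' 0" "\<lambda>x. 0", OF _ _ refl assms(3-7) 0]) (use assms(1,2) in \<open>simp_all add: eigen_sequence_def\<close>)
next
  case (Suc j)
  show ?case
    by (rule jet_unique[of "U (Suc j)" "U j" "U' (Suc j)" "U' j", OF _ _ Suc.IH assms(3-7) Suc.prems])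
      (use assms(1,2) in \<open>simp_all add: eigen_sequence_def\<close>)
qed

text \<open>The factor \<open>5 ^ j\<close> compensates the 1/5 that each Laplacian picks up on a
  cell.\<close>

lemma eigen_sequence_contraction:
  assumes "eigen_sequence U" "i \<in> {0,1,2}"
  shows "eigen_sequence (\<lambda>j x. 5 ^ j * U j (contraction i x))"
proof -
  have "has_laplacian \<mu> (\<lambda>x. 5 ^ j * U j (contraction i x)) (\<lambda>x. 5 ^ j * (1/5 * f (contraction i x)))"
    if "has_laplacian \<mu> (U j) f" for f j
    using has_laplacian_cmult[OF has_laplacian_contraction[OF that assms(2)]] .
  from this[of 0 "\<lambda>x. 0"] this[of "Suc _" "U _"] assms(1) show ?thesis
    by (simp add: eigen_sequence_def)
qed

lemma eigen_sequence_reflection: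
  "eigen_sequence U \<Longrightarrow> eigen_sequence (\<lambda>j x. U j (reflection r x))"
  unfolding eigen_sequence_def using has_laplacian_reflection by fastforce

lemma eigen_sequence_add:
  assumes "eigen_sequence U" "eigen_sequence U'"
  shows "eigen_sequence (\<lambda>j x. U j x + U' j x)"
  using assms has_laplacian_add[of "U 0" "\<lambda>x. 0" "U' 0" "\<lambda>x. 0"]
  by (simp add: eigen_sequence_def has_laplacian_add)

lemma eigen_sequence_cmult:
  assumes "eigen_sequence U"
  shows "eigen_sequence (\<lambda>j x. c * U j x)"
  using assms has_laplacian_cmult[of "U 0" "\<lambda>x. 0" c]
  by (simp add: eigen_sequence_def has_laplacian_cmult)

text \<open>This is multiplication of a formal eigenfunction by a power series in \<open>z\<close>
  with constant coefficients, which preserves the eigenvalue equation.\<close>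

lemma eigen_sequence_convolution:
  assumes "eigen_sequence U"
  shows "eigen_sequence (\<lambda>j x. \<Sum>l\<le>j. c (j - l) * U l x)"
  unfolding eigen_sequence_def
proof (intro conjI allI)
  show "has_laplacian \<mu> (\<lambda>x. \<Sum>l\<le>0. c (0 - l) * U l x) (\<lambda>x. 0)"
    using assms has_laplacian_cmult[of "U 0" "\<lambda>x. 0" "c 0"] by (simp add: eigen_sequence_def)
next
  fix j
  \<comment> \<open>The \<open>l = 0\<close> term is split off because \<open>U 0\<close> has
    Laplacian zero; in the other terms the Laplacian shifts the index by one.\<close>
  have "has_laplacian \<mu> (\<lambda>x. c (Suc j) * U 0 x + (\<Sum>l\<le>j. c (j - l) * U (Suc l) x))
      (\<lambda>x. c (Suc j) * 0 + (\<Sum>l\<le>j. c (j - l) * U l x))"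
    using assms unfolding eigen_sequence_def
    by (intro has_laplacian_add has_laplacian_sum has_laplacian_cmult) simp_all
  then show "has_laplacian \<mu> (\<lambda>x. \<Sum>l\<le>Suc j. c (Suc j - l) * U l x) (\<lambda>x. \<Sum>l\<le>j. c (j - l) * U l x)"
    by (simp only: sum.atMost_Suc_shift diff_zero diff_Suc_Suc mult_zero_right add_0)
qed

section \<open>Monomials\<close>

lemma laplacian_power_cong_arg:
  assumes "\<And>x. x \<in> gasket \<Longrightarrow> u x = u' x"
  shows "has_laplacian_power \<mu> n u f \<Longrightarrow> has_laplacian_power \<mu> n u' f"
proof (induction n arbitrary: f)
  case 0
  then show ?case using assms by simp
next
  case (Suc n)
  then obtain g where "has_laplacian_power \<mu> n u g" "has_laplacian \<mu> g f" by auto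
  with Suc.IH show ?case unfolding has_laplacian_power.simps by (intro exI[of _ g] conjI)
qed

text \<open>The recursion of \<open>has_laplacian_power\<close> splits off the last Laplacian,
  whereas induction on the index \<open>j\<close> of a monomial needs the first.\<close>

lemma laplacian_power_Suc_front:
  "has_laplacian_power \<mu> (Suc n) u f \<Longrightarrow> \<exists>g. has_laplacian \<mu> u g \<and> has_laplacian_power \<mu> n g f"
proof (induction n arbitrary: f)
  case 0
  then obtain g where g: "\<And>x. x \<in> gasket \<Longrightarrow> g x = u x" "has_laplacian \<mu> g f" by auto
  then have "has_laplacian \<mu> u f" using has_laplacian_cong[OF g(1) refl g(2)] by blast
  then show ?case by (intro exI[of _ f]) simp
next
  case (Suc n)
  then obtain h where h: "has_laplacian_power \<mu> (Suc n) u h" "has_laplacian \<mu> h f"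
    unfolding has_laplacian_power.simps(2)[of \<mu> "Suc n"] by blast
  from Suc.IH[OF h(1)] obtain g where "has_laplacian \<mu> u g" "has_laplacian_power \<mu> n g h" by blast
  with h(2) show ?case by (intro exI[of _ g]) auto
qed

lemma monomial_jet:
  assumes "is_monomial \<mu> j k u"
  shows "u (vertex 0) = of_bool (j = 0 \<and> k = 1)"
    "has_normal_derivative u 0 (of_bool (j = 0 \<and> k = 2))"
    "has_tangential_derivative u 0 (of_bool (j = 0 \<and> k = 3))"
proof -
  from assms[unfolded is_monomial_def, THEN conjunct2, rule_format, OF le0]
  obtain f where f: "\<forall>x\<in>gasket. f x = u x"
    "f (vertex 0) = of_bool (j = 0 \<and> k = 1)"
    "has_normal_derivative f 0 (of_bool (j = 0 \<and> k = 2))"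
    "has_tangential_derivative f 0 (of_bool (j = 0 \<and> k = 3))"
    unfolding has_laplacian_power.simps eq_commute[of 0 j] by (elim exE conjE) (rule that)
  from f(1) have "\<And>x. x \<in> gasket \<Longrightarrow> f x = u x" by blast
  note cong = normal_derivative_cong[of f u, OF this] tangential_derivative_cong[of f u, OF this]
    this[of "vertex 0"]
  show "u (vertex 0) = of_bool (j = 0 \<and> k = 1)" using f(2) cong(3) by simp
  show "has_normal_derivative u 0 (of_bool (j = 0 \<and> k = 2))" using f(3) cong(1) by blast
  show "has_tangential_derivative u 0 (of_bool (j = 0 \<and> k = 3))" using f(4) cong(2) by blast
qed

lemma monomial_0_laplacian:
  assumes "is_monomial \<mu> 0 k u"
  shows "has_laplacian \<mu> u (\<lambda>x. 0)"
proof -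
  from assms obtain g where g: "\<And>x. x \<in> gasket \<Longrightarrow> g x = u x" "has_laplacian \<mu> g (\<lambda>x. 0)"
    unfolding is_monomial_def by auto
  show ?thesis by (rule has_laplacian_cong[OF g(1) refl g(2)])
qed

lemma monomial_Suc_laplacian:
  assumes "is_monomial \<mu> (Suc j) k u"
  shows "\<exists>g. has_laplacian \<mu> u g \<and> is_monomial \<mu> j k g"
proof -
  have "has_laplacian_power \<mu> (Suc (Suc j)) u (\<lambda>x. 0)"
    using assms unfolding is_monomial_def by simp
  from laplacian_power_Suc_front[OF this]
  obtain g where g: "has_laplacian \<mu> u g" "has_laplacian_power \<mu> (Suc j) g (\<lambda>x. 0)" by blast
  have "\<exists>f. has_laplacian_power \<mu> n g f \<and> f (vertex 0) = of_bool (n = j \<and> k = 1) \<and>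
        has_normal_derivative f 0 (of_bool (n = j \<and> k = 2)) \<and>
        has_tangential_derivative f 0 (of_bool (n = j \<and> k = 3))" if "n \<le> j" for n
  proof -
    from that have "Suc n \<le> Suc j" by simp
    from assms[unfolded is_monomial_def, THEN conjunct2, rule_format, OF this]
    obtain f where f: "has_laplacian_power \<mu> (Suc n) u f"
      "f (vertex 0) = of_bool (Suc n = Suc j \<and> k = 1)"
      "has_normal_derivative f 0 (of_bool (Suc n = Suc j \<and> k = 2))"
      "has_tangential_derivative f 0 (of_bool (Suc n = Suc j \<and> k = 3))"
      by (elim exE conjE) (rule that)
    from laplacian_power_Suc_front[OF f(1)]
    obtain g' where g': "has_laplacian \<mu> u g'" "has_laplacian_power \<mu> n g' f" by blast
    \<comment> \<open>The witness \<open>g'\<close> depends on \<open>n\<close>; it agrees with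
      \<open>g\<close> on the gasket because both are Laplacians of \<open>u\<close>.\<close>
    have "has_laplacian_power \<mu> n g f"
      by (rule laplacian_power_cong_arg[OF _ g'(2)]) (rule laplacian_unique[OF g'(1) g(1) refl])
    with f(2-4) show ?thesis by (intro exI[of _ f]) simp
  qed
  with g(2) have "is_monomial \<mu> j k g" unfolding is_monomial_def by simp
  with g(1) show ?thesis by blast
qed

lemma monomial_unique:
  assumes "is_monomial \<mu> j k u" "is_monomial \<mu> j k u'" "x \<in> gasket"
  shows "u x = u' x"
  using assms
proof (induction j arbitrary: u u' x)
  case 0
  show ?case
    by (rule jet_unique[OF monomial_0_laplacian[OF 0(1)] monomial_0_laplacian[OF 0(2)] refl _
          monomial_jet(2)[OF 0(1)] monomial_jet(2)[OF 0(2)]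
          monomial_jet(3)[OF 0(1)] monomial_jet(3)[OF 0(2)] 0(3)])
      (rule trans[OF monomial_jet(1)[OF 0(1)] monomial_jet(1)[OF 0(2), symmetric]])
next
  case (Suc j)
  from monomial_Suc_laplacian[OF Suc.prems(1)] obtain g where
    g: "has_laplacian \<mu> u g" "is_monomial \<mu> j k g" by blast
  from monomial_Suc_laplacian[OF Suc.prems(2)] obtain g' where
    g': "has_laplacian \<mu> u' g'" "is_monomial \<mu> j k g'" by blast
  show ?case
    by (rule jet_unique[OF g(1) g'(1) Suc.IH[OF g(2) g'(2)] _
          monomial_jet(2)[OF Suc.prems(1)] monomial_jet(2)[OF Suc.prems(2)]
          monomial_jet(3)[OF Suc.prems(1)] monomial_jet(3)[OF Suc.prems(2)] Suc.prems(3)])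
      (assumption, rule trans[OF monomial_jet(1)[OF Suc.prems(1)] monomial_jet(1)[OF Suc.prems(2), symmetric]])
qed

lemma monomials_eigen_sequence:
  assumes "\<And>j. is_monomial \<mu> j k (p j)"
  shows "eigen_sequence p"
  unfolding eigen_sequence_def
proof (intro conjI allI)
  show "has_laplacian \<mu> (p 0) (\<lambda>x. 0)" by (rule monomial_0_laplacian[OF assms])
  fix j
  from monomial_Suc_laplacian[OF assms[of "Suc j"]] obtain g where
    g: "has_laplacian \<mu> (p (Suc j)) g" "is_monomial \<mu> j k g" by blast
  show "has_laplacian \<mu> (p (Suc j)) (p j)"
    by (rule has_laplacian_cong[OF refl _ g(1)]) (rule monomial_unique[OF g(2) assms])
qed

text \<open>The common tool for scaling and symmetry: an operation preserving eigen sequences acts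
  on the monomials of type \<open>k\<close> as a scalar as soon as it multiplies their jets by that
  scalar.\<close>

lemma eigen_sequence_multiple_of_monomials:
  assumes "\<And>j. is_monomial \<mu> j k (p j)" "eigen_sequence U"
    "\<And>j. U j (vertex 0) = c * of_bool (j = 0 \<and> k = 1)"
    "\<And>j. has_normal_derivative (U j) 0 (c * of_bool (j = 0 \<and> k = 2))"
    "\<And>j. has_tangential_derivative (U j) 0 (c * of_bool (j = 0 \<and> k = 3))" "x \<in> gasket"
  shows "U j x = c * p j x"
  by (rule eigen_sequence_unique[OF assms(2) eigen_sequence_cmult[OF monomials_eigen_sequence[OF assms(1)]]
        _ assms(4) normal_derivative_cmult[OF monomial_jet(2)[OF assms(1)]] assms(5)
        tangential_derivative_cmult[OF monomial_jet(3)[OF assms(1)]] assms(6)])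
    (simp only: assms(3) monomial_jet(1)[OF assms(1)])

text \<open>The factors by which \<open>contraction 0\<close> scales a value, a normal and a
  tangential derivative. They are the eigenvalues of the harmonic extension rule on the cell at
  \<open>vertex 0\<close>.\<close>

definition scale_factor :: "nat \<Rightarrow> real" where
  "scale_factor k = (if k = 1 then 1 else if k = 2 then 3/5 else 1/5)"

lemma monomial_contraction:
  assumes "\<And>j. is_monomial \<mu> j k (p j)" "x \<in> gasket"
  shows "5 ^ j * p j (contraction 0 x) = scale_factor k * p j x"
proof (rule eigen_sequence_multiple_of_monomials[OF assms(1) _ _ _ _ assms(2)])
  show "eigen_sequence (\<lambda>j x. 5 ^ j * p j (contraction 0 x))"
    by (intro eigen_sequence_contraction monomials_eigen_sequence[OF assms(1)]) simp
  fix j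
  \<comment> \<open>Only \<open>j = 0\<close> has a nonzero jet entry, so the factor
    \<open>5 ^ j\<close> does not disturb the jets.\<close>
  show "5 ^ j * p j (contraction 0 (vertex 0)) = scale_factor k * of_bool (j = 0 \<and> k = 1)"
    by (cases j) (simp_all add: monomial_jet(1)[OF assms(1)] scale_factor_def)
  have eq: "5 ^ j * (3/5 * of_bool (j = 0 \<and> k = 2)) = scale_factor k * of_bool (j = 0 \<and> k = 2)"
    by (cases j) (simp_all add: scale_factor_def)
  show "has_normal_derivative (\<lambda>x. 5 ^ j * p j (contraction 0 x)) 0
      (scale_factor k * of_bool (j = 0 \<and> k = 2))"
    unfolding eq[symmetric]
    by (intro normal_derivative_cmult normal_derivative_contraction monomial_jet(2) assms(1))
  have eq: "5 ^ j * (1/5 * of_bool (j = 0 \<and> k = 3)) = scale_factor k * of_bool (j = 0 \<and> k = 3)"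
    by (cases j) (simp_all add: scale_factor_def)
  show "has_tangential_derivative (\<lambda>x. 5 ^ j * p j (contraction 0 x)) 0
      (scale_factor k * of_bool (j = 0 \<and> k = 3))"
    unfolding eq[symmetric]
    by (intro tangential_derivative_cmult tangential_derivative_contraction monomial_jet(3) assms(1))
qed

lemma monomial_contraction_power:
  assumes "\<And>j. is_monomial \<mu> j k (p j)" "x \<in> gasket"
  shows "p j ((contraction 0 ^^ m) x) = (scale_factor k / 5 ^ j) ^ m * p j x"
proof (induction m)
  case (Suc m)
  have "p j ((contraction 0 ^^ Suc m) x) = scale_factor k / 5 ^ j * p j ((contraction 0 ^^ m) x)"
    using monomial_contraction[OF assms(1) contraction_power_gasket[OF _ assms(2), of 0 m], of j]
    by (simp add: field_simps)
  with Suc show ?case by simp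
qed simp

lemma monomial_reflection:
  assumes "\<And>j. is_monomial \<mu> j k (p j)" "x \<in> gasket"
  shows "p j (reflection 0 x) = (if k = 3 then -1 else 1) * p j x"
proof (rule eigen_sequence_multiple_of_monomials[OF assms(1) _ _ _ _ assms(2)])
  show "eigen_sequence (\<lambda>j x. p j (reflection 0 x))"
    by (intro eigen_sequence_reflection monomials_eigen_sequence[OF assms(1)])
  fix j
  show "p j (reflection 0 (vertex 0)) = (if k = 3 then -1 else 1) * of_bool (j = 0 \<and> k = 1)"
    by (simp add: monomial_jet(1)[OF assms(1)])
  show "has_normal_derivative (\<lambda>x. p j (reflection 0 x)) 0 ((if k = 3 then -1 else 1) * of_bool (j = 0 \<and> k = 2))"
    using normal_derivative_reflection[OF monomial_jet(2)[OF assms(1)[of j]]] by (cases "k = 3") simp_all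
  show "has_tangential_derivative (\<lambda>x. p j (reflection 0 x)) 0 ((if k = 3 then -1 else 1) * of_bool (j = 0 \<and> k = 3))"
    using tangential_derivative_reflection[OF monomial_jet(3)[OF assms(1)[of j]]]
    by (cases "k = 3") simp_all
qed

section \<open>The mean value formula at junction points\<close>

text \<open>Both cells meeting at the junction point \<open>contraction i (vertex k)\<close> are mapped onto the gasket so
  that this point becomes \<open>vertex 0\<close>. There the two normal derivatives cancel, so that the sum of the
  two copies satisfies a Neumann condition.\<close>

definition fold_cells :: "nat \<Rightarrow> nat \<Rightarrow> (point \<Rightarrow> real) \<Rightarrow> point \<Rightarrow> real" where
  "fold_cells i k u x = u (contraction i (reflection (2 * k) x)) + u (contraction k (reflection (2 * i) x))"

lemma defect_fold_cell:
  assumes "has_laplacian \<mu> u f" "k \<in> {0,1,2}"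
  shows "defect (\<lambda>x. u (reflection (2 * k) x)) (\<lambda>x. f (reflection (2 * k) x)) (hat 0) = defect u f (hat k)"
proof -
  have f: "continuous_on gasket f" using assms(1) by (simp add: has_laplacian_iff)
  have "hat k (reflection (2 * k) x) = hat 0 x" if "x \<in> gasket" for x
    using hat_reflection[OF reflection_gasket[OF that] assms(2), of "2 * k"]
    by (simp add: reflection_involution)
  then have "defect (\<lambda>x. u (reflection (2 * k) x)) (\<lambda>x. f (reflection (2 * k) x)) (hat 0)
      = defect (\<lambda>x. u (reflection (2 * k) x)) (\<lambda>x. f (reflection (2 * k) x)) (\<lambda>x. hat k (reflection (2 * k) x))"
    by (intro defect_cong refl) simp
  also have "\<dots> = defect u f (hat k)" by (rule defect_reflection[OF hat_energy_domain f])
  finally show ?thesis .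
qed

text \<open>Testing with \<open>junction i k\<close> leaves one hat pairing per adjacent cell, and
  their sum vanishes. Reflecting both cells so that the junction moves to \<open>vertex 0\<close>
  turns this sum into the pairing of the folded function with \<open>hat 0\<close>.\<close>

lemma defect_fold_cells:
  assumes "has_laplacian \<mu> u f" and ik: "i \<in> {0,1,2}" "k \<in> {0,1,2}" "i \<noteq> k"
  shows "defect (fold_cells i k u) (\<lambda>x. 1/5 * fold_cells i k f x) (hat 0) = 0"
    and "has_laplacian \<mu> (fold_cells i k u) (\<lambda>x. 1/5 * fold_cells i k f x)"
proof -
  let ?u = "\<lambda>i x. u (contraction i x)" and ?f = "\<lambda>i x. 1/5 * f (contraction i x)"
  have u: "u \<in> energy_domain" and f: "continuous_on gasket f"
    using assms(1) by (simp_all add: has_laplacian_iff)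
  have l: "has_laplacian \<mu> (?u i) (?f i)" "has_laplacian \<mu> (?u k) (?f k)"
    by (intro has_laplacian_contraction assms)+
  have l': "has_laplacian \<mu> (\<lambda>x. ?u i (reflection (2 * k) x)) (\<lambda>x. ?f i (reflection (2 * k) x))"
    "has_laplacian \<mu> (\<lambda>x. ?u k (reflection (2 * i) x)) (\<lambda>x. ?f k (reflection (2 * i) x))"
    by (rule has_laplacian_reflection[OF l(1)], rule has_laplacian_reflection[OF l(2)])
  have eq: "(\<lambda>x. ?u i (reflection (2 * k) x) + ?u k (reflection (2 * i) x)) = fold_cells i k u"
    "(\<lambda>x. ?f i (reflection (2 * k) x) + ?f k (reflection (2 * i) x)) = (\<lambda>x. 1/5 * fold_cells i k f x)"
    by (simp_all add: fold_cells_def fun_eq_iff)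
  show "has_laplacian \<mu> (fold_cells i k u) (\<lambda>x. 1/5 * fold_cells i k f x)"
    using has_laplacian_add[OF l'] unfolding eq .
  let ?h = "\<lambda>l. if l = i then hat k else if l = k then hat i else (\<lambda>x. 0)"
  have "0 = defect u f (junction i k)"
    using assms(1) junction_test_function[OF ik] by (simp add: has_laplacian_iff)
  also have "\<dots> = 5/3 * (\<Sum>l\<in>{0,1,2}. defect (?u l) (?f l) (?h l))"
    unfolding junction_def
    by (rule defect_glue[OF u f junction_matching[OF ik]]) (simp add: hat_energy_domain energy_domain_const)
  also have "\<dots> = 5/3 * (defect (?u i) (?f i) (hat k) + defect (?u k) (?f k) (hat i))"
    using ik by (elim idx_cases) (simp_all add: defect_zero add_ac)
  also have "\<dots> = 5/3 * defect (fold_cells i k u) (\<lambda>x. 1/5 * fold_cells i k f x) (hat 0)"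
  proof -
    have "defect (fold_cells i k u) (\<lambda>x. 1/5 * fold_cells i k f x) (hat 0) =
      defect (\<lambda>x. ?u i (reflection (2 * k) x)) (\<lambda>x. ?f i (reflection (2 * k) x)) (hat 0) +
      defect (\<lambda>x. ?u k (reflection (2 * i) x)) (\<lambda>x. ?f k (reflection (2 * i) x)) (hat 0)"
      unfolding eq[symmetric] using l' by (intro defect_add hat_energy_domain) (simp_all add: has_laplacian_iff)
    also have "\<dots> = defect (?u i) (?f i) (hat k) + defect (?u k) (?f k) (hat i)"
      using defect_fold_cell[OF l(1) ik(2)] defect_fold_cell[OF l(2) ik(1)] by simp
    finally show ?thesis by simp
  qed
  finally show "defect (fold_cells i k u) (\<lambda>x. 1/5 * fold_cells i k f x) (hat 0) = 0" by simp
qed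

lemma eigen_sequence_fold_cells:
  assumes "eigen_sequence U" and ik: "i \<in> {0,1,2}" "k \<in> {0,1,2}" "i \<noteq> k"
  shows "eigen_sequence (\<lambda>j x. 5 ^ j * fold_cells i k (U j) x)"
    and "has_normal_derivative (\<lambda>x. 5 ^ j * fold_cells i k (U j) x) 0 0"
proof -
  have l: "has_laplacian \<mu> (\<lambda>x. 5 ^ j * fold_cells i k (U j) x) (\<lambda>x. 5 ^ j * (1/5 * fold_cells i k f x))"
    "has_normal_derivative (\<lambda>x. 5 ^ j * fold_cells i k (U j) x) 0 (5 ^ j * 0)"
    if f: "has_laplacian \<mu> (U j) f" for j f
    using has_laplacian_cmult[OF defect_fold_cells(2)[OF f ik]]
      normal_derivative_cmult[OF has_normal_derivative_defect[OF defect_fold_cells(2)[OF f ik]]]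
      defect_fold_cells(1)[OF f ik] by simp_all
  have z: "fold_cells i k (\<lambda>x. 0) = (\<lambda>x. 0)" by (simp add: fold_cells_def fun_eq_iff)
  show "eigen_sequence (\<lambda>j x. 5 ^ j * fold_cells i k (U j) x)"
    using assms(1) l(1)[of 0 "\<lambda>x. 0"] l(1)[of "Suc _" "U _"] by (simp add: eigen_sequence_def z)
  show "has_normal_derivative (\<lambda>x. 5 ^ j * fold_cells i k (U j) x) 0 0"
    using assms(1) l(2)[of j] by (cases j) (auto simp: eigen_sequence_def)
qed

text \<open>Folding removes the normal derivative and adding the mirror image removes the tangential
  one. The jets of the symmetrised sequence thus consist of values only, and by uniqueness it is the
  convolution of these values with \<open>p\<close>.\<close>

lemma mean_value_formula:
  assumes "\<And>j. is_monomial \<mu> j 1 (p j)" "eigen_sequence U"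
    and ik: "i \<in> {0,1,2}" "k \<in> {0,1,2}" "i \<noteq> k"
  shows "fold_cells i k (U j) (vertex 1) + fold_cells i k (U j) (vertex 2) =
    (\<Sum>l\<le>j. 4 * (p l (vertex 1) / 5 ^ l) * U (j - l) (contraction i (vertex k)))"
proof -
  let ?W = "\<lambda>j x. 5 ^ j * fold_cells i k (U j) x"
  let ?S = "\<lambda>j x. ?W j x + ?W j (reflection 0 x)"
  \<comment> \<open>Four copies meet at \<open>vertex 0\<close>: two cells, each with its mirror
    image. The power of 5 comes from restricting to a cell.\<close>
  let ?c = "\<lambda>j. 4 * 5 ^ j * U j (contraction i (vertex k))"
  have p: "eigen_sequence p" by (rule monomials_eigen_sequence[OF assms(1)])
  have "?S j (vertex 1) = (\<Sum>l\<le>j. ?c (j - l) * p l (vertex 1))"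
  proof (rule eigen_sequence_unique[where d = "\<lambda>j. 0" and t = "\<lambda>j. 0"])
    show "eigen_sequence ?S"
      by (intro eigen_sequence_add eigen_sequence_reflection[of ?W] eigen_sequence_fold_cells(1) assms)
    show "eigen_sequence (\<lambda>j x. \<Sum>l\<le>j. ?c (j - l) * p l x)"
      by (rule eigen_sequence_convolution[OF p])
    fix j
    have "reflection (2 * l) (vertex 0) = vertex l" if "l \<in> {0,1,2}" for l
      using that by (elim idx_cases) (simp_all add: reflection_vertex)
    then have "?S j (vertex 0) = ?c j"
      using ik(1,2) contraction_vertex_commute[of k i] by (simp add: fold_cells_def)
    also have "\<dots> = (\<Sum>l\<in>{0}. ?c (j - l) * p l (vertex 0))"
      by (simp add: monomial_jet(1)[OF assms(1)])
    also have "\<dots> = (\<Sum>l\<le>j. ?c (j - l) * p l (vertex 0))"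
      by (rule sum.mono_neutral_left) (auto simp: monomial_jet(1)[OF assms(1)])
    finally show "?S j (vertex 0) = (\<Sum>l\<le>j. ?c (j - l) * p l (vertex 0))" .
    have "has_normal_derivative (?W j) 0 0" by (rule eigen_sequence_fold_cells(2)[OF assms(2) ik])
    from tendsto_add[OF this[unfolded normal_derivative_iff]
        normal_derivative_reflection[OF this, unfolded normal_derivative_iff]]
    show "has_normal_derivative (?S j) 0 0"
      unfolding normal_derivative_iff by (simp add: algebra_simps)
    show "has_tangential_derivative (?S j) 0 0"
      unfolding tangential_derivative_iff
      by (simp add: reflection_contraction_power add.commute)
    show "has_normal_derivative (\<lambda>x. \<Sum>l\<le>j. ?c (j - l) * p l x) 0 0"
    proof -
      have "has_normal_derivative (\<lambda>x. \<Sum>l\<le>j. ?c (j - l) * p l x) 0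
          (\<Sum>l\<le>j. ?c (j - l) * of_bool (l = 0 \<and> (1::nat) = 2))"
        by (intro normal_derivative_sum normal_derivative_cmult monomial_jet(2) assms(1))
      then show ?thesis by simp
    qed
    show "has_tangential_derivative (\<lambda>x. \<Sum>l\<le>j. ?c (j - l) * p l x) 0 0"
    proof -
      have "has_tangential_derivative (\<lambda>x. \<Sum>l\<le>j. ?c (j - l) * p l x) 0
          (\<Sum>l\<le>j. ?c (j - l) * of_bool (l = 0 \<and> (1::nat) = 3))"
        by (intro tangential_derivative_sum tangential_derivative_cmult monomial_jet(3) assms(1))
      then show ?thesis by simp
    qed
  qed simp
  also have "?S j (vertex 1) = 5 ^ j * (fold_cells i k (U j) (vertex 1) + fold_cells i k (U j) (vertex 2))"
    by (simp add: distrib_left)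
  also have "(\<Sum>l\<le>j. ?c (j - l) * p l (vertex 1)) =
      5 ^ j * (\<Sum>l\<le>j. 4 * (p l (vertex 1) / 5 ^ l) * U (j - l) (contraction i (vertex k)))"
    unfolding sum_distrib_left by (intro sum.cong refl) (simp add: power_diff)
  finally show ?thesis by simp
qed

end

section \<open>Positivity of the boundary values\<close>

text \<open>Moving the terms \<open>l = 0\<close> and \<open>l = j\<close> to the left leaves
  \<open>(5 ^ j - 5) * t j\<close> against a sum of positive products. At \<open>j = 1\<close> this
  factor is zero, so positivity there is an input.\<close>

lemma quadratic_recursion_pos:
  fixes t :: "nat \<Rightarrow> real"
  assumes "t 0 = 1" "t 1 > 0" "\<And>j. 5 ^ j * t j = 4 * (\<Sum>l\<le>j. t l * t (j - l)) - 3 * t j"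
  shows "t j > 0"
proof (induction j rule: less_induct)
  case (less j)
  consider "j = 0" | "j = 1" | "j \<ge> 2" by linarith
  then show ?case
  proof cases
    case 3
    have set_eq: "{..j} = insert 0 (insert j {1..<j})" using 3 by auto
    have "(\<Sum>l\<le>j. t l * t (j - l)) = 2 * t j + (\<Sum>l\<in>{1..<j}. t l * t (j - l))"
      unfolding set_eq using 3 assms(1) by simp
    with assms(3)[of j] have eq: "(5 ^ j - 5) * t j = 4 * (\<Sum>l\<in>{1..<j}. t l * t (j - l))"
      by (simp add: algebra_simps)
    have "(\<Sum>l\<in>{1..<j}. t l * t (j - l)) > 0"
      by (rule sum_pos) (use 3 in \<open>auto intro!: mult_pos_pos less.IH\<close>)
    with eq have pos: "(5 ^ j - 5) * t j > 0" by simp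
    have "(5::real) ^ 1 < 5 ^ j" using 3 by (intro power_strict_increasing) auto
    with pos show ?thesis by (simp add: zero_less_mult_iff)
  qed (use assms in simp_all)
qed

text \<open>The term \<open>l = 0\<close> contributes \<open>4 * g j\<close>, whence the factor
  \<open>5 ^ Suc j - 5\<close>. It vanishes at \<open>j = 0\<close>, so positivity of
  \<open>g 0\<close> is an input.\<close>

lemma linear_recursion_pos:
  fixes t g :: "nat \<Rightarrow> real"
  assumes "t 0 = 1" "\<And>j. t j > 0" "g 0 > 0"
    "\<And>j. 5 ^ Suc j * g j - g j = 4 * (\<Sum>l\<le>j. t l * g (j - l))"
  shows "g j > 0"
proof (induction j rule: less_induct)
  case (less j)
  show ?case
  proof (cases "j = 0")
    case False
    have set_eq: "{..j} = insert 0 {1..j}" by auto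
    have "(\<Sum>l\<le>j. t l * g (j - l)) = g j + (\<Sum>l\<in>{1..j}. t l * g (j - l))"
      unfolding set_eq using assms(1) by simp
    with assms(4)[of j] have eq: "(5 ^ Suc j - 5) * g j = 4 * (\<Sum>l\<in>{1..j}. t l * g (j - l))"
      by (simp add: algebra_simps)
    have "(\<Sum>l\<in>{1..j}. t l * g (j - l)) > 0"
      by (rule sum_pos) (use False assms(2) in \<open>auto intro!: mult_pos_pos less.IH\<close>)
    with eq have pos: "(5 ^ Suc j - 5) * g j > 0" by simp
    have "(5::real) ^ 1 < 5 ^ Suc j" using False by (intro power_strict_increasing) auto
    with pos show ?thesis by (simp add: zero_less_mult_iff)
  qed (use assms(3) in simp)
qed

text \<open>Eliminating \<open>y\<close>, the values at the midpoint opposite to \<open>vertex 0\<close>, from the two mean value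
  formulas leaves the spectral decimation polynomial \<open>4 t\<^sup>2 - 3 t\<close>. The formal power series
  ring is an integral domain, so the common factor \<open>1 + 2 t\<close> cancels.\<close>

lemma spectral_decimation:
  fixes a t y :: "nat \<Rightarrow> real"
  assumes "t 0 = 1"
    and eq1: "\<And>j. of_bool (j = 0) + t j + y j + a j = 4 * (\<Sum>l\<le>j. t l * t (j - l))"
    and eq2: "\<And>j. 2 * a j + 2 * t j = 4 * (\<Sum>l\<le>j. t l * y (j - l))"
  shows "a j = 4 * (\<Sum>l\<le>j. t l * t (j - l)) - 3 * t j"
proof -
  let ?A = "Abs_fps a" and ?T = "Abs_fps t" and ?Y = "Abs_fps y"
  have conv: "fps_nth (Abs_fps f * Abs_fps g) j = (\<Sum>l\<le>j. f l * g (j - l))" for f g :: "nat \<Rightarrow> real" and j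
    by (simp add: fps_mult_nth atLeast0AtMost)
  have e1: "1 + ?T + ?Y + ?A = 4 * (?T * ?T)"
    using eq1 by (intro fps_ext) (simp add: numeral_fps_const conv of_bool_def)
  have e2: "2 * ?A + 2 * ?T = 4 * (?T * ?Y)"
    using eq2 by (intro fps_ext) (simp add: numeral_fps_const conv)
  have "?Y = 4 * (?T * ?T) - 1 - ?T - ?A" using e1 by (simp add: algebra_simps)
  with e2 have "2 * ((1 + 2 * ?T) * (?A - (4 * (?T * ?T) - 3 * ?T))) = 0"
    by (simp add: algebra_simps)
  moreover have "1 + 2 * ?T \<noteq> 0"
  proof
    assume "1 + 2 * ?T = 0"
    then have "fps_nth (1 + 2 * ?T) 0 = 0" by simp
    then show False using assms(1) by (simp add: numeral_fps_const)
  qed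
  ultimately have "?A = 4 * (?T * ?T) - 3 * ?T" by simp
  then have "fps_nth ?A j = fps_nth (4 * (?T * ?T) - 3 * ?T) j" by simp
  then show ?thesis by (simp add: numeral_fps_const conv)
qed

context gasket_space
begin

text \<open>These are the four level 1 neighbours of the midpoint of the side from
  \<open>vertex 0\<close> to \<open>vertex 1\<close>.\<close>

lemma fold_cells_01:
  "fold_cells 0 1 u (vertex 1) + fold_cells 0 1 u (vertex 2) =
    u (vertex 0) + u (contraction 0 (vertex 2)) + u (contraction 1 (vertex 2)) + u (vertex 1)"
proof -
  have "reflection 2 (vertex 1) = vertex 0" "reflection 2 (vertex 2) = vertex 2"
    "reflection 0 (vertex 1) = vertex 2" "reflection 0 (vertex 2) = vertex 1"
    using reflection_vertex[of 1 2] reflection_vertex[of 2 2] by simp_all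
  then show ?thesis by (simp only: fold_cells_def) simp
qed

lemma fold_cells_12:
  "fold_cells 1 2 u (vertex 1) + fold_cells 1 2 u (vertex 2) =
    u (vertex 1) + u (contraction 0 (vertex 1)) + u (contraction 0 (vertex 2)) + u (vertex 2)"
proof -
  have "reflection 4 (vertex 1) = vertex 1" "reflection 4 (vertex 2) = vertex 0"
    "reflection 2 (vertex 1) = vertex 0" "reflection 2 (vertex 2) = vertex 2"
    using reflection_vertex[of 1 4] reflection_vertex[of 2 4] reflection_vertex[of 1 2]
      reflection_vertex[of 2 2] by simp_all
  then show ?thesis
    using contraction_vertex_commute[of 1 0] contraction_vertex_commute[of 2 0]
    by (simp add: fold_cells_def)
qed

context
  fixes p :: "nat \<Rightarrow> point \<Rightarrow> real"
  assumes p: "\<And>j. is_monomial \<mu> j 1 (p j)"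
begin

lemma monomial_1_contraction:
  "k \<in> {1,2} \<Longrightarrow> p j (contraction 0 (vertex k)) = p j (vertex 1) / 5 ^ j"
  using monomial_contraction_power[OF p vertex_in_gasket, of j 1 k]
    monomial_reflection[OF p vertex_in_gasket, of j 1]
  by (auto simp: scale_factor_def)

lemma monomial_1_vertex_2: "p j (vertex 2) = p j (vertex 1)"
  using monomial_reflection[OF p vertex_in_gasket, of j 1] by simp

lemma monomial_1_0: "p 0 (vertex 1) = 1"
  using normal_derivative_value[OF monomial_0_laplacian[OF p] monomial_jet(2)[OF p]]
    monomial_jet(1)[OF p, of 0] monomial_1_vertex_2[of 0] by (simp add: gint_const)

text \<open>The Laplacian of \<open>p 1\<close> is the constant 1, so the vanishing normal
  derivative balances twice the value at \<open>vertex 1\<close> against the integral 1/3 of the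
  hat.\<close>

lemma monomial_1_1: "p 1 (vertex 1) = 1/6"
proof -
  have one: "p 0 x = 1" if x: "x \<in> gasket" for x
  proof -
    have "has_laplacian \<mu> (\<lambda>x. 1) (\<lambda>x. 0)"
      unfolding has_laplacian_iff defect_def
      by (simp add: energy_domain_const energy_const gint_const)
    from dirichlet_unique[OF monomial_0_laplacian[OF p] this refl _ x] show ?thesis
      using monomial_1_0 monomial_1_vertex_2[of 0] monomial_jet(1)[OF p, of 0] by auto
  qed
  have "has_laplacian \<mu> (p 1) (p 0)"
    using monomials_eigen_sequence[OF p] by (simp add: eigen_sequence_def)
  from normal_derivative_value[OF this monomial_jet(2)[OF p]]
  have "gint (\<lambda>x. p 0 x * hat 0 x) = 2 * p 1 (vertex 1)"
    using monomial_1_vertex_2[of 1] monomial_jet(1)[OF p, of 1] by simp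
  moreover have "gint (\<lambda>x. p 0 x * hat 0 x) = gint (hat 0)"
    by (rule gint_cong) (simp add: one)
  ultimately show ?thesis using gint_hat[of 0] by simp
qed

lemma monomial_1_pos: "p j (vertex 1) / 5 ^ j > 0"
proof (rule quadratic_recursion_pos[of "\<lambda>j. p j (vertex 1) / 5 ^ j"])
  let ?t = "\<lambda>j. p j (vertex 1) / 5 ^ j" and ?y = "\<lambda>j. p j (contraction 1 (vertex 2))"
  show t0: "?t 0 = 1" "?t 1 > 0" using monomial_1_0 monomial_1_1 by simp_all
  fix j
  note U = monomials_eigen_sequence[OF p]
  \<comment> \<open>The mean value formula at the midpoint of \<open>vertex 0\<close> and
    \<open>vertex 1\<close>; the next equation is the one at the midpoint opposite to
    \<open>vertex 0\<close>.\<close>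
  have "of_bool (j = 0) + ?t j + ?y j + p j (vertex 1) = 4 * (\<Sum>l\<le>j. ?t l * ?t (j - l))" for j
    using mean_value_formula[OF p U, of 0 1 j] fold_cells_01[of "p j"] monomial_jet(1)[OF p, of j]
    by (simp add: monomial_1_contraction sum_distrib_left mult.assoc)
  moreover have "2 * p j (vertex 1) + 2 * ?t j = 4 * (\<Sum>l\<le>j. ?t l * ?y (j - l))" for j
    using mean_value_formula[OF p U, of 1 2 j] fold_cells_12[of "p j"]
    by (simp add: monomial_1_contraction monomial_1_vertex_2 sum_distrib_left mult.assoc)
  ultimately have "p j (vertex 1) = 4 * (\<Sum>l\<le>j. ?t l * ?t (j - l)) - 3 * ?t j"
    using t0(1) by (rule spectral_decimation[rotated])
  then show "5 ^ j * ?t j = 4 * (\<Sum>l\<le>j. ?t l * ?t (j - l)) - 3 * ?t j" by simp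
qed

text \<open>The odd monomial vanishes at \<open>vertex 0\<close> and at the midpoint opposite to it,
  so the mean value formula at the midpoint of \<open>vertex 0\<close> and \<open>vertex 1\<close>
  alone gives a closed recursion. The quantity in question is the value of \<open>q j\<close> at
  that midpoint.\<close>

lemma monomial_3_pos:
  assumes q: "\<And>j. is_monomial \<mu> j 3 (q j)"
  shows "q j (vertex 1) / 5 ^ Suc j > 0"
proof (rule linear_recursion_pos[of "\<lambda>j. p j (vertex 1) / 5 ^ j" "\<lambda>j. q j (vertex 1) / 5 ^ Suc j"])
  let ?t = "\<lambda>j. p j (vertex 1) / 5 ^ j" and ?g = "\<lambda>j. q j (vertex 1) / 5 ^ Suc j"
  have v2: "q j (vertex 2) = - q j (vertex 1)" for j
    using monomial_reflection[OF q vertex_in_gasket, of j 1] by simp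
  have c1: "q j (contraction 0 (vertex 1)) = ?g j" for j
    using monomial_contraction_power[OF q vertex_in_gasket, of j 1 1] by (simp add: scale_factor_def)
  have c2: "q j (contraction 0 (vertex 2)) = - ?g j" for j
    using monomial_contraction_power[OF q vertex_in_gasket, of j 1 2] v2[of j]
    by (simp add: scale_factor_def)
  have mid: "q j (contraction 1 (vertex 2)) = 0" for j
  proof -
    have "reflection 0 (contraction 1 (vertex 2)) = contraction 2 (vertex 1)"
      using reflection_contraction[of 1 0 "vertex 2"] by (simp flip: numeral_2_eq_2)
    then have "reflection 0 (contraction 1 (vertex 2)) = contraction 1 (vertex 2)"
      by (simp only: contraction_vertex_commute[of 2 1])
    then show ?thesis
      using monomial_reflection[OF q contraction_gasket[OF _ vertex_in_gasket], of 1 j 2] by simp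
  qed
  show "?t 0 = 1" using monomial_1_0 by simp
  show "?t j > 0" for j by (rule monomial_1_pos)
  show "?g 0 > 0"
  proof -
    let ?a = "\<lambda>i. q 0 (vertex i)"
    have "q 0 x = harmonic ?a x" if "x \<in> gasket" for x
      by (rule harmonic_unique[OF monomial_0_laplacian[OF q] refl that refl])
    then have "has_tangential_derivative (q 0) 0 (?a 1 - ?a 2)"
      using tangential_derivative_cong[of "q 0" "harmonic ?a"] harmonic_tangential_derivative[of ?a]
      by blast
    from tangential_derivative_unique[OF this monomial_jet(3)[OF q]] v2[of 0]
    have "2 * q 0 (vertex 1) = 1" by simp
    then show ?thesis by simp
  qed
  fix j
  show "5 ^ Suc j * ?g j - ?g j = 4 * (\<Sum>l\<le>j. ?t l * ?g (j - l))"
    using mean_value_formula[OF p monomials_eigen_sequence[OF q], of 0 1 j] fold_cells_01[of "q j"]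
      monomial_jet(1)[OF q, of j] mid[of j]
    by (simp add: c1[simplified] c2[simplified] sum_distrib_left mult.assoc)
qed

end

end

section \<open>Invertibility\<close>

text \<open>A nonzero polynomial of degree below \<open>m\<close> has fewer than \<open>m\<close>
  roots.\<close>

lemma power_sums_zero:
  fixes f :: "nat \<Rightarrow> real"
  assumes "\<And>x. x \<in> S \<Longrightarrow> (\<Sum>r<m. f r * x ^ r) = 0" "card S \<ge> m" "finite S" "r < m"
  shows "f r = 0"
proof -
  let ?p = "\<Sum>r<m. monom (f r) r"
  have coeff: "coeff ?p i = (if i < m then f i else 0)" for i
    by (simp add: coeff_sum)
  have "?p = 0"
  proof (rule ccontr)
    assume nz: "?p \<noteq> 0"
    then have "degree ?p < m"
      by (metis coeff leading_coeff_0_iff)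
    moreover have "S \<subseteq> {x. poly ?p x = 0}"
      using assms(1) by (auto simp: poly_sum poly_monom)
    then have "card S \<le> degree ?p"
      using card_mono[OF poly_roots_finite[OF nz]] card_poly_roots_bound[OF nz] by (meson order_trans)
    ultimately show False using assms(2) by simp
  qed
  with coeff[of r] assms(4) show ?thesis by simp
qed

text \<open>The left kernel is used because a row vector assigns a weight to each interpolation
  point, and each monomial then yields one equation in powers of its scaling factor.\<close>

lemma invertible_mat_left_kernel:
  fixes M :: "real mat"
  assumes M: "M \<in> carrier_mat N N"
    and kernel: "\<And>v. (\<And>c. c < N \<Longrightarrow> (\<Sum>r<N. v r * M $$ (r, c)) = 0) \<Longrightarrow> (\<And>r. r < N \<Longrightarrow> v r = 0)"
  shows "invertible_mat M"
proof -
  have "det (transpose_mat M) \<noteq> 0"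
  proof
    assume "det (transpose_mat M) = 0"
    then obtain v where v: "v \<in> carrier_vec N" "v \<noteq> 0\<^sub>v N" "transpose_mat M *\<^sub>v v = 0\<^sub>v N"
      using det_0_iff_vec_prod_zero_field[of "transpose_mat M" N] M by auto
    have "(\<Sum>r<N. vec_index v r * M $$ (r, c)) = 0" if c: "c < N" for c
    proof -
      have "vec_index (transpose_mat M *\<^sub>v v) c = (\<Sum>r<N. vec_index v r * M $$ (r, c))"
        using M v(1) c by (simp add: scalar_prod_def atLeast0LessThan mult.commute)
      with v(3) c show ?thesis by simp
    qed
    then have "vec_index v r = 0" if "r < N" for r using kernel[of "vec_index v"] that by blast
    with v(1) have "v = 0\<^sub>v N" by (intro eq_vecI) auto
    with v(2) show False by simp
  qed
  then have "det M \<noteq> 0" by (simp add: det_transpose[OF M])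
  from det_non_zero_imp_unit[OF M this, of "()"] obtain B where
    "B \<in> carrier_mat N N" "M * B = 1\<^sub>m N" "B * M = 1\<^sub>m N"
    unfolding Units_def ring_mat_simps by auto
  with M show ?thesis
    unfolding invertible_mat_def inverts_mat_def square_mat.simps by (intro conjI exI[of _ B]) auto
qed

lemma sum_lessThan_add:
  fixes f :: "nat \<Rightarrow> real"
  shows "(\<Sum>i<a + b. f i) = (\<Sum>i<a. f i) + (\<Sum>i<b. f (a + i))"
  by (induction b) simp_all

lemma scale_nodes:
  "card ((\<lambda>j. 1 / 5 ^ j :: real) ` {..n} \<union> (\<lambda>j. 3/5 / 5 ^ j) ` {..n}) = 2 * n + 2"
proof -
  have "inj_on (\<lambda>j. 1 / 5 ^ j :: real) {..n}" "inj_on (\<lambda>j. 3/5 / 5 ^ j :: real) {..n}"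
    by (auto simp: inj_on_def field_simps)
  then have "card ((\<lambda>j. 1 / 5 ^ j :: real) ` {..n}) = Suc n"
    "card ((\<lambda>j. 3/5 / 5 ^ j :: real) ` {..n}) = Suc n"
    by (simp_all add: card_image)
  moreover have "(\<lambda>j. 1 / 5 ^ j :: real) ` {..n} \<inter> (\<lambda>j. 3/5 / 5 ^ j) ` {..n} = {}"
  proof -
    have "(1 / 5 ^ i :: real) \<noteq> 3/5 / 5 ^ j" for i j
    proof
      assume "(1 / 5 ^ i :: real) = 3/5 / 5 ^ j"
      \<comment> \<open>\<open>3 * 5 ^ i\<close> lies strictly between two consecutive powers of 5,
        so comparing exponents refutes this.\<close>
      then have eq: "(5::real) ^ Suc j = 3 * 5 ^ i" by (simp add: field_simps)
      show False
      proof (cases "i \<le> j")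
        case True
        then have "(5::real) ^ Suc j \<ge> 5 ^ Suc i" by (intro power_increasing) auto
        with eq have "5 * 5 ^ i \<le> 3 * (5::real) ^ i" by simp
        then show False by simp
      next
        case False
        then have "(5::real) ^ Suc j \<le> 5 ^ i" by (intro power_increasing) auto
        with eq have "3 * 5 ^ i \<le> (5::real) ^ i" by simp
        then show False by simp
      qed
    qed
    then show ?thesis by blast
  qed
  ultimately show ?thesis by (simp add: card_Un_disjoint)
qed

theorem lemma4p2:
  fixes \<mu> :: "point measure" and P :: "nat \<Rightarrow> nat \<Rightarrow> point \<Rightarrow> real"
    and n :: nat and \<sigma> :: "nat \<Rightarrow> nat \<times> nat"
  assumes "gasket_measure \<mu>"
    and "\<And>j k. k \<in> {1, 2, 3} \<Longrightarrow> is_monomial \<mu> j k (P j k)"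
    and "\<And>j. P j 2 (vertex 1) \<noteq> 0"
    and "bij_betw \<sigma> {0..<3 * n + 3} ({0..n} \<times> {1, 2, 3})"
  shows "invertible_mat (interp_matrix P \<sigma> n)"
proof -
  interpret gasket_space \<mu> by unfold_locales (rule assms(1))
  have mono: "is_monomial \<mu> j 1 (P j 1)" "is_monomial \<mu> j 2 (P j 2)" "is_monomial \<mu> j 3 (P j 3)" for j
    by (rule assms(2), simp)+
  have nz: "P j k (vertex 1) \<noteq> 0" if "k \<in> {1,2,3}" for j k
    using monomial_1_pos[of "\<lambda>j. P j 1" j] monomial_3_pos[of "\<lambda>j. P j 1" "\<lambda>j. P j 3" j] mono assms(3)[of j] that
    by auto
  let ?N = "2 * n + 2 + (n + 1)"
  show ?thesis
  proof (rule invertible_mat_left_kernel)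
    have N: "?N = 3 * n + 3" by simp
    show "interp_matrix P \<sigma> n \<in> carrier_mat ?N ?N" unfolding N interp_matrix_def by simp
    fix v :: "nat \<Rightarrow> real" and r
    assume ker: "\<And>c. c < ?N \<Longrightarrow> (\<Sum>r<?N. v r * interp_matrix P \<sigma> n $$ (r, c)) = 0" and r: "r < ?N"
    \<comment> \<open>The weights on the orbit of \<open>vertex 2\<close>, padded with zeros to
      length \<open>2 * n + 2\<close> so that they can be added to those on the orbit of
      \<open>vertex 1\<close>.\<close>
    define w where "w m = (if m < n + 1 then v (2 * n + 2 + m) else 0)" for m
    have w_sum: "(\<Sum>m<2 * n + 2. w m * s ^ m) = (\<Sum>m<n + 1. w m * s ^ m)" for s :: real
      by (rule sum.mono_neutral_right) (auto simp: w_def)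
    \<comment> \<open>Along the orbit of \<open>vertex 1\<close> the monomial takes the values
      \<open>P j k (vertex 1) * s ^ m\<close>, and along the orbit of \<open>vertex 2\<close> the
      same times \<open>e\<close>. Cancelling the nonzero common factor turns its column into an
      equation in powers of \<open>s\<close>.\<close>
    have eqn: "(\<Sum>m<2 * n + 2. v m * s ^ m) + e * (\<Sum>m<n + 1. w m * s ^ m) = 0"
      if j: "j \<le> n" and k: "k \<in> {1,2,3}" and s: "s = scale_factor k / 5 ^ j"
        and e: "e = (if k = 3 then -1 else 1)" for j k s e
    proof -
      have mon: "\<And>j. is_monomial \<mu> j k (P j k)" using assms(2) k by blast
      have "(j, k) \<in> {0..n} \<times> {1, 2, 3}" using j k by auto
      then obtain c where c: "c \<in> {0..<3 * n + 3}" "\<sigma> c = (j, k)"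
        using assms(4) by (metis (no_types, lifting) bij_betw_imp_surj_on imageE)
      then have cN: "c < ?N" by simp
      have entry: "interp_matrix P \<sigma> n $$ (r, c) = P j k (interp_point n (r + 1))" if "r < ?N" for r
        using that c by (simp add: interp_matrix_def)
      have e2: "P j k (vertex 2) = e * P j k (vertex 1)"
        using monomial_reflection[of k "\<lambda>j. P j k", OF mon vertex_in_gasket, of j 1] by (simp add: e)
      have "0 = (\<Sum>r<?N. v r * P j k (interp_point n (r + 1)))"
        using ker[OF cN] by (simp add: entry)
      also have "\<dots> = (\<Sum>r<2 * n + 2. v r * P j k (interp_point n (r + 1))) +
          (\<Sum>m<n + 1. v (2 * n + 2 + m) * P j k (interp_point n (2 * n + 2 + m + 1)))"
        by (rule sum_lessThan_add)
      also have "(\<Sum>r<2 * n + 2. v r * P j k (interp_point n (r + 1))) =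
          P j k (vertex 1) * (\<Sum>r<2 * n + 2. v r * s ^ r)"
        unfolding sum_distrib_left
        by (intro sum.cong refl)
          (simp add: interp_point_def s monomial_contraction_power[of k "\<lambda>j. P j k", OF mon vertex_in_gasket, simplified])
      also have "(\<Sum>m<n + 1. v (2 * n + 2 + m) * P j k (interp_point n (2 * n + 2 + m + 1))) =
          P j k (vertex 1) * (e * (\<Sum>m<n + 1. w m * s ^ m))"
        unfolding sum_distrib_left
        by (intro sum.cong refl)
          (simp add: interp_point_def s e2 w_def monomial_contraction_power[of k "\<lambda>j. P j k", OF mon vertex_in_gasket])
      finally have "P j k (vertex 1) * ((\<Sum>m<2 * n + 2. v m * s ^ m) + e * (\<Sum>m<n + 1. w m * s ^ m)) = 0"
        by (simp add: distrib_left)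
      with nz[OF k, of j] show ?thesis by simp
    qed
    let ?S = "(\<lambda>j. 1 / 5 ^ j :: real) ` {..n} \<union> (\<lambda>j. 3/5 / 5 ^ j) ` {..n}"
    \<comment> \<open>The even types \<open>k = 1\<close> and \<open>k = 2\<close> have
      \<open>e = 1\<close> and together supply \<open>2 * n + 2\<close> distinct nodes.\<close>
    have vw: "v m + w m = 0" if m: "m < 2 * n + 2" for m
    proof (rule power_sums_zero[where S = ?S and m = "2 * n + 2" and f = "\<lambda>m. v m + w m"])
      fix x assume "x \<in> ?S"
      then consider j where "j \<le> n" "x = 1 / 5 ^ j" | j where "j \<le> n" "x = 3/5 / 5 ^ j" by auto
      then have "(\<Sum>m<2 * n + 2. v m * x ^ m) + 1 * (\<Sum>m<n + 1. w m * x ^ m) = 0"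
      proof cases
        case 1
        then show ?thesis by (intro eqn[of _ 1]) (simp_all add: scale_factor_def)
      next
        case 2
        then show ?thesis by (intro eqn[of _ 2]) (simp_all add: scale_factor_def)
      qed
      then show "(\<Sum>m<2 * n + 2. (v m + w m) * x ^ m) = 0"
        by (simp only: distrib_right sum.distrib w_sum mult_1)
    qed (use m scale_nodes[of n] in simp_all)
    let ?S3 = "(\<lambda>j. 1/5 / 5 ^ j :: real) ` {..n}"
    \<comment> \<open>For \<open>k = 3\<close> the sign is -1. As \<open>v\<close> is already
      \<open>- w\<close> on the first orbit, the equation says that minus twice the polynomial of
      \<open>w\<close> vanishes at \<open>n + 1\<close> nodes.\<close>
    have w0: "w m = 0" if m: "m < n + 1" for m
    proof (rule power_sums_zero[where S = ?S3 and m = "n + 1" and f = w])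
      fix x assume "x \<in> ?S3"
      then obtain j where j: "j \<le> n" "x = 1/5 / 5 ^ j" by auto
      have "(\<Sum>m<2 * n + 2. v m * x ^ m) + (-1) * (\<Sum>m<n + 1. w m * x ^ m) = 0"
        using j by (intro eqn[of _ 3]) (simp_all add: scale_factor_def)
      moreover have "(\<Sum>m<2 * n + 2. v m * x ^ m) = - (\<Sum>m<2 * n + 2. w m * x ^ m)"
        unfolding sum_negf[symmetric]
      proof (rule sum.cong[OF refl])
        fix m assume "m \<in> {..<2 * n + 2}"
        then have "v m = - w m" using vw[of m] by simp
        then show "v m * x ^ m = - (w m * x ^ m)" by simp
      qed
      ultimately show "(\<Sum>m<n + 1. w m * x ^ m) = 0" unfolding w_sum by linarith
    next
      have "inj_on (\<lambda>j. 1/5 / 5 ^ j :: real) {..n}" by (auto simp: inj_on_def)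
      then show "n + 1 \<le> card ?S3" by (simp add: card_image)
    qed (use m in simp_all)
    show "v r = 0"
    proof (cases "r < 2 * n + 2")
      case True
      have "w r = 0" using w0[of r] by (cases "r < n + 1") (simp_all add: w_def)
      with vw[OF True] show ?thesis by simp
    next
      case False
      then obtain m where m: "r = 2 * n + 2 + m" using le_Suc_ex not_less by blast
      with r have "m < n + 1" by simp
      with w0[of m] show ?thesis by (simp add: w_def m)
    qed
  qed
qed

end
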